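(* Let $N\ge 2$, let $\Omega\subset\mathbb{R}^N$ be an open connected set, and let $p>1$, $s\in(0,1)$ be real numbers such that $ps<N$, and $0<\Lambda_1\le\Lambda_2$. Then there exist $\alpha\in(0,1)$ and $C>0$, depending only on $N,p,s,\Omega,\Lambda_1,\Lambda_2$, with the following property. Let $K:\mathbb{R}^N\times\mathbb{R}^N\to\mathbb{R}$ be a measurable function such that for a.e. $(x,y)\in\mathbb{R}^N\times\mathbb{R}^N$ one has $K(x,y)=K(y,x)$ and $\Lambda_1\le K(x,y)|x-y|^{N+ps}\le\Lambda_2$, and let $u$ be a locally bounded, local weak solution of $\mathcal{L}_K u=0$ in $\Omega$. Then $u\in C^{0,\alpha}_{\rm loc}(\Omega)$. Moreover, for all $\Omega'\Subset\Omega$ such that ${\rm dist}(\Omega',\partial\Omega)=2R>0$, and all $x_1,x_2\in\Omega'$, $$|u(x_1)-u(x_2)|\le C\sup_{x\in\Omega'_R}\big[|u(x)|+{\rm Tail}(u,x,R)\big]\Big(\frac{|x_1-x_2|}{R}\Big)^\alpha,$$ where $\Omega'_R=\{x\in\Omega:\ {\rm dist}(x,\Omega')\le R\}$.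
   Context: For a measurable function $u:U\to\mathbb{R}$ on an open set $U\subseteq\mathbb{R}^N$, let $[u]_{s,p,U}=\Big[\iint_{U\times U}\frac{|u(x)-u(y)|^p}{|x-y|^{N+ps}}\,dx\,dy\Big]^{1/p}$ and $W^{s,p}(U)=\{u\in L^p(U):[u]_{s,p,U}<\infty\}$. For bounded $U$, let $\widetilde W^{s,p}(U)$ be the set of all $u\in L^p_{\rm loc}(\mathbb{R}^N)$ such that $u\in W^{s,p}(U')$ for some $U'\Supset U$ and $\int_{\mathbb{R}^N}\frac{|u(x)|^{p-1}}{(1+|x|)^{N+ps}}\,dx<\infty$. For general $\Omega$, $\widetilde W^{s,p}_{\rm loc}(\Omega)=\{u\in L^p_{\rm loc}(\mathbb{R}^N): u\in\widetilde W^{s,p}(\Omega')$ for all bounded $\Omega'\subseteq\Omega\}$. The operator is heuristically $\mathcal{L}_Ku(x)=\lim_{\varepsilon\to0^+}\int_{\mathbb{R}^N\setminus B_\varepsilon(x)}|u(x)-u(y)|^{p-2}(u(x)-u(y))K(x,y)\,dy$. A function $u\in\widetilde W^{s,p}_{\rm loc}(\Omega)$ is a (local weak) supersolution of $\mathcal{L}_Ku=0$ in $\Omega$ if for all $\varphi\in C^1_c(\Omega)$ with $\varphi\ge0$, $$\iint_{\mathbb{R}^N\times\mathbb{R}^N}|u(x)-u(y)|^{p-2}(u(x)-u(y))(\varphi(x)-\varphi(y))K(x,y)\,dx\,dy\ge0;$$ it is a subsolution if the same holds with $\le0$; it is a solution if it is both. Locally bounded means $u\in L^\infty_{\rm loc}(\Omega)$.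 The nonlocal tail of a measurable function $v$ is ${\rm Tail}(v,x_0,R)=\Big[R^{ps}\int_{\mathbb{R}^N\setminus B_R(x_0)}\frac{|v(x)|^{p-1}}{|x-x_0|^{N+ps}}\,dx\Big]^{\frac{1}{p-1}}$. $B_R(x_0)$ is the open ball of radius $R$ centered at $x_0$. Suprema of measurable functions are essential suprema. $u\in C^{0,\alpha}_{\rm loc}(\Omega)$ is understood up to a.e. equality, and pointwise values of $u$ in $\Omega$ refer to its continuous representative. *)

theory Defs
  imports "HOL-Probability.Essential_Supremum"
begin

definition enn_powr :: "ennreal \<Rightarrow> real \<Rightarrow> ennreal" where
  "enn_powr x a = (if x = \<infinity> then \<infinity> else ennreal (enn2real x powr a))"
  \<comment> \<open>only used with exponents \<open>a > 0\<close>\<close>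

definition compactly_in :: "'a::topological_space set \<Rightarrow> 'a set \<Rightarrow> bool" (infix "\<Subset>" 50) where
  "A \<Subset> B \<longleftrightarrow> compact (closure A) \<and> closure A \<subseteq> B"

definition Lp :: "real \<Rightarrow> 'a::euclidean_space set \<Rightarrow> ('a \<Rightarrow> real) set" where
  "Lp p U = {u. u \<in> borel_measurable (lebesgue_on U) \<and>
                (\<integral>\<^sup>+x. ennreal (\<bar>u x\<bar> powr p) \<partial>lebesgue_on U) < \<infinity>}"

definition Lp_loc :: "real \<Rightarrow> 'a::euclidean_space set \<Rightarrow> ('a \<Rightarrow> real) set" where
  "Lp_loc p U = {u. \<forall>A. compact A \<and> A \<subseteq> U \<longrightarrow> u \<in> Lp p A}"

definition Linf_loc :: "'a::euclidean_space set \<Rightarrow> ('a \<Rightarrow> real) set" where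
  "Linf_loc U = {u. \<forall>A. compact A \<and> A \<subseteq> U \<longrightarrow>
     u \<in> borel_measurable (lebesgue_on A) \<and> (\<exists>M. AE x in lebesgue_on A. \<bar>u x\<bar> \<le> M)}"

definition gagliardo :: "real \<Rightarrow> real \<Rightarrow> 'a::euclidean_space set \<Rightarrow> ('a \<Rightarrow> real) \<Rightarrow> ennreal" where
  "gagliardo s p U u =
     enn_powr (\<integral>\<^sup>+(x, y). ennreal (\<bar>u x - u y\<bar> powr p / norm (x - y) powr (real DIM('a) + p * s))
                 \<partial>lebesgue_on (U \<times> U)) (1 / p)"

definition Wsp :: "real \<Rightarrow> real \<Rightarrow> 'a::euclidean_space set \<Rightarrow> ('a \<Rightarrow> real) set" where
  "Wsp s p U = {u \<in> Lp p U. gagliardo s p U u < \<infinity>}"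

text \<open>The following space is meant for bounded open \<open>U\<close>.\<close>

definition Wsp_tilde :: "real \<Rightarrow> real \<Rightarrow> 'a::euclidean_space set \<Rightarrow> ('a \<Rightarrow> real) set" where
  "Wsp_tilde s p U = {u \<in> Lp_loc p UNIV.
     (\<exists>U'. open U' \<and> U \<Subset> U' \<and> u \<in> Wsp s p U') \<and>
     (\<integral>\<^sup>+x. ennreal (\<bar>u x\<bar> powr (p - 1) / (1 + norm x) powr (real DIM('a) + p * s)) \<partial>lebesgue) < \<infinity>}"

definition Wsp_tilde_loc :: "real \<Rightarrow> real \<Rightarrow> 'a::euclidean_space set \<Rightarrow> ('a \<Rightarrow> real) set" where
  "Wsp_tilde_loc s p \<Omega> = {u \<in> Lp_loc p UNIV.
     \<forall>\<Omega>'. open \<Omega>' \<and> bounded \<Omega>' \<and> \<Omega>' \<subseteq> \<Omega> \<longrightarrow> u \<in> Wsp_tilde s p \<Omega>'}"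

definition C1c :: "'a::euclidean_space set \<Rightarrow> ('a \<Rightarrow> real) set" where
  "C1c \<Omega> = {\<phi>. (\<exists>D. (\<forall>x. (\<phi> has_derivative blinfun_apply (D x)) (at x)) \<and> continuous_on UNIV D)
              \<and> support_on UNIV \<phi> \<Subset> \<Omega>}"

text \<open>The Bochner integral is \<open>0\<close> by convention when the integrand is not integrable. For
  \<open>u \<in> Wsp_tilde_loc s p \<Omega>\<close>, \<open>\<phi> \<in> C1c \<Omega>\<close> and a measurable kernel with \<open>\<bar>K (x, y)\<bar> \<le> \<Lambda> / \<bar>x - y\<bar>\<^sup>N\<^sup>+\<^sup>p\<^sup>s\<close>
  the integrand below is always integrable, by Hoelder's inequality near the support of \<open>\<phi>\<close> and the
  weighted integrability of \<open>u\<close> away from it.\<close>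

definition weak_form ::
  "real \<Rightarrow> ('a \<times> 'a \<Rightarrow> real) \<Rightarrow> ('a::euclidean_space \<Rightarrow> real) \<Rightarrow> ('a \<Rightarrow> real) \<Rightarrow> real" where
  "weak_form p K u \<phi> =
     (\<integral>(x, y). \<bar>u x - u y\<bar> powr (p - 2) * (u x - u y) * (\<phi> x - \<phi> y) * K (x, y) \<partial>lebesgue)"

definition weak_supersolution ::
  "real \<Rightarrow> real \<Rightarrow> ('a \<times> 'a \<Rightarrow> real) \<Rightarrow> 'a::euclidean_space set \<Rightarrow> ('a \<Rightarrow> real) \<Rightarrow> bool" where
  "weak_supersolution s p K \<Omega> u \<longleftrightarrow> u \<in> Wsp_tilde_loc s p \<Omega> \<and>
     (\<forall>\<phi>\<in>C1c \<Omega>. (\<forall>x. \<phi> x \<ge> 0) \<longrightarrow> weak_form p K u \<phi> \<ge> 0)"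

definition weak_subsolution ::
  "real \<Rightarrow> real \<Rightarrow> ('a \<times> 'a \<Rightarrow> real) \<Rightarrow> 'a::euclidean_space set \<Rightarrow> ('a \<Rightarrow> real) \<Rightarrow> bool" where
  "weak_subsolution s p K \<Omega> u \<longleftrightarrow> u \<in> Wsp_tilde_loc s p \<Omega> \<and>
     (\<forall>\<phi>\<in>C1c \<Omega>. (\<forall>x. \<phi> x \<ge> 0) \<longrightarrow> weak_form p K u \<phi> \<le> 0)"

definition weak_solution ::
  "real \<Rightarrow> real \<Rightarrow> ('a \<times> 'a \<Rightarrow> real) \<Rightarrow> 'a::euclidean_space set \<Rightarrow> ('a \<Rightarrow> real) \<Rightarrow> bool" where
  "weak_solution s p K \<Omega> u \<longleftrightarrow> weak_supersolution s p K \<Omega> u \<and> weak_subsolution s p K \<Omega> u"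

definition Tail :: "real \<Rightarrow> real \<Rightarrow> ('a::euclidean_space \<Rightarrow> real) \<Rightarrow> 'a \<Rightarrow> real \<Rightarrow> ennreal" where
  "Tail s p v x0 R =
     enn_powr (ennreal (R powr (p * s)) *
       (\<integral>\<^sup>+x. ennreal (\<bar>v x\<bar> powr (p - 1) / norm (x - x0) powr (real DIM('a) + p * s))
          \<partial>lebesgue_on (- ball x0 R))) (1 / (p - 1))"

definition locally_holder :: "real \<Rightarrow> 'a::metric_space set \<Rightarrow> ('a \<Rightarrow> real) \<Rightarrow> bool" where
  "locally_holder \<alpha> \<Omega> v \<longleftrightarrow>
     (\<forall>A. A \<Subset> \<Omega> \<longrightarrow> (\<exists>M. \<forall>x\<in>A. \<forall>y\<in>A. \<bar>v x - v y\<bar> \<le> M * dist x y powr \<alpha>))"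

end

theory Submission
  imports Defs
begin

text \<open>
  Write \<open>N\<close> for the dimension, \<open>q = N + p s\<close>, and \<open>J t = |t| powr (p - 2) * t\<close>.  The proof is De Giorgi's
  method.  What makes it short in the nonlocal setting is that the equation itself couples the points where \<open>u\<close>
  lies above a level with the points where it lies below.

  Let \<open>u \<le> k + \<tau>\<close> in a ball and let \<open>g\<close> be a Lipschitz barrier that equals \<open>k\<close> in a small concentric ball and
  \<open>k + \<tau>\<close> away from it.  Then \<open>w = (u - g)\<^sup>+\<close> vanishes near the boundary of the ball and may be used as a test
  function.  With \<open>m = (g - u)\<^sup>+\<close> the weak inequality gives (\<open>cut_energy_estimate\<close>)

  \<open>\<integral>\<integral> w(x) m(y) powr (p - 1) |x - y| powr (- q) \<le> C (\<tau> powr p + \<tau> * T) * |{u > k}|\<close>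

  up to powers of the radii, where \<open>T\<close> is the contribution of \<open>(u - k)\<^sup>+\<close> outside the ball.  If every point has nearby a fixed
  amount of points with \<open>u \<le> k - l\<close>, the left side is bounded below by a multiple of \<open>|{u > k + h}|\<close>
  (\<open>level_step\<close>).  This is used in two ways.  If \<open>u \<le> M\<close> in a ball and \<open>u \<le> M - H\<close> in half of it, the choice
  \<open>k = M - \<tau> H\<close> shows that \<open>{u > M - \<tau> H / 2}\<close> has measure of order \<open>\<tau> powr (p - 1)\<close> in a smaller ball
  (\<open>measure_shrinking\<close>).  And once a superlevel set is small, most of every ball of comparable measure lies below
  the level; the singularity of the kernel then turns smallness of one superlevel set into a smaller factor
  for the next, and an iteration over levels and radii empties the last one (\<open>de_giorgi\<close>).  Together they show that the
  supremum drops by \<open>\<tau> H / 4\<close> in a ball of an eighth of the radius (\<open>growth_lemma\<close>).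

  In every ball either \<open>u\<close> or \<open>- u\<close> satisfies the half-ball condition at the middle of its range, so the
  oscillation decays geometrically along the radii \<open>R / 8 ^ j\<close> (\<open>oscillation_decay\<close>).  The exterior term \<open>T\<close> is
  controlled by the bounds on the larger balls, which grow slowly if the Hoelder exponent is small, and by the tail
  of \<open>u\<close> beyond the first ball (\<open>tail_control\<close>).

  Two passages to the limit frame this argument.  The weak formulation speaks of test functions of class \<open>C\<^sup>1\<close>
  only, and \<open>w\<close> has the regularity of \<open>u\<close>; it is reached by mollification (\<open>weak_testfun\<close>).  And the decay gives
  a precise value of \<open>u\<close> at every point of the domain, which is the continuous representative
  (\<open>ess_limit_holder\<close>, \<open>ess_limit_ae\<close>).
\<close>

section \<open>Scalar inequalities and radial kernels\<close>

lemma powr_add_le: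
  fixes a b p :: real
  assumes "0 \<le> a" "0 \<le> b" "0 < p"
  shows "(a + b) powr p \<le> 2 powr p * (a powr p + b powr p)"
proof -
  have "(a + b) powr p \<le> (2 * max a b) powr p"
    using assms by (intro powr_mono2) auto
  also have "\<dots> = 2 powr p * max a b powr p"
    using assms by (simp add: powr_mult)
  also have "\<dots> \<le> 2 powr p * (a powr p + b powr p)"
    by (intro mult_left_mono) (auto simp: max_def)
  finally show ?thesis .
qed

text \<open>A tangent to a convex function lies below it; the inequality is Young's inequality in disguise and is
  integrated below to give Jensen's inequality.\<close>

lemma powr_above_tangent:
  fixes x a p :: real
  assumes "1 < p" "0 \<le> x" "0 \<le> a"
  shows "a powr p + p * a powr (p - 1) * (x - a) \<le> x powr p"
proof -
  define q where "q = p / (p - 1)"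
  have q: "q > 1" "1 / p + 1 / q = 1"
    using assms by (auto simp: q_def field_simps)
  have "x * a powr (p - 1) \<le> x powr p / p + (a powr (p - 1)) powr q / q"
    using assms q by (intro Youngs_inequality) auto
  also have "(a powr (p - 1)) powr q = a powr p"
    using assms by (simp add: powr_powr q_def)
  also have "a powr p / q = a powr p * (p - 1) / p"
    by (simp add: q_def)
  finally have "p * (x * a powr (p - 1)) \<le> x powr p + a powr p * (p - 1)"
    using assms by (simp add: field_simps)
  moreover have "a powr p = a powr (p - 1) * a"
    using assms by (cases "a = 0") (auto simp: powr_diff)
  ultimately show ?thesis
    by (simp add: algebra_simps)
qed

text \<open>The nonlinearity of the fractional \<open>p\<close>-Laplacian.\<close>

definition Jp :: "real \<Rightarrow> real \<Rightarrow> real" where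
  "Jp p t = \<bar>t\<bar> powr (p - 2) * t"

lemma Jp_minus [simp]: "Jp p (- t) = - Jp p t"
  by (simp add: Jp_def)

lemma abs_Jp: "\<bar>Jp p t\<bar> = \<bar>t\<bar> powr (p - 1)"
proof (cases "t = 0")
  case False
  then have "\<bar>t\<bar> powr (p - 1) = \<bar>t\<bar> powr (p - 2 + 1)" by simp
  also have "\<dots> = \<bar>t\<bar> powr (p - 2) * \<bar>t\<bar>"
    using False by (subst powr_add) simp
  finally show ?thesis by (simp add: Jp_def abs_mult)
qed (simp add: Jp_def)

lemma Jp_nonneg: "0 \<le> t \<Longrightarrow> Jp p t = t powr (p - 1)"
  using abs_Jp[of p t] by (simp add: Jp_def)

text \<open>For a point above the barrier and one below it, \<open>w + m + b\<close> is the difference of the values of \<open>u\<close>, with \<open>b\<close>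
  the difference of the values of the barrier.  If \<open>b\<close> is small compared with \<open>w + m\<close>, it does not spoil the
  sign; otherwise everything is of the order \<open>|b| powr p\<close>.\<close>

lemma Jp_lower_pos:
  fixes w m b p :: real
  assumes p: "1 < p" and w: "0 \<le> w" and m: "0 \<le> m"
  shows "(1/2) powr (p - 1) * (w * m powr (p - 1)) - (3 powr p + 2) * \<bar>b\<bar> powr p \<le> Jp p (w + m + b) * w"
proof (cases "w + m \<ge> 2 * \<bar>b\<bar>")
  case True
  then have t: "w + m + b \<ge> m / 2" "w + m + b \<ge> 0" using w m by auto
  have "(m/2) powr (p - 1) \<le> Jp p (w + m + b)"
    using t p m by (subst Jp_nonneg) (auto intro!: powr_mono2)
  then have "(m/2) powr (p - 1) * w \<le> Jp p (w + m + b) * w"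
    using w by (intro mult_right_mono)
  moreover have "(m/2) powr (p - 1) = (1/2) powr (p - 1) * m powr (p - 1)"
    using m by (simp add: powr_divide)
  moreover have "0 \<le> (3 powr p + 2) * \<bar>b\<bar> powr p" by simp
  ultimately show ?thesis by (metis (no_types, lifting) diff_ge_0_iff_ge diff_left_mono diff_zero mult.assoc mult.commute order_trans)
next
  case False
  have bb: "\<bar>b\<bar> powr p = \<bar>b\<bar> powr (p - 1) * \<bar>b\<bar>"
    using False w m by (simp add: powr_diff)
  have "\<bar>Jp p (w + m + b) * w\<bar> = \<bar>w + m + b\<bar> powr (p - 1) * w"
    using w by (simp add: abs_mult abs_Jp)
  also have "\<dots> \<le> (3 * \<bar>b\<bar>) powr (p - 1) * (2 * \<bar>b\<bar>)"
    using False w m p by (intro mult_mono powr_mono2) auto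
  also have "\<dots> = 2 * 3 powr (p - 1) * \<bar>b\<bar> powr p"
    by (simp add: powr_mult bb)
  also have "\<dots> \<le> 3 powr p * \<bar>b\<bar> powr p"
    by (intro mult_right_mono) (auto simp: powr_diff)
  finally have A: "\<bar>Jp p (w + m + b) * w\<bar> \<le> 3 powr p * \<bar>b\<bar> powr p" .
  have "(1/2) powr (p - 1) * (w * m powr (p - 1)) = w * (m/2) powr (p - 1)"
    using m by (simp add: powr_divide)
  also have "\<dots> \<le> (2 * \<bar>b\<bar>) * \<bar>b\<bar> powr (p - 1)"
    using False w m p by (intro mult_mono powr_mono2) auto
  also have "\<dots> = 2 * \<bar>b\<bar> powr p" by (simp add: bb)
  finally show ?thesis using A by (simp add: algebra_simps)
qed

lemma Jp_lower:
  fixes d b p :: real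
  assumes p: "1 < p"
  shows "- ((3 powr p + 2) * \<bar>b\<bar> powr p) \<le> Jp p (d + b) * d"
proof (cases "d \<ge> 0")
  case True
  then show ?thesis using Jp_lower_pos[OF p, of d 0 b] p by simp
next
  case False
  have "- d + - b = - (d + b)" by simp
  then have "Jp p (- d + - b) = - Jp p (d + b)" by (metis Jp_minus)
  then show ?thesis using Jp_lower_pos[OF p, of "-d" 0 "-b"] False p by simp
qed

lemma Jp_measurable [measurable]: "Jp p \<in> borel_measurable borel"
  unfolding Jp_def by measurable

lemma geometric_scale:
  fixes b t :: real
  assumes "1 < b" "1 \<le> t"
  obtains j :: nat where "b ^ j \<le> t" "t < b ^ Suc j"
proof -
  obtain n where n: "t < b ^ n" using real_arch_pow[OF assms(1)] by blast
  define m where "m = (LEAST n. t < b ^ n)"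
  have m: "t < b ^ m" unfolding m_def using n by (rule LeastI)
  then have "m \<noteq> 0" using assms by (cases m) auto
  then obtain j where j: "m = Suc j" by (cases m) auto
  have "\<not> t < b ^ j" using j unfolding m_def by (metis lessI not_less_Least)
  then show ?thesis using that[of j] m j by auto
qed

lemma powr_power_commute: "((b::real) ^ j) powr c = (b powr c) ^ j" if "0 < b"
  using that by (simp add: powr_powr powr_realpow[symmetric] mult.commute)

text \<open>Bounds a radial integral by comparison with a step function on dyadic annuli.\<close>

lemma nn_integral_geometric_cover:
  fixes f :: "'a::euclidean_space \<Rightarrow> ennreal" and c \<rho> :: "nat \<Rightarrow> real"
  assumes cov: "\<And>y. f y \<noteq> 0 \<Longrightarrow> \<exists>j. f y \<le> ennreal (c j) * indicator (cball x0 (\<rho> j)) y"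
    and c: "\<And>j. 0 \<le> c j" and \<rho>: "\<And>j. 0 \<le> \<rho> j"
    and geo: "\<And>j. c j * \<rho> j ^ DIM('a) = A * \<theta> ^ j" and th: "0 \<le> \<theta>" "\<theta> < 1" and A: "0 \<le> A"
  shows "(\<integral>\<^sup>+y. f y \<partial>lborel) \<le> ennreal (unit_ball_vol (real DIM('a)) * A / (1 - \<theta>))"
proof -
  let ?g = "\<lambda>j y. ennreal (c j) * indicator (cball x0 (\<rho> j)) y"
  have "(\<integral>\<^sup>+y. f y \<partial>lborel) \<le> (\<integral>\<^sup>+y. (\<Sum>j. ?g j y) \<partial>lborel)"
  proof (rule nn_integral_mono)
    fix y
    show "f y \<le> (\<Sum>j. ?g j y)"
    proof (cases "f y = 0")
      case False
      then obtain j where "f y \<le> ?g j y" using cov by blast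
      also have "?g j y = (\<Sum>i\<in>{j}. ?g i y)"
        by (subst sum.insert) auto
      also have "\<dots> \<le> (\<Sum>j. ?g j y)"
        by (intro sum_le_suminf) auto
      finally show ?thesis .
    qed simp
  qed
  also have "\<dots> = (\<Sum>j. \<integral>\<^sup>+y. ?g j y \<partial>lborel)"
    by (intro nn_integral_suminf borel_measurable_times_ennreal borel_measurable_indicator) auto
  also have "\<dots> = (\<Sum>j. ennreal (unit_ball_vol (real DIM('a)) * A * \<theta> ^ j))"
  proof (rule suminf_cong)
    fix j
    have "(\<integral>\<^sup>+y. ?g j y \<partial>lborel) = ennreal (c j) * emeasure lborel (cball x0 (\<rho> j))"
      by (subst nn_integral_cmult_indicator) auto
    also have "\<dots> = ennreal (c j * (unit_ball_vol (real DIM('a)) * \<rho> j ^ DIM('a)))"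
      using c \<rho> by (subst emeasure_cball) (auto simp: ennreal_mult')
    also have "c j * (unit_ball_vol (real DIM('a)) * \<rho> j ^ DIM('a)) = unit_ball_vol (real DIM('a)) * A * \<theta> ^ j"
      using geo[of j] by (metis mult.commute mult.assoc)
    finally show "(\<integral>\<^sup>+y. ?g j y \<partial>lborel) = ennreal (unit_ball_vol (real DIM('a)) * A * \<theta> ^ j)" .
  qed
  also have "\<dots> = ennreal (\<Sum>j. unit_ball_vol (real DIM('a)) * A * \<theta> ^ j)"
    using A th by (intro suminf_ennreal2) (auto intro!: summable_mult summable_geometric)
  also have "(\<Sum>j. unit_ball_vol (real DIM('a)) * A * \<theta> ^ j) = unit_ball_vol (real DIM('a)) * A / (1 - \<theta>)"
    using th by (subst suminf_mult) (auto simp: suminf_geometric summable_geometric)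
  finally show ?thesis .
qed

definition kernel_const :: "'a::euclidean_space itself \<Rightarrow> real \<Rightarrow> real" where
  "kernel_const T \<beta> = unit_ball_vol (real DIM('a)) * 2 ^ DIM('a) / (1 - 2 powr (- \<beta>))"

lemma kernel_const_pos: "0 < \<beta> \<Longrightarrow> 0 < kernel_const (T :: 'a::euclidean_space itself) \<beta>"
  unfolding kernel_const_def by (intro divide_pos_pos mult_pos_pos) (auto simp: powr_minus field_simps)

text \<open>On the annulus of radii \<open>2 ^ j r\<close> and \<open>2 ^ (j + 1) r\<close> the kernel is at most its value on the inner
  sphere; the annuli contribute a geometric series.\<close>

lemma kernel_far_integral:
  fixes x0 :: "'a::euclidean_space" and \<beta> r :: real
  assumes \<beta>: "0 < \<beta>" and r: "0 < r"
  shows "(\<integral>\<^sup>+y. ennreal (norm (y - x0) powr (- (real DIM('a) + \<beta>))) * indicator (- ball x0 r) y \<partial>lborel)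
    \<le> ennreal (kernel_const TYPE('a) \<beta> * r powr (- \<beta>))" (is "integral\<^sup>N _ ?f \<le> _")
proof -
  define \<theta> where "\<theta> = (2::real) powr (- \<beta>)"
  have th: "0 \<le> \<theta>" "\<theta> < 1" using \<beta> by (auto simp: \<theta>_def powr_minus field_simps)
    let ?c = "\<lambda>j. (2 ^ j * r) powr (- (real DIM('a) + \<beta>))" and ?\<rho> = "\<lambda>j. 2 ^ Suc j * r"
    have "integral\<^sup>N lborel ?f \<le> ennreal (unit_ball_vol (real DIM('a)) * (2 ^ DIM('a) * r powr (- \<beta>)) / (1 - \<theta>))"
    proof (rule nn_integral_geometric_cover[where c = ?c and \<rho> = ?\<rho> and ?x0.0 = x0])
      fix y assume "?f y \<noteq> 0"
      then have y: "r \<le> norm (y - x0)"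
        by (auto simp: indicator_def dist_norm norm_minus_commute split: if_splits)
      then have "1 \<le> norm (y - x0) / r" using r by simp
      with geometric_scale[of 2 "norm (y - x0) / r"] obtain j where
        j: "2 ^ j \<le> norm (y - x0) / r" "norm (y - x0) / r < 2 ^ Suc j" by auto
      then have j': "2 ^ j * r \<le> norm (y - x0)" "norm (y - x0) < 2 ^ Suc j * r"
        using r by (auto simp: field_simps)
      have "?f y \<le> ennreal (?c j) * indicator (cball x0 (?\<rho> j)) y"
        using j' r y \<beta> by (auto simp: indicator_def dist_norm norm_minus_commute
          intro!: powr_mono2')
      then show "\<exists>j. ?f y \<le> ennreal (?c j) * indicator (cball x0 (?\<rho> j)) y" by blast
    next
      fix j
      have "?\<rho> j ^ DIM('a) = 2 ^ DIM('a) * (2 ^ j * r) powr (real DIM('a))"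
        using r by (simp add: powr_realpow power_mult_distrib mult_ac)
      then have "?c j * ?\<rho> j ^ DIM('a) = 2 ^ DIM('a) * ((2 ^ j * r) powr (- (real DIM('a) + \<beta>)) * (2 ^ j * r) powr (real DIM('a)))"
        by simp
      also have "\<dots> = 2 ^ DIM('a) * (2 ^ j * r) powr (- \<beta>)"
        by (subst powr_add[symmetric]) simp
      also have "(2 ^ j * r) powr (- \<beta>) = r powr (- \<beta>) * \<theta> ^ j"
      proof -
        have "(2 ^ j * r) powr (- \<beta>) = ((2::real) ^ j) powr (- \<beta>) * r powr (- \<beta>)"
          by (rule powr_mult)
        also have "((2::real) ^ j) powr (- \<beta>) = \<theta> ^ j"
          unfolding \<theta>_def by (rule powr_power_commute) simp
        finally show ?thesis by simp
      qed
      finally show "?c j * ?\<rho> j ^ DIM('a) = 2 ^ DIM('a) * r powr (- \<beta>) * \<theta> ^ j" by simp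
    qed (use r th in auto)
    also have "unit_ball_vol (real DIM('a)) * (2 ^ DIM('a) * r powr (- \<beta>)) / (1 - \<theta>) = kernel_const TYPE('a) \<beta> * r powr (- \<beta>)"
      by (simp add: kernel_const_def \<theta>_def)
    finally show ?thesis .
qed

lemma kernel_near_integral:
  fixes x0 :: "'a::euclidean_space" and \<beta> r :: real
  assumes \<beta>: "0 < \<beta>" and r: "0 < r"
  shows "(\<integral>\<^sup>+y. ennreal (norm (y - x0) powr (\<beta> - real DIM('a))) * indicator (ball x0 r) y \<partial>lborel)
    \<le> ennreal (kernel_const TYPE('a) \<beta> * r powr \<beta>)" (is "integral\<^sup>N _ ?f \<le> _")
proof -
  define \<theta> where "\<theta> = (2::real) powr (- \<beta>)"
  have th: "0 \<le> \<theta>" "\<theta> < 1" using \<beta> by (auto simp: \<theta>_def powr_minus field_simps)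
    let ?c = "\<lambda>j. (r / 2 ^ j) powr \<beta> * (r / 2 ^ Suc j) powr (- real DIM('a))" and ?\<rho> = "\<lambda>j. r / 2 ^ j"
    have "integral\<^sup>N lborel ?f \<le> ennreal (unit_ball_vol (real DIM('a)) * (2 ^ DIM('a) * r powr \<beta>) / (1 - \<theta>))"
    proof (rule nn_integral_geometric_cover[where c = ?c and \<rho> = ?\<rho> and ?x0.0 = x0])
      fix y assume f0: "?f y \<noteq> 0"
      then have y: "norm (y - x0) < r" "0 < norm (y - x0)"
        by (auto simp: indicator_def dist_norm norm_minus_commute split: if_splits)
      then have "1 \<le> r / norm (y - x0)" by simp
      with geometric_scale[of 2 "r / norm (y - x0)"] obtain j where
        j: "2 ^ j \<le> r / norm (y - x0)" "r / norm (y - x0) < 2 ^ Suc j" by auto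
      then have j': "norm (y - x0) \<le> r / 2 ^ j" "r / 2 ^ Suc j < norm (y - x0)"
        using r y by (auto simp: field_simps)
      have "norm (y - x0) powr (\<beta> - real DIM('a)) = norm (y - x0) powr \<beta> * norm (y - x0) powr (- real DIM('a))"
        by (subst powr_add[symmetric]) simp
      also have "\<dots> \<le> ?c j"
        using j' r y \<beta> by (intro mult_mono powr_mono2 powr_mono2') auto
      finally have "?f y \<le> ennreal (?c j) * indicator (cball x0 (?\<rho> j)) y"
        using j' r y by (auto simp: indicator_def dist_norm norm_minus_commute)
      then show "\<exists>j. ?f y \<le> ennreal (?c j) * indicator (cball x0 (?\<rho> j)) y" by blast
    next
      fix j
      have *: "?\<rho> j ^ DIM('a) = 2 ^ DIM('a) * (r / 2 ^ Suc j) powr (real DIM('a))"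
        using r by (simp add: powr_realpow power_mult_distrib power_divide mult_ac)
      have "?c j * ?\<rho> j ^ DIM('a) = 2 ^ DIM('a) * (r / 2 ^ j) powr \<beta> * ((r / 2 ^ Suc j) powr (- real DIM('a)) * (r / 2 ^ Suc j) powr (real DIM('a)))"
        unfolding * by simp
      also have "\<dots> = 2 ^ DIM('a) * (r / 2 ^ j) powr \<beta>"
        using r by (subst powr_add[symmetric]) simp
      also have "\<dots> = 2 ^ DIM('a) * (r powr \<beta> * \<theta> ^ j)"
      proof -
        have "(r / 2 ^ j) powr \<beta> = r powr \<beta> / ((2::real) ^ j) powr \<beta>"
          by (rule powr_divide)
        also have "((2::real) ^ j) powr \<beta> = 1 / \<theta> ^ j"
          unfolding \<theta>_def by (simp add: powr_power_commute powr_minus power_inverse field_simps)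
        finally show ?thesis by (simp only: times_divide_eq_right divide_divide_eq_right mult_1_right div_by_1)
      qed
      finally show "?c j * ?\<rho> j ^ DIM('a) = 2 ^ DIM('a) * r powr \<beta> * \<theta> ^ j" by (simp only: mult.assoc)
    qed (use r th in auto)
    also have "unit_ball_vol (real DIM('a)) * (2 ^ DIM('a) * r powr \<beta>) / (1 - \<theta>) = kernel_const TYPE('a) \<beta> * r powr \<beta>"
      by (simp add: kernel_const_def \<theta>_def)
    finally show ?thesis .
qed

section \<open>Mollification\<close>

lemma nn_integral_lborel_shift:
  fixes f :: "'a::euclidean_space \<Rightarrow> ennreal"
  assumes [measurable]: "f \<in> borel_measurable borel"
  shows "(\<integral>\<^sup>+x. f (c + x) \<partial>lborel) = (\<integral>\<^sup>+x. f x \<partial>lborel)"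
  by (subst (2) lborel_distr_plus[symmetric, of c]) (simp add: nn_integral_distr)

lemma integral_lborel_shift:
  fixes f :: "'a::euclidean_space \<Rightarrow> 'b::euclidean_space"
  assumes [measurable]: "f \<in> borel_measurable borel"
  shows "(\<integral>x. f (c + x) \<partial>lborel) = (\<integral>x. f x \<partial>lborel)"
  by (subst (2) lborel_distr_plus[symmetric, of c]) (simp add: integral_distr)

text \<open>A compactly supported function with a quadratic Taylor remainder.  That much smoothness suffices to
  differentiate a convolution by hand (\<open>has_derivative_quadratic\<close>).\<close>

definition bump :: "'a::euclidean_space \<Rightarrow> real" where
  "bump x = (max 0 (1 - (norm x)\<^sup>2))\<^sup>2"

lemma bump_nonneg: "0 \<le> bump x" and bump_le_1: "bump x \<le> 1"
  by (auto simp: bump_def max_def power_le_one)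

lemma bump_eq_0: "1 \<le> norm x \<Longrightarrow> bump x = 0"
  using one_le_power[of "norm x" 2] by (simp add: bump_def)

lemma bump_minus: "bump (- x) = bump x"
  by (simp add: bump_def)

lemma bump_ge: "norm x \<le> 1/2 \<Longrightarrow> 1/2 \<le> bump x"
proof -
  assume "norm x \<le> 1/2"
  then have "(norm x)\<^sup>2 \<le> (1/2)\<^sup>2" by (intro power_mono) auto
  then have "(3/4)\<^sup>2 \<le> (max 0 (1 - (norm x)\<^sup>2))\<^sup>2" by (intro power_mono) (auto simp: power2_eq_square)
  then show ?thesis by (simp add: bump_def power2_eq_square)
qed

lemma bump_measurable [measurable]: "bump \<in> borel_measurable borel"
  unfolding bump_def by measurable

definition bump_grad :: "'a::euclidean_space \<Rightarrow> 'a" where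
  "bump_grad x = (- 4 * max 0 (1 - (norm x)\<^sup>2)) *\<^sub>R x"

lemma bump_grad_measurable [measurable]: "bump_grad \<in> borel_measurable borel"
  unfolding bump_grad_def by measurable

lemma continuous_bump_grad: "isCont bump_grad x"
  unfolding bump_grad_def by (intro continuous_intros)

lemma norm_bump_grad_le: "norm (bump_grad x) \<le> 4"
proof (cases "norm x \<le> 1")
  case True
  then have "(norm x)\<^sup>2 \<le> 1" by (simp add: power_le_one)
  then have "norm (bump_grad x) = 4 * (1 - (norm x)\<^sup>2) * norm x" by (simp add: bump_grad_def)
  also have "\<dots> \<le> 4 * 1 * 1"
    using True \<open>(norm x)\<^sup>2 \<le> 1\<close> by (intro mult_mono) auto
  finally show ?thesis by simp
next
  case False
  then have "(norm x)\<^sup>2 > 1" by simp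
  then show ?thesis by (simp add: bump_grad_def)
qed

lemma truncated_square_taylor:
  fixes t a :: real
  shows "\<bar>(max 0 (1 - (t + a)))\<^sup>2 - (max 0 (1 - t))\<^sup>2 + 2 * max 0 (1 - t) * a\<bar> \<le> a\<^sup>2"
proof (cases "t \<le> 1"; cases "t + a \<le> 1")
  assume h: "t \<le> 1" "t + a \<le> 1"
  then have "(max 0 (1 - (t + a)))\<^sup>2 - (max 0 (1 - t))\<^sup>2 + 2 * max 0 (1 - t) * a = a\<^sup>2"
    by (simp add: power2_eq_square algebra_simps)
  then show ?thesis by simp
next
  assume h: "t \<le> 1" "\<not> t + a \<le> 1"
  then have "(max 0 (1 - (t + a)))\<^sup>2 - (max 0 (1 - t))\<^sup>2 + 2 * max 0 (1 - t) * a = (1 - t) * (2 * a - (1 - t))"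
    by (simp add: power2_eq_square algebra_simps)
  moreover have "0 \<le> (1 - t) * (2 * a - (1 - t))" using h by (intro mult_nonneg_nonneg) auto
  moreover have "(1 - t) * (2 * a - (1 - t)) = a\<^sup>2 - (a - (1 - t))\<^sup>2"
    by (simp add: power2_eq_square algebra_simps)
  moreover have "0 \<le> (a - (1 - t))\<^sup>2" by simp
  ultimately show ?thesis by linarith
next
  assume h: "\<not> t \<le> 1" "t + a \<le> 1"
  then have "(1 - (t + a))\<^sup>2 \<le> (- a)\<^sup>2" by (intro power_mono) auto
  with h show ?thesis by simp
next
  assume h: "\<not> t \<le> 1" "\<not> t + a \<le> 1"
  then show ?thesis by simp
qed

text \<open>\<open>bump\<close> is a function of \<open>|x|\<^sup>2\<close>, whose increment is \<open>2 x \<bullet> h + |h|\<^sup>2\<close>; the remainder of the outer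
  function is quadratic by \<open>truncated_square_taylor\<close>.\<close>

lemma bump_taylor:
  fixes x h :: "'a::euclidean_space"
  assumes h: "norm h \<le> 1"
  shows "\<bar>bump (x + h) - bump x - bump_grad x \<bullet> h\<bar> \<le> 27 * (norm h)\<^sup>2"
proof (cases "norm x \<le> 2")
  case True
  define a where "a = 2 * (x \<bullet> h) + (norm h)\<^sup>2"
  have n: "(norm (x + h))\<^sup>2 = (norm x)\<^sup>2 + a"
    by (simp add: a_def power2_norm_eq_inner inner_add_left inner_add_right inner_commute)
  have "\<bar>x \<bullet> h\<bar> \<le> norm x * norm h" by (rule Cauchy_Schwarz_ineq2)
  also have "\<dots> \<le> 2 * norm h" using True by (intro mult_right_mono) auto
  finally have xh: "\<bar>x \<bullet> h\<bar> \<le> 2 * norm h" .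
  have "(norm h)\<^sup>2 \<le> norm h"
    using h by (simp add: power2_eq_square mult_left_le)
  then have "\<bar>a\<bar> \<le> 5 * norm h" using xh unfolding a_def by (smt (verit) zero_le_power2)
  then have "\<bar>a\<bar>\<^sup>2 \<le> (5 * norm h)\<^sup>2" by (intro power_mono) auto
  then have a2: "a\<^sup>2 \<le> 25 * (norm h)\<^sup>2" by (simp add: power_mult_distrib)
  define m where "m = max 0 (1 - (norm x)\<^sup>2)"
  have m: "0 \<le> m" "m \<le> 1" by (auto simp: m_def)
  have "\<bar>bump (x + h) - bump x + 2 * m * a\<bar> \<le> a\<^sup>2"
    unfolding bump_def n m_def by (rule truncated_square_taylor)
  moreover have "bump_grad x \<bullet> h = - (2 * m * a) + 2 * m * (norm h)\<^sup>2"
    unfolding bump_grad_def a_def m_def[symmetric] by (simp add: algebra_simps)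
  moreover have "0 \<le> m * (norm h)\<^sup>2" "m * (norm h)\<^sup>2 \<le> (norm h)\<^sup>2"
    using m by (auto intro: mult_left_le_one_le)
  ultimately show ?thesis using a2 by linarith
next
  case False
  then have "norm (x + h) \<ge> 1" using h norm_triangle_ineq2[of x "-h"] by auto
  moreover have "1 < (norm x)\<^sup>2" using False by simp
  ultimately show ?thesis using False by (simp add: bump_eq_0 bump_grad_def)
qed

lemma has_derivative_quadratic:
  fixes f :: "'a::euclidean_space \<Rightarrow> real"
  assumes "\<delta> > 0" "\<And>h. norm h \<le> \<delta> \<Longrightarrow> \<bar>f (x + h) - f x - d \<bullet> h\<bar> \<le> C * (norm h)\<^sup>2"
  shows "(f has_derivative (\<lambda>h. d \<bullet> h)) (at x)"
  unfolding has_derivative_at_alt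
proof (intro conjI allI impI)
  show "bounded_linear (\<lambda>h. d \<bullet> h)" by (rule bounded_linear_inner_right)
  fix e :: real assume e: "0 < e"
  show "\<exists>d'>0. \<forall>y. norm (y - x) < d' \<longrightarrow> norm (f y - f x - d \<bullet> (y - x)) \<le> e * norm (y - x)"
  proof (intro exI[of _ "min \<delta> (e / (\<bar>C\<bar> + 1))"] conjI allI impI)
    fix y assume y: "norm (y - x) < min \<delta> (e / (\<bar>C\<bar> + 1))"
    then have "norm (f y - f x - d \<bullet> (y - x)) \<le> C * (norm (y - x))\<^sup>2"
      using assms(2)[of "y - x"] by simp
    also have "\<dots> \<le> (\<bar>C\<bar> + 1) * (norm (y - x))\<^sup>2" by (intro mult_right_mono) auto
    also have "\<dots> = ((\<bar>C\<bar> + 1) * norm (y - x)) * norm (y - x)" by (simp add: power2_eq_square)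
    also have "\<dots> \<le> e * norm (y - x)"
      using y by (intro mult_right_mono) (auto simp: field_simps)
    finally show "norm (f y - f x - d \<bullet> (y - x)) \<le> e * norm (y - x)" .
  qed (use e assms(1) in auto)
qed

lemma integrable_bounded_mult:
  fixes f :: "'a \<Rightarrow> 'b::{real_normed_vector, second_countable_topology, banach}"
  assumes k: "integrable M k" and [measurable]: "f \<in> borel_measurable M" and B: "\<And>x. norm (f x) \<le> B"
  shows "integrable M (\<lambda>x. (k x :: real) *\<^sub>R f x)"
proof (rule Bochner_Integration.integrable_bound[of M "\<lambda>x. B * k x"])
  show "integrable M (\<lambda>x. B * k x)" using k by simp
  show "(\<lambda>x. k x *\<^sub>R f x) \<in> borel_measurable M" using k by measurable
  show "AE x in M. norm (k x *\<^sub>R f x) \<le> norm (B * k x)"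
  proof (rule AE_I2)
    fix x
    have "norm (f x) \<le> \<bar>B\<bar>" using B[of x] by linarith
    then show "norm (k x *\<^sub>R f x) \<le> norm (B * k x)"
      by (simp add: abs_mult mult_left_mono mult.commute[of "\<bar>B\<bar>"])
  qed
qed

definition mollifier :: "real \<Rightarrow> 'a::euclidean_space \<Rightarrow> real" where
  "mollifier \<epsilon> z = bump (z /\<^sub>R \<epsilon>) / (\<integral>x. bump ((x::'a) /\<^sub>R \<epsilon>) \<partial>lborel)"

lemma integrable_scaled_bump:
  fixes \<epsilon> :: real
  assumes "0 < \<epsilon>"
  shows "integrable lborel (\<lambda>z::'a::euclidean_space. bump (z /\<^sub>R \<epsilon>))"
proof (rule Bochner_Integration.integrable_bound)
  show "integrable lborel (\<lambda>z::'a. indicat_real (cball 0 \<epsilon>) z)"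
    by (intro integrable_real_indicator emeasure_lborel_cball_finite) simp
  show "AE z::'a in lborel. norm (bump (z /\<^sub>R \<epsilon>)) \<le> norm (indicat_real (cball 0 \<epsilon>) z)"
  proof (rule AE_I2)
    fix z :: 'a
    show "norm (bump (z /\<^sub>R \<epsilon>)) \<le> norm (indicat_real (cball 0 \<epsilon>) z)"
    proof (cases "norm z \<le> \<epsilon>")
      case False
      then have "1 \<le> norm (z /\<^sub>R \<epsilon>)" using assms by (simp add: field_simps)
      then show ?thesis using False by (simp add: bump_eq_0)
    qed (auto simp: bump_nonneg bump_le_1)
  qed
qed measurable

text \<open>Gives the order \<open>\<epsilon> powr N\<close> of the normalising constant without a change of variables.\<close>

lemma scaled_bump_integral_ge:
  fixes \<epsilon> :: real
  assumes e: "0 < \<epsilon>"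
  shows "unit_ball_vol (real DIM('a)) / 2 * (\<epsilon> / 2) ^ DIM('a) \<le> (\<integral>z. bump ((z::'a::euclidean_space) /\<^sub>R \<epsilon>) \<partial>lborel)"
proof -
  have "unit_ball_vol (real DIM('a)) / 2 * (\<epsilon> / 2) ^ DIM('a) = (\<integral>z. 1/2 * indicat_real (cball (0::'a) (\<epsilon>/2)) z \<partial>lborel)"
    using e by (simp add: content_cball)
  also have "\<dots> \<le> (\<integral>z. bump ((z::'a) /\<^sub>R \<epsilon>) \<partial>lborel)"
  proof (rule integral_mono)
    show "integrable lborel (\<lambda>z::'a. 1/2 * indicat_real (cball 0 (\<epsilon>/2)) z)"
      by (intro integrable_mult_right integrable_real_indicator emeasure_lborel_cball_finite) simp
    show "integrable lborel (\<lambda>z::'a. bump (z /\<^sub>R \<epsilon>))" using e by (rule integrable_scaled_bump)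
    fix z :: 'a
    show "1/2 * indicat_real (cball 0 (\<epsilon>/2)) z \<le> bump (z /\<^sub>R \<epsilon>)"
    proof (cases "norm z \<le> \<epsilon>/2")
      case True
      then have "norm (z /\<^sub>R \<epsilon>) \<le> 1/2" using e by (simp add: field_simps)
      then show ?thesis using bump_ge[of "z /\<^sub>R \<epsilon>"] True by simp
    qed (auto simp: bump_nonneg)
  qed
  finally show ?thesis .
qed

lemma scaled_bump_integral_pos:
  fixes \<epsilon> :: real
  assumes e: "0 < \<epsilon>"
  shows "0 < (\<integral>z. bump ((z::'a::euclidean_space) /\<^sub>R \<epsilon>) \<partial>lborel)"
  using scaled_bump_integral_ge[where 'a = 'a, OF e] e
  by (smt (verit) divide_pos_pos mult_pos_pos unit_ball_vol_pos zero_less_power of_nat_0_le_iff)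

lemma mollifier_measurable [measurable]: "mollifier \<epsilon> \<in> borel_measurable borel"
  unfolding mollifier_def by measurable

lemma mollifier:
  fixes \<epsilon> :: real
  assumes e: "0 < \<epsilon>"
  shows mollifier_nonneg: "\<And>z::'a::euclidean_space. 0 \<le> mollifier \<epsilon> z"
    and integrable_mollifier: "integrable lborel (mollifier \<epsilon> :: 'a \<Rightarrow> real)"
    and integral_mollifier: "(\<integral>z. mollifier \<epsilon> (z::'a) \<partial>lborel) = 1"
    and mollifier_eq_0: "\<And>z::'a. \<epsilon> \<le> norm z \<Longrightarrow> mollifier \<epsilon> z = 0"
proof -
  note pos = scaled_bump_integral_pos[where 'a = 'a, OF e]
  show "0 \<le> mollifier \<epsilon> z" for z :: 'a
    using pos by (simp add: mollifier_def bump_nonneg)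
  show "integrable lborel (mollifier \<epsilon> :: 'a \<Rightarrow> real)"
    unfolding mollifier_def using integrable_scaled_bump[OF e] by auto
  show "(\<integral>z. mollifier \<epsilon> (z::'a) \<partial>lborel) = 1"
    unfolding mollifier_def using pos by simp
  show "mollifier \<epsilon> z = 0" if "\<epsilon> \<le> norm z" for z :: 'a
    using that e unfolding mollifier_def by (subst bump_eq_0) (auto simp: field_simps)
qed

definition mollify :: "real \<Rightarrow> ('a::euclidean_space \<Rightarrow> real) \<Rightarrow> 'a \<Rightarrow> real" where
  "mollify \<epsilon> \<phi> x = (\<integral>z. mollifier \<epsilon> z * \<phi> (x + z) \<partial>lborel)"

lemma mollify_measurable [measurable]:
  assumes [measurable]: "\<phi> \<in> borel_measurable borel"
  shows "mollify \<epsilon> \<phi> \<in> borel_measurable borel"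
  unfolding mollify_def by measurable

lemma integrable_mollify:
  fixes \<phi> :: "'a::euclidean_space \<Rightarrow> real"
  assumes e: "0 < \<epsilon>" and [measurable]: "\<phi> \<in> borel_measurable borel" and B: "\<And>x. \<bar>\<phi> x\<bar> \<le> B"
  shows "integrable lborel (\<lambda>z. mollifier \<epsilon> z * \<phi> z)"
  using integrable_bounded_mult[OF integrable_mollifier[OF e], of \<phi> B] B by simp

lemma mollify_eq_scaled_bump:
  fixes \<phi> :: "'a::euclidean_space \<Rightarrow> real"
  assumes [measurable]: "\<phi> \<in> borel_measurable borel"
  shows "mollify \<epsilon> \<phi> x = (\<integral>z. bump ((x - z) /\<^sub>R \<epsilon>) * \<phi> z \<partial>lborel) / (\<integral>x. bump ((x::'a) /\<^sub>R \<epsilon>) \<partial>lborel)"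
proof -
  have "mollify \<epsilon> \<phi> x = (\<integral>z. mollifier \<epsilon> (- x + (x + z)) * \<phi> (x + z) \<partial>lborel)"
    by (simp add: mollify_def)
  also have "\<dots> = (\<integral>z. mollifier \<epsilon> (- x + z) * \<phi> z \<partial>lborel)"
    by (rule integral_lborel_shift) measurable
  also have "(\<lambda>z. mollifier \<epsilon> (- x + z)) = (\<lambda>z. bump ((x - z) /\<^sub>R \<epsilon>) / (\<integral>x. bump ((x::'a) /\<^sub>R \<epsilon>) \<partial>lborel))"
  proof
    fix z
    show "mollifier \<epsilon> (- x + z) = bump ((x - z) /\<^sub>R \<epsilon>) / (\<integral>x. bump ((x::'a) /\<^sub>R \<epsilon>) \<partial>lborel)"
      using bump_minus[of "(x - z) /\<^sub>R \<epsilon>"] by (simp add: mollifier_def scaleR_diff_right)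
  qed
  finally show ?thesis by simp
qed

lemma mollify_C1:
  fixes \<phi> :: "'a::euclidean_space \<Rightarrow> real"
  assumes e: "0 < \<epsilon>" and \<phi>: "integrable lborel \<phi>"
  shows "\<exists>D. (\<forall>x. (mollify \<epsilon> \<phi> has_derivative blinfun_apply (D x)) (at x)) \<and> continuous_on UNIV D"
proof -
  have [measurable]: "\<phi> \<in> borel_measurable borel" using \<phi> by auto
  define I where "I = (\<integral>x. bump ((x::'a) /\<^sub>R \<epsilon>) \<partial>lborel)"
  have I: "I > 0" unfolding I_def using e by (rule scaled_bump_integral_pos)
  define d where "d x = (\<integral>z. \<phi> z *\<^sub>R bump_grad ((x - z) /\<^sub>R \<epsilon>) \<partial>lborel) /\<^sub>R (I * \<epsilon>)" for x
  have int1: "integrable lborel (\<lambda>z. \<phi> z *\<^sub>R bump_grad ((x - z) /\<^sub>R \<epsilon>))" for x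
    by (rule integrable_bounded_mult[OF \<phi>]) (auto intro: norm_bump_grad_le)
  have int2: "integrable lborel (\<lambda>z. \<phi> z *\<^sub>R bump ((x - z) /\<^sub>R \<epsilon>))" for x
    by (rule integrable_bounded_mult[OF \<phi>, of _ 1]) (auto simp: bump_nonneg bump_le_1)
  have "(mollify \<epsilon> \<phi> has_derivative (\<lambda>h. d x \<bullet> h)) (at x)" for x
  proof (rule has_derivative_quadratic[OF e])
    fix h :: 'a assume h: "norm h \<le> \<epsilon>"
    let ?r = "\<lambda>z. bump ((x + h - z) /\<^sub>R \<epsilon>) - bump ((x - z) /\<^sub>R \<epsilon>) - bump_grad ((x - z) /\<^sub>R \<epsilon>) \<bullet> (h /\<^sub>R \<epsilon>)"
    have r: "\<bar>?r z\<bar> \<le> 27 * (norm h / \<epsilon>)\<^sup>2" for z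
    proof -
      have "(x + h - z) /\<^sub>R \<epsilon> = (x - z) /\<^sub>R \<epsilon> + h /\<^sub>R \<epsilon>"
        by (simp add: scaleR_diff_right scaleR_add_right)
      then show ?thesis
        using bump_taylor[of "h /\<^sub>R \<epsilon>" "(x - z) /\<^sub>R \<epsilon>"] h e by (simp add: field_simps)
    qed
    have "mollify \<epsilon> \<phi> (x + h) - mollify \<epsilon> \<phi> x - d x \<bullet> h
        = ((\<integral>z. \<phi> z *\<^sub>R bump ((x + h - z) /\<^sub>R \<epsilon>) \<partial>lborel) - (\<integral>z. \<phi> z *\<^sub>R bump ((x - z) /\<^sub>R \<epsilon>) \<partial>lborel)
            - (\<integral>z. \<phi> z *\<^sub>R bump_grad ((x - z) /\<^sub>R \<epsilon>) \<partial>lborel) \<bullet> (h /\<^sub>R \<epsilon>)) / I"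
    proof -
      define P Q V where "P = (\<integral>z. \<phi> z *\<^sub>R bump ((x + h - z) /\<^sub>R \<epsilon>) \<partial>lborel)"
        and "Q = (\<integral>z. \<phi> z *\<^sub>R bump ((x - z) /\<^sub>R \<epsilon>) \<partial>lborel)"
        and "V = (\<integral>z. \<phi> z *\<^sub>R bump_grad ((x - z) /\<^sub>R \<epsilon>) \<partial>lborel)"
      have "mollify \<epsilon> \<phi> (x + h) = P / I" "mollify \<epsilon> \<phi> x = Q / I"
        unfolding P_def Q_def I_def by (subst mollify_eq_scaled_bump; simp add: mult.commute)+
      moreover have "d x \<bullet> h = (V \<bullet> h) / (I * \<epsilon>)"
        unfolding d_def V_def by (simp add: field_simps)
      moreover have "V \<bullet> (h /\<^sub>R \<epsilon>) = (V \<bullet> h) / \<epsilon>" by (simp add: field_simps)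
      ultimately show ?thesis
        unfolding P_def[symmetric] Q_def[symmetric] V_def[symmetric] by (simp add: diff_divide_distrib)
    qed
    also have "(\<integral>z. \<phi> z *\<^sub>R bump_grad ((x - z) /\<^sub>R \<epsilon>) \<partial>lborel) \<bullet> (h /\<^sub>R \<epsilon>)
        = (\<integral>z. (\<phi> z *\<^sub>R bump_grad ((x - z) /\<^sub>R \<epsilon>)) \<bullet> (h /\<^sub>R \<epsilon>) \<partial>lborel)"
      using int1 by (intro integral_inner_left[symmetric]) auto
    also have "(\<integral>z. \<phi> z *\<^sub>R bump ((x + h - z) /\<^sub>R \<epsilon>) \<partial>lborel) - (\<integral>z. \<phi> z *\<^sub>R bump ((x - z) /\<^sub>R \<epsilon>) \<partial>lborel)
            - (\<integral>z. (\<phi> z *\<^sub>R bump_grad ((x - z) /\<^sub>R \<epsilon>)) \<bullet> (h /\<^sub>R \<epsilon>) \<partial>lborel) = (\<integral>z. \<phi> z *\<^sub>R ?r z \<partial>lborel)"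
    proof -
      have "integrable lborel (\<lambda>z. (\<phi> z *\<^sub>R bump_grad ((x - z) /\<^sub>R \<epsilon>)) \<bullet> (h /\<^sub>R \<epsilon>))"
        using int1 by (intro integrable_inner_left) auto
      from Bochner_Integration.integral_diff[OF Bochner_Integration.integrable_diff[OF int2[of "x + h"] int2[of x]] this]
        Bochner_Integration.integral_diff[OF int2[of "x + h"] int2[of x]]
      show ?thesis
        by (simp only: real_scaleR_def right_diff_distrib inner_scaleR_left)
    qed
    finally have *: "mollify \<epsilon> \<phi> (x + h) - mollify \<epsilon> \<phi> x - d x \<bullet> h = (\<integral>z. \<phi> z *\<^sub>R ?r z \<partial>lborel) / I" .
    have "\<bar>\<integral>z. \<phi> z *\<^sub>R ?r z \<partial>lborel\<bar> \<le> (\<integral>z. \<bar>\<phi> z\<bar> * (27 * (norm h / \<epsilon>)\<^sup>2) \<partial>lborel)"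
    proof (rule order_trans[OF integral_abs_bound integral_mono])
      have "integrable lborel (\<lambda>z. \<phi> z *\<^sub>R ?r z)"
        by (rule integrable_bounded_mult[OF \<phi>, where B = "27 * (norm h / \<epsilon>)\<^sup>2"]) (use r in auto)
      then show "integrable lborel (\<lambda>z. \<bar>\<phi> z *\<^sub>R ?r z\<bar>)" by (rule integrable_abs)
      show "integrable lborel (\<lambda>z. \<bar>\<phi> z\<bar> * (27 * (norm h / \<epsilon>)\<^sup>2))" using \<phi> by auto
      show "\<bar>\<phi> z *\<^sub>R ?r z\<bar> \<le> \<bar>\<phi> z\<bar> * (27 * (norm h / \<epsilon>)\<^sup>2)" for z
        using r[of z] by (simp only: real_scaleR_def abs_mult) (intro mult_left_mono, auto)
    qed
    also have "\<dots> = (\<integral>z. \<bar>\<phi> z\<bar> \<partial>lborel) * (27 / \<epsilon>\<^sup>2) * (norm h)\<^sup>2"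
      by (simp add: power_divide)
    finally show "\<bar>mollify \<epsilon> \<phi> (x + h) - mollify \<epsilon> \<phi> x - d x \<bullet> h\<bar>
        \<le> ((\<integral>z. \<bar>\<phi> z\<bar> \<partial>lborel) * (27 / \<epsilon>\<^sup>2) / I) * (norm h)\<^sup>2"
      unfolding * using I by (simp add: field_simps)
  qed
  moreover have "continuous_on UNIV (\<lambda>x. blinfun_inner_right (d x))"
  proof -
    have "continuous (at a) (\<lambda>x. \<integral>z. \<phi> z *\<^sub>R bump_grad ((x - z) /\<^sub>R \<epsilon>) \<partial>lborel)" for a
      unfolding continuous_at_sequentially comp_def
    proof (intro allI impI)
      fix X assume X: "X \<longlonglongrightarrow> a"
      show "(\<lambda>n. \<integral>z. \<phi> z *\<^sub>R bump_grad ((X n - z) /\<^sub>R \<epsilon>) \<partial>lborel) \<longlonglongrightarrow>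
         (\<integral>z. \<phi> z *\<^sub>R bump_grad ((a - z) /\<^sub>R \<epsilon>) \<partial>lborel)"
      proof (rule integral_dominated_convergence[where w = "\<lambda>z. \<bar>\<phi> z\<bar> * 4"])
        show "integrable lborel (\<lambda>z. \<bar>\<phi> z\<bar> * 4)" using \<phi> by auto
        show "AE z in lborel. (\<lambda>n. \<phi> z *\<^sub>R bump_grad ((X n - z) /\<^sub>R \<epsilon>)) \<longlonglongrightarrow> \<phi> z *\<^sub>R bump_grad ((a - z) /\<^sub>R \<epsilon>)"
          by (intro AE_I2 tendsto_intros isCont_tendsto_compose[OF continuous_bump_grad] X)
        show "AE z in lborel. norm (\<phi> z *\<^sub>R bump_grad ((X n - z) /\<^sub>R \<epsilon>)) \<le> \<bar>\<phi> z\<bar> * 4" for n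
          by (intro AE_I2) (auto intro!: mult_left_mono norm_bump_grad_le)
      qed auto
    qed
    then have "continuous_on UNIV (\<lambda>x. \<integral>z. \<phi> z *\<^sub>R bump_grad ((x - z) /\<^sub>R \<epsilon>) \<partial>lborel)"
      by (simp add: continuous_on_eq_continuous_at)
    then show ?thesis unfolding d_def
      by (intro bounded_linear.continuous_on[OF bounded_linear_blinfun_inner_right] continuous_intros)
  qed
  ultimately show ?thesis
    by (intro exI[of _ "\<lambda>x. blinfun_inner_right (d x)"]) simp
qed

lemma mollify_bounds:
  fixes \<phi> :: "'a::euclidean_space \<Rightarrow> real"
  assumes e: "0 < \<epsilon>" and [measurable]: "\<phi> \<in> borel_measurable borel" and B: "\<And>x. 0 \<le> \<phi> x" "\<And>x. \<phi> x \<le> B"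
  shows "0 \<le> mollify \<epsilon> \<phi> x" "mollify \<epsilon> \<phi> x \<le> B"
proof -
  show "0 \<le> mollify \<epsilon> \<phi> x"
    unfolding mollify_def using B mollifier_nonneg[OF e]
    by (intro Bochner_Integration.integral_nonneg mult_nonneg_nonneg) auto
  have "integrable lborel (\<lambda>z. mollifier \<epsilon> z * \<phi> (x + z))"
    using B by (intro integrable_mollify[OF e, of _ B]) auto
  moreover have "integrable lborel (\<lambda>z::'a. mollifier \<epsilon> z * B)"
    using integrable_mollifier[OF e] by auto
  ultimately have "mollify \<epsilon> \<phi> x \<le> (\<integral>z. mollifier \<epsilon> (z::'a) * B \<partial>lborel)"
    unfolding mollify_def using B mollifier_nonneg[OF e]
    by (intro integral_mono) (auto intro!: mult_left_mono)
  also have "\<dots> = B" using integral_mollifier[OF e, where 'a = 'a] by simp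
  finally show "mollify \<epsilon> \<phi> x \<le> B" .
qed

lemma mollify_eq_0:
  fixes \<phi> :: "'a::euclidean_space \<Rightarrow> real"
  assumes e: "0 < \<epsilon>" and \<phi>: "\<And>x. x \<notin> ball x0 \<rho> \<Longrightarrow> \<phi> x = 0" and x: "x \<notin> ball x0 (\<rho> + \<epsilon>)"
  shows "mollify \<epsilon> \<phi> x = 0"
proof -
  have "mollifier \<epsilon> z * \<phi> (x + z) = 0" for z
  proof (cases "\<epsilon> \<le> norm z")
    case False
    have "dist x0 x \<le> dist x0 (x + z) + norm z"
      using dist_triangle[of x0 x "x + z"] by (simp add: dist_norm)
    then show ?thesis using x False \<phi>[of "x + z"] by auto
  qed (simp add: mollifier_eq_0[OF e])
  then show ?thesis by (simp only: mollify_def Bochner_Integration.integral_zero)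
qed

text \<open>Jensen's inequality for the probability density \<open>mollifier \<epsilon>\<close>.\<close>

lemma mollifier_jensen:
  fixes f :: "'a::euclidean_space \<Rightarrow> real"
  assumes e: "0 < \<epsilon>" and [measurable]: "f \<in> borel_measurable borel" and B: "\<And>x. \<bar>f x\<bar> \<le> B" and p: "1 < p"
  shows "ennreal (\<bar>\<integral>z. mollifier \<epsilon> z * f z \<partial>lborel\<bar> powr p)
    \<le> (\<integral>\<^sup>+z. ennreal (mollifier \<epsilon> z * \<bar>f z\<bar> powr p) \<partial>lborel)"
proof -
  let ?k = "mollifier \<epsilon> :: 'a \<Rightarrow> real"
  define A where "A = (\<integral>z. ?k z * \<bar>f z\<bar> \<partial>lborel)"
  note k = mollifier_nonneg[OF e, where 'a = 'a] integrable_mollifier[OF e, where 'a = 'a] integral_mollifier[OF e, where 'a = 'a]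
  have B0: "0 \<le> B" using B[of undefined] by linarith
  have i1: "integrable lborel (\<lambda>z. ?k z * \<bar>f z\<bar>)"
    using B by (intro integrable_mollify[OF e, of _ B]) auto
  have i2: "integrable lborel (\<lambda>z. ?k z * \<bar>f z\<bar> powr p)"
    using B p by (intro integrable_mollify[OF e, of _ "B powr p"]) (auto intro!: powr_mono2)
  have A0: "0 \<le> A" unfolding A_def using k by (intro Bochner_Integration.integral_nonneg) auto
  have "A powr p = (\<integral>z. ?k z * (A powr p + p * A powr (p - 1) * (\<bar>f z\<bar> - A)) \<partial>lborel)"
  proof -
    have "(\<integral>z. ?k z * (A powr p + p * A powr (p - 1) * (\<bar>f z\<bar> - A)) \<partial>lborel)
      = (\<integral>z. (A powr p - p * A powr (p - 1) * A) * ?k z + (p * A powr (p - 1)) * (?k z * \<bar>f z\<bar>) \<partial>lborel)"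
      by (intro Bochner_Integration.integral_cong) (auto simp: algebra_simps)
    also have "\<dots> = (A powr p - p * A powr (p - 1) * A) * 1 + (p * A powr (p - 1)) * A"
      using k i1 unfolding A_def by (subst Bochner_Integration.integral_add) auto
    finally show ?thesis by simp
  qed
  also have "\<dots> \<le> (\<integral>z. ?k z * \<bar>f z\<bar> powr p \<partial>lborel)"
  proof (rule integral_mono)
    have "integrable lborel (\<lambda>z. (A powr p - p * A powr (p - 1) * A) * ?k z + (p * A powr (p - 1)) * (?k z * \<bar>f z\<bar>))"
      using k i1 by auto
    then show "integrable lborel (\<lambda>z. ?k z * (A powr p + p * A powr (p - 1) * (\<bar>f z\<bar> - A)))"
      by (simp add: algebra_simps)
    show "?k z * (A powr p + p * A powr (p - 1) * (\<bar>f z\<bar> - A)) \<le> ?k z * \<bar>f z\<bar> powr p" for z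
      using k A0 p by (intro mult_left_mono powr_above_tangent) auto
  qed (rule i2)
  finally have "A powr p \<le> (\<integral>z. ?k z * \<bar>f z\<bar> powr p \<partial>lborel)" .
  moreover have "\<bar>\<integral>z. ?k z * f z \<partial>lborel\<bar> \<le> A"
  proof -
    have "\<bar>\<integral>z. ?k z * f z \<partial>lborel\<bar> \<le> (\<integral>z. \<bar>?k z * f z\<bar> \<partial>lborel)" by (rule integral_abs_bound)
    then show ?thesis using k by (simp add: A_def abs_mult)
  qed
  ultimately have "\<bar>\<integral>z. ?k z * f z \<partial>lborel\<bar> powr p \<le> (\<integral>z. ?k z * \<bar>f z\<bar> powr p \<partial>lborel)"
    using p by (smt (verit) powr_mono2 abs_ge_zero)
  then show ?thesis
    using k i2 by (subst nn_integral_eq_integral) (auto intro!: ennreal_leI)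
qed

text \<open>The \<open>p\<close>-th power of the Gagliardo seminorm on the whole space.\<close>

definition gagliardo_energy :: "real \<Rightarrow> real \<Rightarrow> ('a::euclidean_space \<Rightarrow> real) \<Rightarrow> ennreal" where
  "gagliardo_energy q p \<phi> =
    (\<integral>\<^sup>+x. \<integral>\<^sup>+y. ennreal (\<bar>\<phi> x - \<phi> y\<bar> powr p * norm (x - y) powr (- q)) \<partial>lborel \<partial>lborel)"

text \<open>Differences of the mollified function are averages of differences of translates, and all translates have the
  same energy.\<close>

lemma gagliardo_energy_mollify:
  fixes \<phi> :: "'a::euclidean_space \<Rightarrow> real"
  assumes e: "0 < \<epsilon>" and [measurable]: "\<phi> \<in> borel_measurable borel" and B: "\<And>x. \<bar>\<phi> x\<bar> \<le> B" and p: "1 < p"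
  shows "gagliardo_energy q p (mollify \<epsilon> \<phi>) \<le> gagliardo_energy q p \<phi>"
proof -
  let ?k = "mollifier \<epsilon> :: 'a \<Rightarrow> real"
  note k = mollifier_nonneg[OF e, where 'a = 'a] integrable_mollifier[OF e, where 'a = 'a] integral_mollifier[OF e, where 'a = 'a]
  let ?g = "\<lambda>x y. ennreal (\<bar>\<phi> x - \<phi> y\<bar> powr p * norm (x - y) powr (- q))"
  have "gagliardo_energy q p (mollify \<epsilon> \<phi>) \<le> (\<integral>\<^sup>+x. \<integral>\<^sup>+y. \<integral>\<^sup>+z. ennreal (?k z) * ?g (z + x) (z + y) \<partial>lborel \<partial>lborel \<partial>lborel)"
    unfolding gagliardo_energy_def
  proof (intro nn_integral_mono)
    fix x y :: 'a
    have i: "integrable lborel (\<lambda>z. ?k z * \<phi> (x + z))" for x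
      using B by (intro integrable_mollify[OF e, of _ B]) auto
    have "mollify \<epsilon> \<phi> x - mollify \<epsilon> \<phi> y = (\<integral>z. ?k z * (\<phi> (z + x) - \<phi> (z + y)) \<partial>lborel)"
      unfolding mollify_def using i
      Bochner_Integration.integral_diff[OF i(1)[of x] i(1)[of y]] by (simp add: right_diff_distrib add.commute)
    then have "ennreal (\<bar>mollify \<epsilon> \<phi> x - mollify \<epsilon> \<phi> y\<bar> powr p) \<le>
      (\<integral>\<^sup>+z. ennreal (?k z * \<bar>\<phi> (z + x) - \<phi> (z + y)\<bar> powr p) \<partial>lborel)"
    proof (simp only:, intro mollifier_jensen[OF e, of _ "2 * B"] p)
      show "\<bar>\<phi> (z + x) - \<phi> (z + y)\<bar> \<le> 2 * B" for z
        using B[of "z + x"] B[of "z + y"] by linarith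
    qed measurable
    then have "ennreal (\<bar>mollify \<epsilon> \<phi> x - mollify \<epsilon> \<phi> y\<bar> powr p) * ennreal (norm (x - y) powr (- q)) \<le>
      (\<integral>\<^sup>+z. ennreal (?k z * \<bar>\<phi> (z + x) - \<phi> (z + y)\<bar> powr p) \<partial>lborel) * ennreal (norm (x - y) powr (- q))"
      by (intro mult_right_mono) auto
    also have "\<dots> = (\<integral>\<^sup>+z. ennreal (?k z) * ?g (z + x) (z + y) \<partial>lborel)"
      using k by (subst nn_integral_multc[symmetric]) (auto intro!: nn_integral_cong simp: ennreal_mult' mult.assoc)
    finally show "ennreal (\<bar>mollify \<epsilon> \<phi> x - mollify \<epsilon> \<phi> y\<bar> powr p * norm (x - y) powr (- q))
      \<le> (\<integral>\<^sup>+z. ennreal (?k z) * ?g (z + x) (z + y) \<partial>lborel)"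
      by (simp add: ennreal_mult')
  qed
  also have "\<dots> = (\<integral>\<^sup>+x. \<integral>\<^sup>+z. \<integral>\<^sup>+y. ennreal (?k z) * ?g (z + x) (z + y) \<partial>lborel \<partial>lborel \<partial>lborel)"
    by (intro nn_integral_cong lborel_pair.Fubini') measurable
  also have "\<dots> = (\<integral>\<^sup>+x. \<integral>\<^sup>+z. ennreal (?k z) * (\<integral>\<^sup>+y. ?g (z + x) y \<partial>lborel) \<partial>lborel \<partial>lborel)"
    by (intro nn_integral_cong) (subst nn_integral_cmult, measurable, subst nn_integral_lborel_shift, measurable)
  also have "\<dots> = (\<integral>\<^sup>+z. \<integral>\<^sup>+x. ennreal (?k z) * (\<integral>\<^sup>+y. ?g (z + x) y \<partial>lborel) \<partial>lborel \<partial>lborel)"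
    by (rule lborel_pair.Fubini') measurable
  also have "\<dots> = (\<integral>\<^sup>+z. ennreal (?k z) * gagliardo_energy q p \<phi> \<partial>lborel)"
  proof (intro nn_integral_cong)
    fix z
    have "(\<integral>\<^sup>+x. ennreal (?k z) * (\<integral>\<^sup>+y. ?g (z + x) y \<partial>lborel) \<partial>lborel)
       = ennreal (?k z) * (\<integral>\<^sup>+x. (\<integral>\<^sup>+y. ?g (z + x) y \<partial>lborel) \<partial>lborel)"
      by (rule nn_integral_cmult) measurable
    also have "(\<integral>\<^sup>+x. (\<integral>\<^sup>+y. ?g (z + x) y \<partial>lborel) \<partial>lborel) = (\<integral>\<^sup>+x. (\<integral>\<^sup>+y. ?g x y \<partial>lborel) \<partial>lborel)"
      by (rule nn_integral_lborel_shift[where f = "\<lambda>x. \<integral>\<^sup>+y. ?g x y \<partial>lborel"]) measurable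
    finally show "(\<integral>\<^sup>+x. ennreal (?k z) * (\<integral>\<^sup>+y. ?g (z + x) y \<partial>lborel) \<partial>lborel) = ennreal (?k z) * gagliardo_energy q p \<phi>"
      unfolding gagliardo_energy_def .
  qed
  also have "\<dots> = (\<integral>\<^sup>+z. ennreal (?k z) \<partial>lborel) * gagliardo_energy q p \<phi>"
    by (rule nn_integral_multc) measurable
  also have "(\<integral>\<^sup>+z. ennreal (?k z) \<partial>lborel) = 1"
    using k by (subst nn_integral_eq_integral) auto
  finally show ?thesis by simp
qed

text \<open>The mollifier is at most of order \<open>\<epsilon> powr (- N)\<close> and lives where \<open>|z| < \<epsilon>\<close>; there
  \<open>\<epsilon> powr (- N) \<le> \<epsilon> powr \<beta> * |z| powr (- (N + \<beta>))\<close>.  This compares mollification with the Gagliardo energy.\<close>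

lemma mollifier_le_kernel:
  fixes z :: "'a::euclidean_space" and \<beta> :: real
  assumes e: "0 < \<epsilon>" and b: "0 < \<beta>" and z: "z \<noteq> 0"
  shows "mollifier \<epsilon> z \<le> 2 * 2 ^ DIM('a) / unit_ball_vol (real DIM('a)) * \<epsilon> powr \<beta> * norm z powr (- (real DIM('a) + \<beta>))"
proof (cases "\<epsilon> \<le> norm z")
  case True
  then show ?thesis by (simp add: mollifier_eq_0[OF e])
next
  case False
  let ?w = "unit_ball_vol (real DIM('a))"
  have w: "?w > 0" by simp
  have "mollifier \<epsilon> z \<le> 1 / (?w / 2 * (\<epsilon> / 2) ^ DIM('a))"
    unfolding mollifier_def using scaled_bump_integral_ge[where 'a = 'a, OF e] bump_le_1 e w
    by (intro frac_le) auto
  also have "\<dots> = 2 * 2 ^ DIM('a) / ?w * \<epsilon> powr (- real DIM('a))"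
    using e by (simp add: power_divide powr_minus powr_realpow field_simps)
  also have "\<epsilon> powr (- real DIM('a)) = \<epsilon> powr \<beta> * \<epsilon> powr (- (real DIM('a) + \<beta>))"
    by (subst powr_add[symmetric]) simp
  also have "2 * 2 ^ DIM('a) / ?w * \<dots> \<le> 2 * 2 ^ DIM('a) / ?w * (\<epsilon> powr \<beta> * norm z powr (- (real DIM('a) + \<beta>)))"
    using False z b w by (intro mult_left_mono powr_mono2') auto
  finally show ?thesis by (simp add: mult_ac)
qed

text \<open>Finite Gagliardo energy gives a rate for the convergence of mollifications in \<open>L\<^sup>p\<close>, and hence
  convergence almost everywhere along a subsequence.\<close>

lemma mollify_Lp_error:
  fixes \<phi> :: "'a::euclidean_space \<Rightarrow> real" and \<beta> :: real
  assumes e: "0 < \<epsilon>" and [measurable]: "\<phi> \<in> borel_measurable borel" and B: "\<And>x. \<bar>\<phi> x\<bar> \<le> B" and p: "1 < p"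
    and b: "0 < \<beta>"
  shows "(\<integral>\<^sup>+x. ennreal (\<bar>mollify \<epsilon> \<phi> x - \<phi> x\<bar> powr p) \<partial>lborel)
    \<le> ennreal (2 * 2 ^ DIM('a) / unit_ball_vol (real DIM('a)) * \<epsilon> powr \<beta>) * gagliardo_energy (real DIM('a) + \<beta>) p \<phi>"
proof -
  let ?k = "mollifier \<epsilon> :: 'a \<Rightarrow> real"
  let ?C = "2 * 2 ^ DIM('a) / unit_ball_vol (real DIM('a)) * \<epsilon> powr \<beta>"
  let ?q = "real DIM('a) + \<beta>"
  note k = mollifier_nonneg[OF e, where 'a = 'a] integrable_mollifier[OF e, where 'a = 'a] integral_mollifier[OF e, where 'a = 'a]
  have C0: "0 \<le> ?C" by simp
  let ?g = "\<lambda>x y. ennreal (\<bar>\<phi> x - \<phi> y\<bar> powr p * norm (x - y) powr (- ?q))"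
  have "(\<integral>\<^sup>+x. ennreal (\<bar>mollify \<epsilon> \<phi> x - \<phi> x\<bar> powr p) \<partial>lborel)
    \<le> (\<integral>\<^sup>+x. \<integral>\<^sup>+z. ennreal ?C * ?g x (x + z) \<partial>lborel \<partial>lborel)"
  proof (intro nn_integral_mono)
    fix x
    have i: "integrable lborel (\<lambda>z. ?k z * \<phi> (x + z))" for x
      using B by (intro integrable_mollify[OF e, of _ B]) auto
    have "mollify \<epsilon> \<phi> x - \<phi> x = (\<integral>z. ?k z * \<phi> (x + z) \<partial>lborel) - (\<integral>z. ?k z * \<phi> x \<partial>lborel)"
      unfolding mollify_def using k by simp
    also have "\<dots> = (\<integral>z. ?k z * (\<phi> (x + z) - \<phi> x) \<partial>lborel)"
      using Bochner_Integration.integral_diff[OF i(1)[of x], of "\<lambda>z. ?k z * \<phi> x"] k by (simp add: right_diff_distrib)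
    finally have "ennreal (\<bar>mollify \<epsilon> \<phi> x - \<phi> x\<bar> powr p) \<le>
      (\<integral>\<^sup>+z. ennreal (?k z * \<bar>\<phi> (x + z) - \<phi> x\<bar> powr p) \<partial>lborel)"
    proof (simp only:, intro mollifier_jensen[OF e, of _ "2 * B"] p)
      show "\<bar>\<phi> (x + z) - \<phi> x\<bar> \<le> 2 * B" for z
        using B[of "x + z"] B[of "x"] by linarith
    qed measurable
    also have "\<dots> \<le> (\<integral>\<^sup>+z. ennreal ?C * ?g x (x + z) \<partial>lborel)"
    proof (rule nn_integral_mono)
      fix z
      show "ennreal (?k z * \<bar>\<phi> (x + z) - \<phi> x\<bar> powr p) \<le> ennreal ?C * ?g x (x + z)"
      proof (cases "z = 0")
        case False
        have "?k z * \<bar>\<phi> (x + z) - \<phi> x\<bar> powr p \<le> (?C * norm z powr (- ?q)) * \<bar>\<phi> (x + z) - \<phi> x\<bar> powr p"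
          using mollifier_le_kernel[OF e b False] by (intro mult_right_mono) auto
        then have "ennreal (?k z * \<bar>\<phi> (x + z) - \<phi> x\<bar> powr p) \<le> ennreal (?C * (\<bar>\<phi> x - \<phi> (x + z)\<bar> powr p * norm (x - (x + z)) powr (- ?q)))"
          by (intro ennreal_leI) (simp add: abs_minus_commute mult_ac)
        also have "\<dots> = ennreal ?C * ?g x (x + z)" by (rule ennreal_mult'[OF C0])
        finally show ?thesis .
      qed simp
    qed
    finally show "ennreal (\<bar>mollify \<epsilon> \<phi> x - \<phi> x\<bar> powr p) \<le> (\<integral>\<^sup>+z. ennreal ?C * ?g x (x + z) \<partial>lborel)" .
  qed
  also have "\<dots> = (\<integral>\<^sup>+x. ennreal ?C * (\<integral>\<^sup>+y. ?g x y \<partial>lborel) \<partial>lborel)"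
    by (intro nn_integral_cong) (subst nn_integral_cmult, measurable, subst nn_integral_lborel_shift, measurable)
  also have "\<dots> = ennreal ?C * gagliardo_energy ?q p \<phi>"
    unfolding gagliardo_energy_def by (rule nn_integral_cmult) measurable
  finally show ?thesis .
qed

lemma integrable_bounded_support:
  fixes \<phi> :: "'a::euclidean_space \<Rightarrow> real"
  assumes [measurable]: "\<phi> \<in> borel_measurable borel" and B: "\<And>x. \<bar>\<phi> x\<bar> \<le> B"
    and supp: "\<And>x. x \<notin> ball x0 \<rho> \<Longrightarrow> \<phi> x = 0"
  shows "integrable lborel \<phi>"
proof (rule Bochner_Integration.integrable_bound)
  show "integrable lborel (\<lambda>z. B * indicat_real (ball x0 \<rho>) z)"
    by (intro integrable_mult_right integrable_real_indicator emeasure_lborel_ball_finite) simp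
  show "AE x in lborel. norm (\<phi> x) \<le> norm (B * indicat_real (ball x0 \<rho>) x)"
  proof (rule AE_I2)
    fix x
    show "norm (\<phi> x) \<le> norm (B * indicat_real (ball x0 \<rho>) x)"
      using B[of x] supp[of x] by (cases "x \<in> ball x0 \<rho>") auto
  qed
qed simp

lemma mollified_sequence:
  fixes \<phi> :: "'a::euclidean_space \<Rightarrow> real" and \<beta> :: real
  assumes [measurable]: "\<phi> \<in> borel_measurable borel" and B: "\<And>x. 0 \<le> \<phi> x" "\<And>x. \<phi> x \<le> B"
    and supp: "\<And>x. x \<notin> ball x0 \<rho> \<Longrightarrow> \<phi> x = 0"
    and p: "1 < p" and b: "0 < \<beta>" and e: "0 < e"
    and fin: "gagliardo_energy (real DIM('a) + \<beta>) p \<phi> < \<infinity>"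
  obtains f :: "nat \<Rightarrow> 'a \<Rightarrow> real" where
    "\<And>n. \<exists>D. (\<forall>x. (f n has_derivative blinfun_apply (D x)) (at x)) \<and> continuous_on UNIV D"
    "\<And>n. f n \<in> borel_measurable borel" "\<And>n x. 0 \<le> f n x" "\<And>n x. f n x \<le> B"
    "\<And>n x. x \<notin> ball x0 (\<rho> + e) \<Longrightarrow> f n x = 0"
    "\<And>n. gagliardo_energy (real DIM('a) + \<beta>) p (f n) \<le> gagliardo_energy (real DIM('a) + \<beta>) p \<phi>"
    "AE x in lborel. (\<lambda>n. f n x) \<longlonglongrightarrow> \<phi> x"
proof -
  have B': "\<bar>\<phi> x\<bar> \<le> B" for x using B[of x] by simp
  define \<epsilon> where "\<epsilon> n = e / real (Suc n)" for n
  have \<epsilon>: "0 < \<epsilon> n" "\<epsilon> n \<le> e" for n using e by (auto simp: \<epsilon>_def field_simps)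
  define g where "g n = mollify (\<epsilon> n) \<phi>" for n
  have gm[measurable]: "g n \<in> borel_measurable borel" for n unfolding g_def by measurable
  have g0: "0 \<le> g n x" "g n x \<le> B" for n x
    unfolding g_def using mollify_bounds[OF \<epsilon>(1), of \<phi> B] B by auto
  have gs: "g n x = 0" if "x \<notin> ball x0 (\<rho> + e)" for n x
    unfolding g_def using mollify_eq_0[OF \<epsilon>(1), of x0 \<rho> \<phi>] supp that \<epsilon>(2)[of n] by auto
  have int: "integrable lborel (\<lambda>x. \<bar>g n x - \<phi> x\<bar> powr p)" for n
  proof (rule integrable_bounded_support[of _ "B powr p" x0 "\<rho> + e"])
    show "\<bar>\<bar>g n x - \<phi> x\<bar> powr p\<bar> \<le> B powr p" for x
      using g0[where n=n and x=x] B[of x] p by (auto intro!: powr_mono2)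
    show "\<bar>g n x - \<phi> x\<bar> powr p = 0" if "x \<notin> ball x0 (\<rho> + e)" for x
      using gs[OF that, of n] supp[of x] that e by auto
  qed measurable
  define E where "E = enn2real (gagliardo_energy (real DIM('a) + \<beta>) p \<phi>)"
  have E: "gagliardo_energy (real DIM('a) + \<beta>) p \<phi> = ennreal E" "0 \<le> E"
    using fin by (auto simp: E_def)
  define c where "c = 2 * 2 ^ DIM('a) / unit_ball_vol (real DIM('a))"
  have c: "0 \<le> c" by (simp add: c_def)
  have bound: "(\<integral>x. norm (\<bar>g n x - \<phi> x\<bar> powr p) \<partial>lborel) \<le> c * E * \<epsilon> n powr \<beta>" for n
  proof -
    have "ennreal (\<integral>x. norm (\<bar>g n x - \<phi> x\<bar> powr p) \<partial>lborel) = (\<integral>\<^sup>+x. ennreal (\<bar>g n x - \<phi> x\<bar> powr p) \<partial>lborel)"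
      using int[of n] by (subst nn_integral_eq_integral) auto
    also have "\<dots> \<le> ennreal (c * \<epsilon> n powr \<beta>) * ennreal E"
      unfolding g_def c_def E(1)[symmetric] by (rule mollify_Lp_error[OF \<epsilon>(1) _ B' p b]) measurable
    also have "\<dots> = ennreal (c * E * \<epsilon> n powr \<beta>)"
      using E c by (simp add: ennreal_mult'[symmetric] mult_ac)
    finally show ?thesis using E c by (subst (asm) ennreal_le_iff) auto
  qed
  have lim: "(\<lambda>n. \<integral>x. norm (\<bar>g n x - \<phi> x\<bar> powr p) \<partial>lborel) \<longlonglongrightarrow> 0"
  proof (rule tendsto_sandwich[OF _ _ tendsto_const])
    have "\<epsilon> \<longlonglongrightarrow> 0" unfolding \<epsilon>_def divide_inverse
      by (intro tendsto_mult_right_zero LIMSEQ_inverse_real_of_nat)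
    then have "(\<lambda>n. c * E * \<epsilon> n powr \<beta>) \<longlonglongrightarrow> c * E * 0 powr \<beta>"
      using b \<epsilon> by (intro tendsto_intros) (auto intro!: always_eventually less_imp_le)
    then show "(\<lambda>n. c * E * \<epsilon> n powr \<beta>) \<longlonglongrightarrow> 0" by simp
  qed (use bound in auto)
  from tendsto_L1_AE_subseq[OF int lim] obtain r :: "nat \<Rightarrow> nat" where
    r: "AE x in lborel. (\<lambda>n. \<bar>g (r n) x - \<phi> x\<bar> powr p) \<longlonglongrightarrow> 0" by blast
  have ae: "AE x in lborel. (\<lambda>n. g (r n) x) \<longlonglongrightarrow> \<phi> x"
    using r
  proof eventually_elim
    case (elim x)
    then have "(\<lambda>n. (\<bar>g (r n) x - \<phi> x\<bar> powr p) powr (1 / p)) \<longlonglongrightarrow> 0 powr (1 / p)"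
      using p by (intro tendsto_intros) auto
    then have "(\<lambda>n. \<bar>g (r n) x - \<phi> x\<bar>) \<longlonglongrightarrow> 0"
      using p by (simp add: powr_powr)
    then show ?case using LIM_zero_iff tendsto_rabs_zero_iff by blast
  qed
  have "\<exists>D. (\<forall>x. (g n has_derivative blinfun_apply (D x)) (at x)) \<and> continuous_on UNIV D" for n
    unfolding g_def by (intro mollify_C1 \<epsilon> integrable_bounded_support[OF _ B' supp]) auto
  moreover have "gagliardo_energy (real DIM('a) + \<beta>) p (g n) \<le> gagliardo_energy (real DIM('a) + \<beta>) p \<phi>" for n
    unfolding g_def by (rule gagliardo_energy_mollify[OF \<epsilon>(1) _ B' p]) measurable
  ultimately show ?thesis using that[of "\<lambda>n. g (r n)"] gm g0 gs ae by blast
qed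

section \<open>Weak limits and exterior integrals\<close>

abbreviation tail_energy :: "real \<Rightarrow> real \<Rightarrow> ('a::euclidean_space \<Rightarrow> real) \<Rightarrow> 'a \<Rightarrow> real \<Rightarrow> ennreal" where
  "tail_energy q p u z R \<equiv>
    (\<integral>\<^sup>+y. ennreal (\<bar>u y\<bar> powr (p - 1) * norm (y - z) powr (- q)) * indicator (- ball z R) y \<partial>lborel)"

abbreviation excess_energy :: "real \<Rightarrow> real \<Rightarrow> ('a::euclidean_space \<Rightarrow> real) \<Rightarrow> real \<Rightarrow> 'a \<Rightarrow> real \<Rightarrow> ennreal" where
  "excess_energy q p u k z R \<equiv>
    (\<integral>\<^sup>+y. ennreal (max 0 (u y - k) powr (p - 1) * norm (y - z) powr (- q)) * indicator (- ball z R) y \<partial>lborel)"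

lemma ball_cball_measurable [measurable]: "ball (x::'a::metric_space) r \<in> sets borel" "cball x r \<in> sets borel"
  by auto

lemma tendsto_ennreal_0I:
  fixes f :: "nat \<Rightarrow> ennreal"
  assumes "\<And>e. 0 < e \<Longrightarrow> eventually (\<lambda>n. f n \<le> ennreal e) sequentially"
  shows "f \<longlonglongrightarrow> 0"
proof (rule order_tendstoI)
  fix a :: ennreal assume "0 < a"
  then obtain b where b: "0 < b" "b < a" using dense by blast
  have "b < top" using b(2) top_greatest by (rule less_le_trans)
  then have e: "0 < enn2real b" "ennreal (enn2real b) < a"
    using b by (auto simp: enn2real_positive_iff)
  then show "eventually (\<lambda>n. f n < a) sequentially"
    by (intro eventually_mono[OF assms[OF e(1)]]) (use e(2) in simp)
qed simp

text \<open>A sequence that is bounded in \<open>L\<^sup>p\<close> with weight \<open>k\<close> and tends to \<open>0\<close> almost everywhere also tends to \<open>0\<close> when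
  tested with \<open>a powr (p - 1)\<close>, for \<open>a\<close> in \<open>L\<^sup>p\<close>.  Where \<open>d n \<le> t * a\<close> the integrand is dominated by
  \<open>t * a powr p\<close>; elsewhere \<open>a powr (p - 1) * d n\<close> is at most \<open>t powr (1 - p) * d n powr p\<close>, which is small in the
  mean for large \<open>t\<close>.\<close>

lemma nn_integral_weak_limit:
  fixes a k :: "'b \<Rightarrow> real" and d :: "nat \<Rightarrow> 'b \<Rightarrow> real"
  assumes [measurable]: "a \<in> borel_measurable M" "k \<in> borel_measurable M" "\<And>n. d n \<in> borel_measurable M"
    and nonneg: "\<And>x. 0 \<le> a x" "\<And>x. 0 \<le> k x" "\<And>n x. 0 \<le> d n x" and p: "1 < p"
    and fin: "(\<integral>\<^sup>+x. ennreal (a x powr p * k x) \<partial>M) < \<infinity>"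
    and bound: "\<And>n. (\<integral>\<^sup>+x. ennreal (d n x powr p * k x) \<partial>M) \<le> E" "E < \<infinity>"
    and lim: "AE x in M. (\<lambda>n. d n x) \<longlonglongrightarrow> 0"
  shows "(\<lambda>n. \<integral>\<^sup>+x. ennreal (a x powr (p - 1) * d n x * k x) \<partial>M) \<longlonglongrightarrow> 0"
proof (rule tendsto_ennreal_0I)
  fix e :: real assume e: "0 < e"
  obtain E' where E': "E = ennreal E'" "0 \<le> E'" using bound(2) by (cases E) auto
  \<comment> \<open>chosen so that \<open>t powr (1 - p) * E' \<le> e / 2\<close>\<close>
  define t where "t = (2 * (E' + 1) / e) powr (1 / (p - 1))"
  have t: "0 < t" unfolding t_def using e E' by auto
  have tp: "t powr (1 - p) = e / (2 * (E' + 1))"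
  proof -
    have "t powr (1 - p) = (2 * (E' + 1) / e) powr (1 / (p - 1) * (1 - p))"
      by (simp add: t_def powr_powr)
    also have "1 / (p - 1) * (1 - p) = -1" using p by (simp add: field_simps)
    finally show ?thesis using e E' by (simp add: powr_minus field_simps)
  qed
  let ?I = "\<lambda>n. \<integral>\<^sup>+x. ennreal (a x powr (p - 1) * min (d n x) (t * a x) * k x) \<partial>M"
  have "?I \<longlonglongrightarrow> (\<integral>\<^sup>+x. 0 \<partial>M)"
  proof (rule nn_integral_dominated_convergence[where w = "\<lambda>x. ennreal t * ennreal (a x powr p * k x)"])
    fix n
    show "AE x in M. ennreal (a x powr (p - 1) * min (d n x) (t * a x) * k x) \<le> ennreal t * ennreal (a x powr p * k x)"
    proof (rule AE_I2)
      fix x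
      have "a x powr (p - 1) * min (d n x) (t * a x) * k x \<le> a x powr (p - 1) * (t * a x) * k x"
        using nonneg by (intro mult_right_mono mult_left_mono) auto
      also have "\<dots> = t * (a x powr p * k x)"
        using nonneg(1)[of x] by (cases "a x = 0") (auto simp: powr_diff)
      finally show "ennreal (a x powr (p - 1) * min (d n x) (t * a x) * k x) \<le> ennreal t * ennreal (a x powr p * k x)"
        using t nonneg by (simp add: ennreal_mult'[symmetric] ennreal_leI)
    qed
  next
    have "(\<integral>\<^sup>+x. ennreal t * ennreal (a x powr p * k x) \<partial>M) = ennreal t * (\<integral>\<^sup>+x. ennreal (a x powr p * k x) \<partial>M)"
      by (rule nn_integral_cmult) measurable
    then show "(\<integral>\<^sup>+x. ennreal t * ennreal (a x powr p * k x) \<partial>M) < \<infinity>"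
      using fin by (simp add: ennreal_mult_less_top)
  next
    show "AE x in M. (\<lambda>n. ennreal (a x powr (p - 1) * min (d n x) (t * a x) * k x)) \<longlonglongrightarrow> 0"
      using lim
    proof eventually_elim
      case (elim x)
      have "(\<lambda>n. min (d n x) (t * a x)) \<longlonglongrightarrow> min 0 (t * a x)"
        by (intro tendsto_min elim tendsto_const)
      then have "(\<lambda>n. a x powr (p - 1) * min (d n x) (t * a x) * k x) \<longlonglongrightarrow> a x powr (p - 1) * 0 * k x"
        using nonneg(1)[of x] t by (intro tendsto_intros) simp
      then have "(\<lambda>n. ennreal (a x powr (p - 1) * min (d n x) (t * a x) * k x)) \<longlonglongrightarrow> ennreal 0"
        by (intro tendsto_ennrealI) simp
      then show ?case by simp
    qed
  qed measurable
  then have "?I \<longlonglongrightarrow> 0" by simp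
  then have "eventually (\<lambda>n. ?I n < ennreal (e / 2)) sequentially"
    using e by (intro order_tendstoD) auto
  then show "eventually (\<lambda>n. (\<integral>\<^sup>+x. ennreal (a x powr (p - 1) * d n x * k x) \<partial>M) \<le> ennreal e) sequentially"
  proof eventually_elim
    case (elim n)
    have "(\<integral>\<^sup>+x. ennreal (a x powr (p - 1) * d n x * k x) \<partial>M)
      \<le> (\<integral>\<^sup>+x. ennreal (a x powr (p - 1) * min (d n x) (t * a x) * k x) + ennreal (t powr (1 - p)) * ennreal (d n x powr p * k x) \<partial>M)"
    proof (rule nn_integral_mono)
      fix x
      have "a x powr (p - 1) * d n x \<le> a x powr (p - 1) * min (d n x) (t * a x) + t powr (1 - p) * d n x powr p"
      proof (cases "d n x \<le> t * a x")
        case False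
        then have d: "0 < d n x" using t nonneg(1)[of x] by (smt (verit) mult_nonneg_nonneg)
        have "a x powr (p - 1) \<le> (d n x / t) powr (p - 1)"
          using False t p nonneg by (intro powr_mono2) (auto simp: field_simps)
        also have "\<dots> = t powr (1 - p) * d n x powr (p - 1)"
          using powr_minus_divide[of t "p - 1"] by (simp add: powr_divide)
        finally have "a x powr (p - 1) * d n x \<le> t powr (1 - p) * d n x powr (p - 1) * d n x"
          using d by (intro mult_right_mono) auto
        also have "\<dots> = t powr (1 - p) * d n x powr p" using d by (simp add: powr_diff)
        also have "\<dots> \<le> a x powr (p - 1) * min (d n x) (t * a x) + t powr (1 - p) * d n x powr p"
          using nonneg t by simp
        finally show ?thesis .
      qed simp
      then have "a x powr (p - 1) * d n x * k x \<le> (a x powr (p - 1) * min (d n x) (t * a x) + t powr (1 - p) * d n x powr p) * k x"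
        using nonneg(2) by (rule mult_right_mono)
      then have "a x powr (p - 1) * d n x * k x \<le> a x powr (p - 1) * min (d n x) (t * a x) * k x + t powr (1 - p) * (d n x powr p * k x)"
        by (simp add: algebra_simps)
      then show "ennreal (a x powr (p - 1) * d n x * k x)
        \<le> ennreal (a x powr (p - 1) * min (d n x) (t * a x) * k x) + ennreal (t powr (1 - p)) * ennreal (d n x powr p * k x)"
        using nonneg t by (simp add: ennreal_mult'[symmetric] ennreal_plus[symmetric] ennreal_leI del: ennreal_plus)
    qed
    also have "\<dots> = ?I n + ennreal (t powr (1 - p)) * (\<integral>\<^sup>+x. ennreal (d n x powr p * k x) \<partial>M)"
    proof (subst nn_integral_add)
      show "?I n + (\<integral>\<^sup>+x. ennreal (t powr (1 - p)) * ennreal (d n x powr p * k x) \<partial>M)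
        = ?I n + ennreal (t powr (1 - p)) * (\<integral>\<^sup>+x. ennreal (d n x powr p * k x) \<partial>M)"
        by (subst nn_integral_cmult) measurable
    qed measurable
    also have "\<dots> \<le> ennreal (e / 2) + ennreal (e / (2 * (E' + 1))) * ennreal E'"
      using elim bound(1)[of n] unfolding tp E' by (intro add_mono mult_left_mono) auto
    also have "\<dots> = ennreal (e / 2 + e / (2 * (E' + 1)) * E')"
      using e E' by (simp add: ennreal_mult'[symmetric] ennreal_plus[symmetric] del: ennreal_plus)
    also have "\<dots> \<le> ennreal e"
      using e E' by (intro ennreal_leI) (simp add: field_simps)
    finally show ?case .
  qed
qed

abbreviation lborel2 :: "('a::euclidean_space \<times> 'a) measure" where
  "lborel2 \<equiv> lborel \<Otimes>\<^sub>M lborel"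

text \<open>The data of a local subsolution in terms of Borel functions and Lebesgue-Borel measure, so that Fubini's theorem
  for \<open>lborel \<Otimes>\<^sub>M lborel\<close> applies.  The bounds of the kernel are written with a negative power,
  which is \<open>0\<close> on the diagonal.\<close>

definition borel_subsolution :: "real \<Rightarrow> real \<Rightarrow> real \<Rightarrow> real \<Rightarrow> ('a \<times> 'a \<Rightarrow> real) \<Rightarrow> 'a::euclidean_space set \<Rightarrow> ('a \<Rightarrow> real) \<Rightarrow> bool" where
  "borel_subsolution p s \<Lambda>1 \<Lambda>2 K \<Omega> u \<longleftrightarrow>
     u \<in> borel_measurable borel \<and> K \<in> borel_measurable (borel \<Otimes>\<^sub>M borel) \<and>
     (AE (x, y) in lborel2. \<Lambda>1 * norm (x - y) powr (- (real DIM('a) + p * s)) \<le> K (x, y) \<and>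
        K (x, y) \<le> \<Lambda>2 * norm (x - y) powr (- (real DIM('a) + p * s))) \<and>
     (\<forall>x0 r. cball x0 r \<subseteq> \<Omega> \<longrightarrow>
        (\<exists>M. AE x in lborel. x \<in> ball x0 r \<longrightarrow> \<bar>u x\<bar> \<le> M) \<and>
        (\<integral>\<^sup>+x. \<integral>\<^sup>+y. ennreal (\<bar>u x - u y\<bar> powr p * norm (x - y) powr (- (real DIM('a) + p * s)))
           * indicator (ball x0 r) x * indicator (ball x0 r) y \<partial>lborel \<partial>lborel) < \<infinity>) \<and>
     (\<integral>\<^sup>+x. ennreal (\<bar>u x\<bar> powr (p - 1) * (1 + norm x) powr (- (real DIM('a) + p * s))) \<partial>lborel) < \<infinity> \<and>
     (\<forall>\<phi>\<in>C1c \<Omega>. (\<forall>x. 0 \<le> \<phi> x) \<longrightarrow>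
        (\<integral>(x, y). Jp p (u x - u y) * (\<phi> x - \<phi> y) * K (x, y) \<partial>lborel2) \<le> 0)"

text \<open>For \<open>x\<close> well inside the ball and \<open>y\<close> outside, \<open>|x - y|\<close> is comparable to \<open>1 + |y|\<close>; this links the kernel with
  the weight in the definition of the space of admissible functions.\<close>

lemma far_kernel_le:
  fixes x y x0 :: "'a::euclidean_space"
  assumes r: "0 < r" and q: "0 \<le> q" and x: "x \<in> ball x0 (3 * r / 4)" and y: "y \<notin> ball x0 r"
  shows "norm (x - y) powr (- q) \<le> ((1 + norm x0 + r) * (4 / r) + 1) powr q * (1 + norm y) powr (- q)"
proof -
  let ?A = "(1 + norm x0 + r) * (4 / r) + 1"
  have d: "r / 4 \<le> norm (x - y)"
    using x y dist_triangle[of x0 y x] by (auto simp: dist_norm)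
  then have xy: "0 < norm (x - y)" using r by linarith
  have "norm y \<le> norm x0 + norm (x - x0) + norm (x - y)"
    using norm_triangle_ineq[of x0 "x - x0"] norm_triangle_ineq[of x "y - x"] by (simp add: norm_minus_commute)
  also have "\<dots> \<le> norm x0 + r + norm (x - y)"
    using x r by (auto simp: dist_norm norm_minus_commute)
  finally have "1 + norm y \<le> (1 + norm x0 + r) * 1 + norm (x - y)" by simp
  also have "\<dots> \<le> (1 + norm x0 + r) * (4 / r * norm (x - y)) + norm (x - y)"
    using d r by (intro add_right_mono mult_left_mono) (auto simp: field_simps intro: add_nonneg_nonneg)
  also have "\<dots> = ?A * norm (x - y)" by (simp add: algebra_simps)
  finally have le: "(1 + norm y) / ?A \<le> norm (x - y)"
    using r by (subst pos_divide_le_eq) (auto simp: mult.commute intro!: add_nonneg_pos mult_nonneg_nonneg)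
  have A: "0 < ?A" using r by (intro add_nonneg_pos mult_nonneg_nonneg) auto
  have y1: "0 < 1 + norm y" by (smt (verit) norm_ge_zero)
  have "norm (x - y) powr (- q) \<le> ((1 + norm y) / ?A) powr (- q)"
    using q le A y1 by (intro powr_mono2' divide_pos_pos) auto
  also have "\<dots> = ?A powr q * (1 + norm y) powr (- q)"
    using A y1 by (simp add: powr_divide powr_minus field_simps)
  finally show ?thesis .
qed

lemma weight_integral_finite:
  assumes "0 < \<beta>"
  shows "(\<integral>\<^sup>+y. ennreal ((1 + norm (y::'a::euclidean_space)) powr (- (real DIM('a) + \<beta>))) \<partial>lborel) < \<infinity>"
proof -
  let ?q = "real DIM('a) + \<beta>"
  have "(\<integral>\<^sup>+y. ennreal ((1 + norm (y::'a)) powr (- ?q)) \<partial>lborel)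
     \<le> (\<integral>\<^sup>+y. indicator (ball (0::'a) 1) y + ennreal (norm (y - 0) powr (- ?q)) * indicator (- ball 0 1) y \<partial>lborel)"
  proof (rule nn_integral_mono)
    fix y :: 'a
    show "ennreal ((1 + norm y) powr (- ?q)) \<le> indicator (ball 0 1) y + ennreal (norm (y - 0) powr (- ?q)) * indicator (- ball 0 1) y"
    proof (cases "y \<in> ball 0 1")
      case True
      have "(1 + norm y) powr (- ?q) \<le> 1 powr (- ?q)" using assms by (intro powr_mono2') auto
      then show ?thesis using True by simp
    next
      case False
      then have "(1 + norm y) powr (- ?q) \<le> norm y powr (- ?q)" using assms by (intro powr_mono2') auto
      then show ?thesis using False by (simp add: ennreal_leI)
    qed
  qed
  also have "\<dots> = emeasure lborel (ball (0::'a) 1) + (\<integral>\<^sup>+y. ennreal (norm (y - 0) powr (- ?q)) * indicator (- ball (0::'a) 1) y \<partial>lborel)"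
    by (subst nn_integral_add) auto
  also have "\<dots> < \<infinity>"
    using kernel_far_integral[OF assms, of 1 "0::'a"] emeasure_lborel_ball_finite[of "0::'a" 1] by (auto simp: less_top[symmetric] top_unique)
  finally show ?thesis .
qed

lemma exterior_energy_finite:
  fixes u :: "'a::euclidean_space \<Rightarrow> real"
  assumes p: "1 < p" and b: "0 < \<beta>" and r: "0 < r" and [measurable]: "u \<in> borel_measurable borel"
    and M: "AE x in lborel. x \<in> ball x0 r \<longrightarrow> \<bar>u x\<bar> \<le> M"
    and tail: "(\<integral>\<^sup>+x. ennreal (\<bar>u x\<bar> powr (p - 1) * (1 + norm x) powr (- (real DIM('a) + \<beta>))) \<partial>lborel) < \<infinity>"
  shows "(\<integral>\<^sup>+x. \<integral>\<^sup>+y. ennreal (\<bar>u x - u y\<bar> powr (p - 1) * norm (x - y) powr (- (real DIM('a) + \<beta>)))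
           * indicator (ball x0 (3 * r / 4)) x * indicator (- ball x0 r) y \<partial>lborel \<partial>lborel) < \<infinity>"
proof -
  let ?q = "real DIM('a) + \<beta>"
  define A where "A = ((1 + norm x0 + r) * (4 / r) + 1) powr ?q"
  define c where "c = A * 2 powr (p - 1)"
  have c0: "0 \<le> c" by (simp add: c_def A_def)
  define I where "I = (\<integral>\<^sup>+y. ennreal (c * (1 + norm y) powr (- ?q) * \<bar>M\<bar> powr (p - 1)) + ennreal c * ennreal (\<bar>u y\<bar> powr (p - 1) * (1 + norm y) powr (- ?q)) \<partial>lborel)"
  have "(\<integral>\<^sup>+x. \<integral>\<^sup>+y. ennreal (\<bar>u x - u y\<bar> powr (p - 1) * norm (x - y) powr (- ?q))
           * indicator (ball x0 (3 * r / 4)) x * indicator (- ball x0 r) y \<partial>lborel \<partial>lborel)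
      \<le> (\<integral>\<^sup>+x. I * indicator (ball x0 (3 * r / 4)) x \<partial>lborel)"
  proof (rule nn_integral_mono_AE)
    show "AE x in lborel. (\<integral>\<^sup>+y. ennreal (\<bar>u x - u y\<bar> powr (p - 1) * norm (x - y) powr (- ?q))
           * indicator (ball x0 (3 * r / 4)) x * indicator (- ball x0 r) y \<partial>lborel) \<le> I * indicator (ball x0 (3 * r / 4)) x"
      using M
    proof eventually_elim
      case (elim x)
      show ?case
      proof (cases "x \<in> ball x0 (3 * r / 4)")
        case True
        then have "x \<in> ball x0 r" using r by auto
        with elim have ux: "\<bar>u x\<bar> \<le> M" by simp
        have "(\<integral>\<^sup>+y. ennreal (\<bar>u x - u y\<bar> powr (p - 1) * norm (x - y) powr (- ?q))
           * indicator (ball x0 (3 * r / 4)) x * indicator (- ball x0 r) y \<partial>lborel) \<le> I"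
          unfolding I_def
        proof (rule nn_integral_mono)
          fix y
          show "ennreal (\<bar>u x - u y\<bar> powr (p - 1) * norm (x - y) powr (- ?q)) * indicator (ball x0 (3 * r / 4)) x * indicator (- ball x0 r) y
            \<le> ennreal (c * (1 + norm y) powr (- ?q) * \<bar>M\<bar> powr (p - 1)) + ennreal c * ennreal (\<bar>u y\<bar> powr (p - 1) * (1 + norm y) powr (- ?q))"
          proof (cases "y \<in> ball x0 r")
            case False
            have "\<bar>u x - u y\<bar> powr (p - 1) \<le> (\<bar>u x\<bar> + \<bar>u y\<bar>) powr (p - 1)"
              using p by (intro powr_mono2) auto
            also have "\<dots> \<le> 2 powr (p - 1) * (\<bar>u x\<bar> powr (p - 1) + \<bar>u y\<bar> powr (p - 1))"
              using p by (intro powr_add_le) auto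
            also have "\<dots> \<le> 2 powr (p - 1) * (\<bar>M\<bar> powr (p - 1) + \<bar>u y\<bar> powr (p - 1))"
              using p ux by (intro mult_left_mono add_right_mono powr_mono2) auto
            finally have "\<bar>u x - u y\<bar> powr (p - 1) * norm (x - y) powr (- ?q)
              \<le> (2 powr (p - 1) * (\<bar>M\<bar> powr (p - 1) + \<bar>u y\<bar> powr (p - 1))) * (A * (1 + norm y) powr (- ?q))"
              using far_kernel_le[OF r _ True False, of ?q] b unfolding A_def by (intro mult_mono) auto
            also have "\<dots> = c * (1 + norm y) powr (- ?q) * \<bar>M\<bar> powr (p - 1) + c * (\<bar>u y\<bar> powr (p - 1) * (1 + norm y) powr (- ?q))"
              by (simp add: c_def algebra_simps)
            finally show ?thesis using True False c0
              by (simp add: ennreal_mult'[symmetric] ennreal_plus[symmetric] ennreal_leI del: ennreal_plus)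
          qed simp
        qed
        then show ?thesis using True by simp
      qed simp
    qed
  qed
  also have "\<dots> = I * emeasure lborel (ball x0 (3 * r / 4))"
    by (rule nn_integral_cmult_indicator) simp
  also have "\<dots> < \<infinity>"
  proof -
    have "I = ennreal (c * \<bar>M\<bar> powr (p - 1)) * (\<integral>\<^sup>+y. ennreal ((1 + norm (y::'a)) powr (- ?q)) \<partial>lborel)
       + ennreal c * (\<integral>\<^sup>+x. ennreal (\<bar>u x\<bar> powr (p - 1) * (1 + norm x) powr (- ?q)) \<partial>lborel)"
      unfolding I_def using c0
      using c0
      by (simp add: nn_integral_add nn_integral_cmult[symmetric] ennreal_mult'[symmetric] mult_ac)
    also have "\<dots> < \<infinity>"
      using weight_integral_finite[OF b, where 'a = 'a] tail by (auto simp: ennreal_mult_less_top)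
    finally show ?thesis using emeasure_lborel_ball_finite[of x0 "3 * r / 4"] by (auto simp: ennreal_mult_less_top)
  qed
  finally show ?thesis .
qed

lemma nn_integral_lborel2:
  fixes f :: "'a::euclidean_space \<times> 'a \<Rightarrow> ennreal"
  assumes "f \<in> borel_measurable lborel2"
  shows "(\<integral>\<^sup>+z. f z \<partial>lborel2) = (\<integral>\<^sup>+x. \<integral>\<^sup>+y. f (x, y) \<partial>lborel \<partial>lborel)"
  using lborel.nn_integral_fst[OF assms] by simp

lemma nn_integral_lborel2_swap:
  fixes f :: "'a::euclidean_space \<times> 'a \<Rightarrow> ennreal"
  assumes "f \<in> borel_measurable lborel2"
  shows "(\<integral>\<^sup>+z. f z \<partial>lborel2) = (\<integral>\<^sup>+y. \<integral>\<^sup>+x. f (x, y) \<partial>lborel \<partial>lborel)"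
  using lborel_pair.nn_integral_snd[OF assms] by simp

lemma AE_lborel2_coordinate:
  assumes "AE x in lborel. Q (x::'a::euclidean_space)"
  shows "AE z in lborel2. Q (fst z)" "AE z in lborel2. Q (snd z)"
proof -
  obtain N where N: "N \<in> null_sets lborel" "{x. \<not> Q x} \<subseteq> N"
    using assms unfolding eventually_ae_filter by auto
  have "N \<times> UNIV \<in> null_sets (lborel2 :: ('a \<times> 'a) measure)"
    using N(1) lborel.emeasure_pair_measure_Times[of N lborel UNIV] by (auto simp: null_sets_def)
  then show "AE z in lborel2. Q (fst z)"
    by (rule AE_I') (use N(2) in auto)
  have "UNIV \<times> N \<in> null_sets (lborel2 :: ('a \<times> 'a) measure)"
    using N(1) lborel.emeasure_pair_measure_Times[of UNIV lborel N] by (auto simp: null_sets_def)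
  then show "AE z in lborel2. Q (snd z)"
    by (rule AE_I') (use N(2) in auto)
qed

section \<open>Testing with functions of finite energy\<close>

locale subsolution_ball =
  fixes p s \<Lambda>1 \<Lambda>2 :: real and K :: "'a::euclidean_space \<times> 'a \<Rightarrow> real" and \<Omega> :: "'a set" and u :: "'a \<Rightarrow> real"
    and x0 :: 'a and r :: real
  assumes p: "1 < p" and s: "0 < s" "s < 1" and \<Lambda>: "0 < \<Lambda>1" "\<Lambda>1 \<le> \<Lambda>2"
    and sub: "borel_subsolution p s \<Lambda>1 \<Lambda>2 K \<Omega> u" and r: "0 < r" and ball: "cball x0 r \<subseteq> \<Omega>"
begin

definition "q = real DIM('a) + p * s"

lemma ps: "0 < p * s" using p s by simp

lemma q: "0 < q" using ps unfolding q_def by (smt (verit) DIM_positive of_nat_0_less_iff)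

definition ker :: "'a \<Rightarrow> 'a \<Rightarrow> real" where "ker x y = norm (x - y) powr (- q)"

lemma ker_nonneg: "0 \<le> ker x y" by (simp add: ker_def)

lemma ker_measurable [measurable]: "(\<lambda>(x, y). ker x y) \<in> borel_measurable (borel \<Otimes>\<^sub>M borel)"
  unfolding ker_def by measurable

lemma u_measurable [measurable]: "u \<in> borel_measurable borel"
  and K_measurable [measurable]: "K \<in> borel_measurable (borel \<Otimes>\<^sub>M borel)"
  and K_bounds: "AE (x, y) in lborel2. \<Lambda>1 * ker x y \<le> K (x, y) \<and> K (x, y) \<le> \<Lambda>2 * ker x y"
  and weak: "\<And>\<phi>. \<phi> \<in> C1c \<Omega> \<Longrightarrow> (\<And>x. 0 \<le> \<phi> x) \<Longrightarrow> (\<integral>(x, y). Jp p (u x - u y) * (\<phi> x - \<phi> y) * K (x, y) \<partial>lborel2) \<le> 0"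
  and tail: "(\<integral>\<^sup>+x. ennreal (\<bar>u x\<bar> powr (p - 1) * (1 + norm x) powr (- q)) \<partial>lborel) < \<infinity>"
  and energy: "(\<integral>\<^sup>+x. \<integral>\<^sup>+y. ennreal (\<bar>u x - u y\<bar> powr p * ker x y)
           * indicator (ball x0 r) x * indicator (ball x0 r) y \<partial>lborel \<partial>lborel) < \<infinity>"
  and bounded: "\<exists>M. AE x in lborel. x \<in> ball x0 r \<longrightarrow> \<bar>u x\<bar> \<le> M"
  using sub ball unfolding borel_subsolution_def ker_def q_def by blast+

text \<open>The weights of the two parts of the double integral that a test function supported in the three-quarter ball can
  see: both points in the ball, or one point in the three-quarter ball and the other outside the ball.  On the first
  part \<open>u\<close> has finite energy, on the second only its \<open>(p - 1)\<close>-st power is integrable, but there the kernel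
  is not singular.\<close>

definition near :: "'a \<times> 'a \<Rightarrow> real" where
  "near = (\<lambda>(x, y). ker x y * indicator (ball x0 r) x * indicator (ball x0 r) y)"

definition ext :: "'a \<times> 'a \<Rightarrow> real" where
  "ext = (\<lambda>(x, y). \<bar>u x - u y\<bar> powr (p - 1) * ker x y *
      (indicator (ball x0 (3 * r / 4)) x * indicator (- ball x0 r) y + indicator (ball x0 (3 * r / 4)) y * indicator (- ball x0 r) x))"

lemma near_nonneg: "0 \<le> near z" and ext_nonneg: "0 \<le> ext z"
  by (auto simp: near_def ext_def ker_nonneg split: prod.split)

lemma near_measurable [measurable]: "near \<in> borel_measurable (borel \<Otimes>\<^sub>M borel)"
  unfolding near_def by measurable

lemma ext_measurable [measurable]: "ext \<in> borel_measurable (borel \<Otimes>\<^sub>M borel)"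
  unfolding ext_def by measurable

lemma near_energy_finite: "(\<integral>\<^sup>+(x, y). ennreal (\<bar>u x - u y\<bar> powr p * near (x, y)) \<partial>lborel2) < \<infinity>"
proof -
  have "(\<integral>\<^sup>+(x, y). ennreal (\<bar>u x - u y\<bar> powr p * near (x, y)) \<partial>lborel2)
    = (\<integral>\<^sup>+x. \<integral>\<^sup>+y. ennreal (\<bar>u x - u y\<bar> powr p * ker x y)
           * indicator (ball x0 r) x * indicator (ball x0 r) y \<partial>lborel \<partial>lborel)"
    by (subst nn_integral_lborel2, measurable)
       (auto intro!: nn_integral_cong simp: near_def ker_nonneg indicator_def)
  then show ?thesis using energy by simp
qed

lemma ext_finite: "(\<integral>\<^sup>+z. ennreal (ext z) \<partial>lborel2) < \<infinity>"
proof -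
  let ?f = "\<lambda>x y. ennreal (\<bar>u x - u y\<bar> powr (p - 1) * ker x y) * indicator (ball x0 (3 * r / 4)) x * indicator (- ball x0 r) y"
  obtain M where M: "AE x in lborel. x \<in> ball x0 r \<longrightarrow> \<bar>u x\<bar> \<le> M" using bounded by blast
  have fin: "(\<integral>\<^sup>+x. \<integral>\<^sup>+y. ?f x y \<partial>lborel \<partial>lborel) < \<infinity>"
    unfolding ker_def q_def
    by (rule exterior_energy_finite[OF p ps r _ M]) (use tail in \<open>auto simp: q_def\<close>)
  have "(\<integral>\<^sup>+z. ennreal (ext z) \<partial>lborel2) \<le> (\<integral>\<^sup>+z. ?f (fst z) (snd z) + ?f (snd z) (fst z) \<partial>lborel2)"
    using r by (intro nn_integral_mono) (auto simp: ext_def ker_def norm_minus_commute abs_minus_commute indicator_def split: prod.split)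
  also have "\<dots> = (\<integral>\<^sup>+z. ?f (fst z) (snd z) \<partial>lborel2) + (\<integral>\<^sup>+z. ?f (snd z) (fst z) \<partial>lborel2)"
    by (rule nn_integral_add) measurable
  also have "(\<integral>\<^sup>+z. ?f (fst z) (snd z) \<partial>lborel2) = (\<integral>\<^sup>+x. \<integral>\<^sup>+y. ?f x y \<partial>lborel \<partial>lborel)"
    by (subst nn_integral_lborel2) measurable
  also have "(\<integral>\<^sup>+z. ?f (snd z) (fst z) \<partial>lborel2) = (\<integral>\<^sup>+x. \<integral>\<^sup>+y. ?f x y \<partial>lborel \<partial>lborel)"
    by (subst nn_integral_lborel2_swap) measurable
  also have "(\<integral>\<^sup>+x. \<integral>\<^sup>+y. ?f x y \<partial>lborel \<partial>lborel) + (\<integral>\<^sup>+x. \<integral>\<^sup>+y. ?f x y \<partial>lborel \<partial>lborel) < \<infinity>"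
    using fin by simp
  finally show ?thesis .
qed

abbreviation weak_integrand :: "('a \<Rightarrow> real) \<Rightarrow> 'a \<times> 'a \<Rightarrow> real" where
  "weak_integrand \<phi> \<equiv> (\<lambda>(x, y). Jp p (u x - u y) * (\<phi> x - \<phi> y) * K (x, y))"

definition testfun :: "real \<Rightarrow> ('a \<Rightarrow> real) \<Rightarrow> bool" where
  "testfun B \<phi> \<longleftrightarrow> \<phi> \<in> borel_measurable borel \<and> (\<forall>x. 0 \<le> \<phi> x \<and> \<phi> x \<le> B) \<and> (\<forall>x. x \<notin> ball x0 (3 * r / 4) \<longrightarrow> \<phi> x = 0) \<and>
     gagliardo_energy q p \<phi> < \<infinity>"

lemma weak_integrand_le:
  assumes supp: "\<And>x. x \<notin> ball x0 (3 * r / 4) \<Longrightarrow> \<phi> x = 0"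
    and K: "\<Lambda>1 * ker x y \<le> K (x, y) \<and> K (x, y) \<le> \<Lambda>2 * ker x y"
  shows "\<bar>Jp p (u x - u y) * (\<phi> x - \<phi> y) * K (x, y)\<bar>
    \<le> \<Lambda>2 * (\<bar>u x - u y\<bar> powr (p - 1) * \<bar>\<phi> x - \<phi> y\<bar> * near (x, y)) + \<Lambda>2 * (\<bar>\<phi> x - \<phi> y\<bar> * ext (x, y))"
proof -
  have K': "\<bar>K (x, y)\<bar> \<le> \<Lambda>2 * ker x y"
    using K \<Lambda> ker_nonneg[of x y] by (smt (verit) mult_nonneg_nonneg)
  let ?V = "ball x0 r" and ?W = "ball x0 (3 * r / 4)"
  have WV: "?W \<subseteq> ?V" using r by auto
  have "\<bar>Jp p (u x - u y) * (\<phi> x - \<phi> y) * K (x, y)\<bar> = \<bar>u x - u y\<bar> powr (p - 1) * \<bar>\<phi> x - \<phi> y\<bar> * \<bar>K (x, y)\<bar>"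
    by (simp add: abs_mult abs_Jp)
  also have "\<dots> \<le> \<bar>u x - u y\<bar> powr (p - 1) * \<bar>\<phi> x - \<phi> y\<bar> * (\<Lambda>2 * ker x y)"
    using K' by (intro mult_left_mono) auto
  also have "\<dots> = \<Lambda>2 * (\<bar>u x - u y\<bar> powr (p - 1) * ker x y) * \<bar>\<phi> x - \<phi> y\<bar>" by simp
  also have "\<dots> \<le> \<Lambda>2 * (\<bar>u x - u y\<bar> powr (p - 1) * ker x y) * (\<bar>\<phi> x - \<phi> y\<bar> * indicator ?V x * indicator ?V y
      + \<bar>\<phi> x - \<phi> y\<bar> * (indicator ?W x * indicator (- ?V) y + indicator ?W y * indicator (- ?V) x))"
  proof (rule mult_left_mono)
    show "\<bar>\<phi> x - \<phi> y\<bar> \<le> \<bar>\<phi> x - \<phi> y\<bar> * indicator ?V x * indicator ?V y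
      + \<bar>\<phi> x - \<phi> y\<bar> * (indicator ?W x * indicator (- ?V) y + indicator ?W y * indicator (- ?V) x)"
      using supp[of x] supp[of y] WV by (auto simp: indicator_def)
    show "0 \<le> \<Lambda>2 * (\<bar>u x - u y\<bar> powr (p - 1) * ker x y)"
      using \<Lambda> ker_nonneg by simp
  qed
  also have "\<dots> = \<Lambda>2 * (\<bar>u x - u y\<bar> powr (p - 1) * \<bar>\<phi> x - \<phi> y\<bar> * near (x, y)) + \<Lambda>2 * (\<bar>\<phi> x - \<phi> y\<bar> * ext (x, y))"
    by (simp add: near_def ext_def algebra_simps)
  finally show ?thesis .
qed

lemma near_test_energy:
  assumes [measurable]: "\<phi> \<in> borel_measurable borel"
  shows "(\<integral>\<^sup>+(x, y). ennreal (\<bar>\<phi> x - \<phi> y\<bar> powr p * near (x, y)) \<partial>lborel2) \<le> gagliardo_energy q p \<phi>"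
proof -
  have "(\<integral>\<^sup>+(x, y). ennreal (\<bar>\<phi> x - \<phi> y\<bar> powr p * near (x, y)) \<partial>lborel2)
    \<le> (\<integral>\<^sup>+(x, y). ennreal (\<bar>\<phi> x - \<phi> y\<bar> powr p * ker x y) \<partial>lborel2)"
    by (intro nn_integral_mono) (auto simp: near_def ker_nonneg indicator_def split: prod.split)
  also have "\<dots> = gagliardo_energy q p \<phi>"
    unfolding gagliardo_energy_def ker_def by (subst nn_integral_lborel2) measurable
  finally show ?thesis .
qed

lemma weak_integrable:
  assumes \<phi>: "testfun B \<phi>"
  shows "integrable lborel2 (weak_integrand \<phi>)"
proof -
  have [measurable]: "\<phi> \<in> borel_measurable borel" and B: "\<And>x. 0 \<le> \<phi> x" "\<And>x. \<phi> x \<le> B"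
    and supp: "\<And>x. x \<notin> ball x0 (3 * r / 4) \<Longrightarrow> \<phi> x = 0" and E: "gagliardo_energy q p \<phi> < \<infinity>"
    using \<phi> by (auto simp: testfun_def)
  have B0: "0 \<le> B" using B[of x0] by linarith
  have "(\<integral>\<^sup>+z. ennreal (norm ((weak_integrand \<phi>) z)) \<partial>lborel2)
    \<le> (\<integral>\<^sup>+z. ennreal \<Lambda>2 * ((\<lambda>(x, y). ennreal (\<bar>u x - u y\<bar> powr p * near (x, y))) z + (\<lambda>(x, y). ennreal (\<bar>\<phi> x - \<phi> y\<bar> powr p * near (x, y))) z)
        + ennreal (\<Lambda>2 * B) * ennreal (ext z) \<partial>lborel2)"
  proof (rule nn_integral_mono_AE, use K_bounds in eventually_elim)
    fix z :: "'a \<times> 'a"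
    obtain x y where z: "z = (x, y)" by (cases z)
    assume "case z of (x, y) \<Rightarrow> \<Lambda>1 * ker x y \<le> K (x, y) \<and> K (x, y) \<le> \<Lambda>2 * ker x y"
    then have "\<bar>Jp p (u x - u y) * (\<phi> x - \<phi> y) * K (x, y)\<bar>
      \<le> \<Lambda>2 * (\<bar>u x - u y\<bar> powr (p - 1) * \<bar>\<phi> x - \<phi> y\<bar> * near (x, y)) + \<Lambda>2 * (\<bar>\<phi> x - \<phi> y\<bar> * ext (x, y))"
      unfolding z by (intro weak_integrand_le supp) auto
    also have "\<dots> \<le> \<Lambda>2 * ((\<bar>u x - u y\<bar> powr p + \<bar>\<phi> x - \<phi> y\<bar> powr p) * near (x, y)) + \<Lambda>2 * (B * ext (x, y))"
    proof -
      have *: "c powr (p - 1) * d \<le> c powr p + d powr p" if "0 \<le> c" "0 \<le> d" for c d :: real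
      proof -
        define m where "m = max c d"
        have "c powr (p - 1) * d \<le> m powr (p - 1) * m"
          using that p unfolding m_def by (intro mult_mono powr_mono2) auto
        also have "\<dots> = m powr p" using that by (cases "m = 0") (auto simp: powr_diff m_def)
        also have "\<dots> \<le> c powr p + d powr p" by (auto simp: m_def max_def)
        finally show ?thesis .
      qed
      have "\<bar>\<phi> x - \<phi> y\<bar> \<le> B" using B[of x] B[of y] by auto
      then show ?thesis
        using \<Lambda> near_nonneg ext_nonneg by (intro add_mono mult_left_mono mult_right_mono *) auto
    qed
    finally have "\<bar>Jp p (u x - u y) * (\<phi> x - \<phi> y) * K (x, y)\<bar>
      \<le> \<Lambda>2 * (\<bar>u x - u y\<bar> powr p * near (x, y) + \<bar>\<phi> x - \<phi> y\<bar> powr p * near (x, y)) + \<Lambda>2 * B * ext (x, y)"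
      by (simp add: distrib_right)
    then show "ennreal (norm ((weak_integrand \<phi>) z))
      \<le> ennreal \<Lambda>2 * ((\<lambda>(x, y). ennreal (\<bar>u x - u y\<bar> powr p * near (x, y))) z + (\<lambda>(x, y). ennreal (\<bar>\<phi> x - \<phi> y\<bar> powr p * near (x, y))) z)
        + ennreal (\<Lambda>2 * B) * ennreal (ext z)"
      using \<Lambda> B0 near_nonneg ext_nonneg unfolding z
      by (simp add: ennreal_mult'[symmetric] ennreal_plus[symmetric] ennreal_leI del: ennreal_plus)
  qed
  also have "\<dots> = ennreal \<Lambda>2 * ((\<integral>\<^sup>+(x, y). ennreal (\<bar>u x - u y\<bar> powr p * near (x, y)) \<partial>lborel2) + (\<integral>\<^sup>+(x, y). ennreal (\<bar>\<phi> x - \<phi> y\<bar> powr p * near (x, y)) \<partial>lborel2))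
      + ennreal (\<Lambda>2 * B) * (\<integral>\<^sup>+z. ennreal (ext z) \<partial>lborel2)"
    by (simp add: nn_integral_add nn_integral_cmult)
  also have "\<dots> < \<infinity>"
    using near_energy_finite ext_finite le_less_trans[OF near_test_energy E] by (auto simp: ennreal_mult_less_top)
  finally show ?thesis by (intro integrableI_bounded) measurable
qed

text \<open>Mollifications of \<open>\<phi>\<close> are admissible.  Their differences from \<open>\<phi>\<close> are bounded in energy and tend to \<open>0\<close>
  almost everywhere, hence the near part converges by \<open>nn_integral_weak_limit\<close>, while the exterior part
  converges dominatedly because the mollifications are uniformly bounded.\<close>

lemma weak_testfun:
  assumes \<phi>: "\<phi> \<in> borel_measurable borel" and B: "\<And>x. 0 \<le> \<phi> x" "\<And>x. \<phi> x \<le> B"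
    and supp: "\<And>x. x \<notin> ball x0 (r / 2) \<Longrightarrow> \<phi> x = 0" and E: "gagliardo_energy q p \<phi> < \<infinity>"
  shows "integrable lborel2 (weak_integrand \<phi>)" (is "integrable _ (?G \<phi>)")
    and "(\<integral>z. (weak_integrand \<phi>) z \<partial>lborel2) \<le> 0"
proof -
  note [measurable] = \<phi>
  let ?G = weak_integrand
  have B0: "0 \<le> B" using B[of x0] by linarith
  have t\<phi>: "testfun B \<phi>" unfolding testfun_def using B supp E r by auto
  then show int: "integrable lborel2 (?G \<phi>)" by (rule weak_integrable)
  have r4: "0 < r / 4" using r by simp
  obtain f :: "nat \<Rightarrow> 'a \<Rightarrow> real" where f: 
    "\<And>n. \<exists>D. (\<forall>x. (f n has_derivative blinfun_apply (D x)) (at x)) \<and> continuous_on UNIV D"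
    "\<And>n. f n \<in> borel_measurable borel" "\<And>n x. 0 \<le> f n x" "\<And>n x. f n x \<le> B"
    "\<And>n x. x \<notin> ball x0 (r / 2 + r / 4) \<Longrightarrow> f n x = 0"
    "\<And>n. gagliardo_energy q p (f n) \<le> gagliardo_energy q p \<phi>"
    "AE x in lborel. (\<lambda>n. f n x) \<longlonglongrightarrow> \<phi> x"
    using mollified_sequence[OF \<phi> B supp p ps r4] E unfolding q_def by blast
  note [measurable] = f(2)
  have r34: "r / 2 + r / 4 = 3 * r / 4" by simp
  note fs = f(5)[unfolded r34]
  have tf: "testfun B (f n)" for n
    unfolding testfun_def using f(2,3,4) fs le_less_trans[OF f(6) E] by auto
  have C1: "f n \<in> C1c \<Omega>" for n
  proof -
    have "closure (support_on UNIV (f n)) \<subseteq> cball x0 (3 * r / 4)"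
    proof (rule closure_minimal)
      show "support_on UNIV (f n) \<subseteq> cball x0 (3 * r / 4)"
        using fs[of _ n] by (force simp: support_on_def)
    qed simp
    moreover have "cball x0 (3 * r / 4) \<subseteq> \<Omega>" using ball r by (auto simp: subset_iff)
    moreover from calculation(1) have "compact (closure (support_on UNIV (f n)))"
      by (meson bounded_cball bounded_subset closed_closure compact_eq_bounded_closed)
    ultimately show ?thesis using f(1)[of n] by (auto simp: C1c_def compactly_in_def)
  qed
  have "(\<lambda>n. \<integral>z. ?G (f n) z \<partial>lborel2) \<longlonglongrightarrow> (\<integral>z. ?G \<phi> z \<partial>lborel2)"
  proof (rule tendsto_L1_int)
    show "integrable lborel2 (?G (f n))" for n using tf by (rule weak_integrable)
    show "integrable lborel2 (?G \<phi>)" by (rule int)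
    define d where "d n = (\<lambda>(x, y). \<bar>(f n x - \<phi> x) - (f n y - \<phi> y)\<bar>)" for n
    have [measurable]: "d n \<in> borel_measurable lborel2" for n unfolding d_def by measurable
    define a where "a = (\<lambda>(x, y). \<bar>u x - u y\<bar>)"
    have [measurable]: "a \<in> borel_measurable lborel2" unfolding a_def by measurable
    have d0: "AE z in lborel2. (\<lambda>n. d n z) \<longlonglongrightarrow> 0"
    proof -
      have "AE z in lborel2. (\<lambda>n. f n (fst z)) \<longlonglongrightarrow> \<phi> (fst z)" "AE z in lborel2. (\<lambda>n. f n (snd z)) \<longlonglongrightarrow> \<phi> (snd z)"
        using AE_lborel2_coordinate[OF f(7)] by auto
      then show ?thesis
      proof eventually_elim
        case (elim z)
        then have "(\<lambda>n. \<bar>(f n (fst z) - \<phi> (fst z)) - (f n (snd z) - \<phi> (snd z))\<bar>)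
           \<longlonglongrightarrow> \<bar>(\<phi> (fst z) - \<phi> (fst z)) - (\<phi> (snd z) - \<phi> (snd z))\<bar>"
          by (intro tendsto_intros)
        then show ?case by (simp add: d_def split_beta)
      qed
    qed
    have L1: "(\<lambda>n. \<integral>\<^sup>+z. ennreal (a z powr (p - 1) * d n z * near z) \<partial>lborel2) \<longlonglongrightarrow> 0"
    proof (rule nn_integral_weak_limit[where E = "ennreal (2 powr p) * (gagliardo_energy q p \<phi> + gagliardo_energy q p \<phi>)"])
      show "(\<integral>\<^sup>+z. ennreal (a z powr p * near z) \<partial>lborel2) < \<infinity>"
        using near_energy_finite by (simp add: a_def case_prod_beta')
      show "ennreal (2 powr p) * (gagliardo_energy q p \<phi> + gagliardo_energy q p \<phi>) < \<infinity>"
        using E by (simp add: ennreal_mult_less_top)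
      fix n
      have "(\<integral>\<^sup>+z. ennreal (d n z powr p * near z) \<partial>lborel2) \<le>
         (\<integral>\<^sup>+z. ennreal (2 powr p) * ((\<lambda>(x, y). ennreal (\<bar>f n x - f n y\<bar> powr p * near (x, y))) z + (\<lambda>(x, y). ennreal (\<bar>\<phi> x - \<phi> y\<bar> powr p * near (x, y))) z) \<partial>lborel2)"
      proof (rule nn_integral_mono)
        fix z :: "'a \<times> 'a"
        obtain x y where z: "z = (x, y)" by (cases z)
        have "d n z powr p \<le> (\<bar>f n x - f n y\<bar> + \<bar>\<phi> x - \<phi> y\<bar>) powr p"
          unfolding d_def z using p by (intro powr_mono2) auto
        also have "\<dots> \<le> 2 powr p * (\<bar>f n x - f n y\<bar> powr p + \<bar>\<phi> x - \<phi> y\<bar> powr p)"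
          using p by (intro powr_add_le) auto
        finally have "d n z powr p * near z \<le> 2 powr p * (\<bar>f n x - f n y\<bar> powr p + \<bar>\<phi> x - \<phi> y\<bar> powr p) * near z"
          using near_nonneg by (rule mult_right_mono)
        also have "\<dots> = 2 powr p * (\<bar>f n x - f n y\<bar> powr p * near z + \<bar>\<phi> x - \<phi> y\<bar> powr p * near z)"
          by (simp add: algebra_simps)
        finally show "ennreal (d n z powr p * near z) \<le> ennreal (2 powr p) * ((\<lambda>(x, y). ennreal (\<bar>f n x - f n y\<bar> powr p * near (x, y))) z + (\<lambda>(x, y). ennreal (\<bar>\<phi> x - \<phi> y\<bar> powr p * near (x, y))) z)"
          using near_nonneg unfolding z
          by (simp add: ennreal_mult'[symmetric] ennreal_plus[symmetric] ennreal_leI del: ennreal_plus)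
      qed
      also have "\<dots> = ennreal (2 powr p) * ((\<integral>\<^sup>+(x, y). ennreal (\<bar>f n x - f n y\<bar> powr p * near (x, y)) \<partial>lborel2) + (\<integral>\<^sup>+(x, y). ennreal (\<bar>\<phi> x - \<phi> y\<bar> powr p * near (x, y)) \<partial>lborel2))"
        by (simp add: nn_integral_add nn_integral_cmult)
      also have "\<dots> \<le> ennreal (2 powr p) * (gagliardo_energy q p \<phi> + gagliardo_energy q p \<phi>)"
        by (intro mult_left_mono add_mono near_test_energy order_trans[OF near_test_energy f(6)]) auto
      finally show "(\<integral>\<^sup>+z. ennreal (d n z powr p * near z) \<partial>lborel2) \<le> ennreal (2 powr p) * (gagliardo_energy q p \<phi> + gagliardo_energy q p \<phi>)" .
    qed (use p d0 near_nonneg in \<open>auto simp: a_def d_def split_beta\<close>)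
    have L2: "(\<lambda>n. \<integral>\<^sup>+z. ennreal (d n z * ext z) \<partial>lborel2) \<longlonglongrightarrow> (\<integral>\<^sup>+z. 0 \<partial>(lborel2 :: ('a \<times> 'a) measure))"
    proof (rule nn_integral_dominated_convergence[where w = "\<lambda>z. ennreal (2 * B) * ennreal (ext z)"])
      show "AE z in lborel2. ennreal (d n z * ext z) \<le> ennreal (2 * B) * ennreal (ext z)" for n
      proof (rule AE_I2)
        fix z :: "'a \<times> 'a"
        have "d n z \<le> 2 * B"
          using f(3,4)[of n "fst z"] f(3,4)[of n "snd z"] B[of "fst z"] B[of "snd z"] by (simp add: d_def split_beta)
        then have "d n z * ext z \<le> 2 * B * ext z" using ext_nonneg by (rule mult_right_mono)
        then show "ennreal (d n z * ext z) \<le> ennreal (2 * B) * ennreal (ext z)"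
          using B0 by (simp add: ennreal_mult'[symmetric] ennreal_leI)
      qed
      show "(\<integral>\<^sup>+z. ennreal (2 * B) * ennreal (ext z) \<partial>lborel2) < \<infinity>"
        using ext_finite by (simp add: nn_integral_cmult ennreal_mult_less_top)
      show "AE z in lborel2. (\<lambda>n. ennreal (d n z * ext z)) \<longlonglongrightarrow> 0"
        using d0
      proof eventually_elim
        case (elim z)
        then have "(\<lambda>n. ennreal (d n z * ext z)) \<longlonglongrightarrow> ennreal (0 * ext z)" by (intro tendsto_intros)
        then show ?case by simp
      qed
    qed measurable
    have bound: "(\<integral>\<^sup>+z. ennreal (norm (?G (f n) z - ?G \<phi> z)) \<partial>lborel2)
      \<le> ennreal \<Lambda>2 * (\<integral>\<^sup>+z. ennreal (a z powr (p - 1) * d n z * near z) \<partial>lborel2) + ennreal \<Lambda>2 * (\<integral>\<^sup>+z. ennreal (d n z * ext z) \<partial>lborel2)" for n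
    proof -
      have "(\<integral>\<^sup>+z. ennreal (norm (?G (f n) z - ?G \<phi> z)) \<partial>lborel2)
        \<le> (\<integral>\<^sup>+z. ennreal \<Lambda>2 * ennreal (a z powr (p - 1) * d n z * near z) + ennreal \<Lambda>2 * ennreal (d n z * ext z) \<partial>lborel2)"
      proof (rule nn_integral_mono_AE, use K_bounds in eventually_elim)
        fix z :: "'a \<times> 'a"
        obtain x y where z: "z = (x, y)" by (cases z)
        assume K: "case z of (x, y) \<Rightarrow> \<Lambda>1 * ker x y \<le> K (x, y) \<and> K (x, y) \<le> \<Lambda>2 * ker x y"
        have "norm (?G (f n) z - ?G \<phi> z) = \<bar>Jp p (u x - u y) * ((f n x - \<phi> x) - (f n y - \<phi> y)) * K (x, y)\<bar>"
          unfolding z by (simp add: algebra_simps)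
        also have "\<dots> \<le> \<Lambda>2 * (\<bar>u x - u y\<bar> powr (p - 1) * \<bar>(f n x - \<phi> x) - (f n y - \<phi> y)\<bar> * near (x, y))
            + \<Lambda>2 * (\<bar>(f n x - \<phi> x) - (f n y - \<phi> y)\<bar> * ext (x, y))"
        proof (rule weak_integrand_le[where \<phi> = "\<lambda>x. f n x - \<phi> x"])
          fix x assume "x \<notin> ball x0 (3 * r / 4)"
          then show "f n x - \<phi> x = 0" using fs[of x n] supp[of x] r by auto
        qed (use K z in auto)
        finally have "norm (?G (f n) z - ?G \<phi> z) \<le> \<Lambda>2 * (a z powr (p - 1) * d n z * near z) + \<Lambda>2 * (d n z * ext z)"
          by (simp add: z a_def d_def)
        moreover have "0 \<le> d n z" by (simp add: z d_def)
        ultimately show "ennreal (norm (?G (f n) z - ?G \<phi> z)) \<le> ennreal \<Lambda>2 * ennreal (a z powr (p - 1) * d n z * near z) + ennreal \<Lambda>2 * ennreal (d n z * ext z)"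
          using \<Lambda> near_nonneg ext_nonneg
          by (simp add: ennreal_mult'[symmetric] ennreal_plus[symmetric] ennreal_leI del: ennreal_plus)
      qed
      also have "\<dots> = ennreal \<Lambda>2 * (\<integral>\<^sup>+z. ennreal (a z powr (p - 1) * d n z * near z) \<partial>lborel2) + ennreal \<Lambda>2 * (\<integral>\<^sup>+z. ennreal (d n z * ext z) \<partial>lborel2)"
        by (simp add: nn_integral_add nn_integral_cmult)
      finally show ?thesis .
    qed
    have L2': "(\<lambda>n. \<integral>\<^sup>+z. ennreal (d n z * ext z) \<partial>lborel2) \<longlonglongrightarrow> 0" using L2 by simp
    have L: "(\<lambda>n. ennreal \<Lambda>2 * (\<integral>\<^sup>+z. ennreal (a z powr (p - 1) * d n z * near z) \<partial>lborel2)
      + ennreal \<Lambda>2 * (\<integral>\<^sup>+z. ennreal (d n z * ext z) \<partial>lborel2)) \<longlonglongrightarrow> 0"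
      using tendsto_add[OF ennreal_tendsto_cmult[OF _ L1] ennreal_tendsto_cmult[OF _ L2'], of "ennreal \<Lambda>2" "ennreal \<Lambda>2"]
      by simp
    show "(\<lambda>n. \<integral>\<^sup>+z. ennreal (norm (?G (f n) z - ?G \<phi> z)) \<partial>lborel2) \<longlonglongrightarrow> 0"
      by (rule tendsto_sandwich[OF _ _ tendsto_const L]) (rule always_eventually, rule allI, (rule zero_le | rule bound))+
  qed
  moreover have "(\<integral>z. ?G (f n) z \<partial>lborel2) \<le> 0" for n
    using weak[OF C1 f(3)] by simp
  ultimately show "(\<integral>z. ?G \<phi> z \<partial>lborel2) \<le> 0"
    by (intro LIMSEQ_le_const2) auto
qed

end

section \<open>The truncation estimate\<close>

text \<open>Turns a pointwise lower bound of an integrand whose integral is known to be nonpositive into an inequality between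
  nonnegative integrals; the right side may be infinite.\<close>

lemma nn_integral_le_of_integral_nonpos:
  fixes f :: "'b \<Rightarrow> real"
  assumes f: "integrable M f" "(\<integral>z. f z \<partial>M) \<le> 0"
    and [measurable]: "good \<in> borel_measurable M" "bad \<in> borel_measurable M"
    and le: "AE z in M. good z \<le> f z + bad z" and nonneg: "\<And>z. 0 \<le> good z" "\<And>z. 0 \<le> bad z"
  shows "(\<integral>\<^sup>+z. ennreal (good z) \<partial>M) \<le> (\<integral>\<^sup>+z. ennreal (bad z) \<partial>M)"
proof (cases "(\<integral>\<^sup>+z. ennreal (bad z) \<partial>M) = \<infinity>")
  case False
  then have bad: "integrable M bad"
    using nonneg by (intro integrableI_nonneg) (auto simp: less_top[symmetric])
  have good: "integrable M good"
  proof (rule Bochner_Integration.integrable_bound[of M "\<lambda>z. f z + bad z"])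
    show "AE z in M. norm (good z) \<le> norm (f z + bad z)"
      using le by eventually_elim (use nonneg in \<open>smt (verit) real_norm_def\<close>)
  qed (use f bad in auto)
  have "(\<integral>z. good z \<partial>M) \<le> (\<integral>z. f z + bad z \<partial>M)"
    using f bad good le by (intro integral_mono_AE) auto
  also have "\<dots> \<le> (\<integral>z. bad z \<partial>M)"
    using f bad by simp
  finally show ?thesis
    using good bad nonneg by (simp add: nn_integral_eq_integral ennreal_leI)
qed simp

lemma emeasure_subset_ball_finite:
  assumes "S \<subseteq> ball (x::'a::euclidean_space) r"
  shows "emeasure lborel S < \<infinity>"
  using le_less_trans[OF emeasure_mono[OF assms] emeasure_lborel_ball_finite] by simp

lemma nn_integral_add4:
  assumes [measurable]: "a \<in> borel_measurable M" "b \<in> borel_measurable M" "c \<in> borel_measurable M" "d \<in> borel_measurable M"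
  shows "(\<integral>\<^sup>+z. a z + b z + c z + d z \<partial>M) = (\<integral>\<^sup>+z. a z \<partial>M) + (\<integral>\<^sup>+z. b z \<partial>M) + (\<integral>\<^sup>+z. c z \<partial>M) + (\<integral>\<^sup>+z. d z \<partial>M)"
  by (simp add: nn_integral_add)

text \<open>The four cases are the positions of the two points above or below the barrier.  Only the mixed position with the
  first point above is kept on the left side.\<close>

lemma weak_integrand_lower_interior:
  fixes ux uy gx gy K k \<Lambda>1 \<Lambda>2 p :: real
  assumes p: "1 < p" and K: "\<Lambda>1 * k \<le> K" "K \<le> \<Lambda>2 * k" and \<Lambda>: "0 < \<Lambda>1" and k: "0 \<le> k"
  defines "wx \<equiv> max 0 (ux - gx)" and "wy \<equiv> max 0 (uy - gy)" and "my \<equiv> max 0 (gy - uy)"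
  shows "\<Lambda>1 * (1/2) powr (p - 1) * (wx * my powr (p - 1) * k)
    \<le> Jp p (ux - uy) * (wx - wy) * K + (if 0 < wx \<or> 0 < wy then \<Lambda>2 * (3 powr p + 2) * (\<bar>gx - gy\<bar> powr p * k) else 0)"
proof -
  have K0: "0 \<le> K" using K(1) \<Lambda> k by (smt (verit) mult_nonneg_nonneg)
  let ?c = "3 powr p + 2" and ?b = "\<bar>gx - gy\<bar> powr p"
  have b0: "0 \<le> ?c * ?b" by simp
  have cK: "?c * ?b * K \<le> \<Lambda>2 * ?c * (?b * k)"
    using mult_left_mono[OF K(2) b0] by (simp add: mult_ac)
  show ?thesis
  proof (cases "0 < wx"; cases "0 < wy")
    assume h: "0 < wx" "0 < wy"
    then have "my = 0" "ux - uy = (wx - wy) + (gx - gy)" by (auto simp: wx_def wy_def my_def)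
    moreover have "- (?c * ?b) * K \<le> Jp p ((wx - wy) + (gx - gy)) * (wx - wy) * K"
      using Jp_lower[OF p] K0 by (intro mult_right_mono) auto
    ultimately show ?thesis using h cK p by simp
  next
    assume h: "0 < wx" "\<not> 0 < wy"
    then have e: "wy = 0" "ux - uy = wx + my + (gx - gy)" by (auto simp: wx_def wy_def my_def)
    define A where "A = (1/2) powr (p - 1) * (wx * my powr (p - 1))"
    have "(A - ?c * ?b) * K \<le> Jp p (wx + my + (gx - gy)) * wx * K"
      using h K0 unfolding A_def by (intro mult_right_mono Jp_lower_pos[OF p]) (auto simp: my_def)
    moreover have "A * (\<Lambda>1 * k) \<le> A * K"
      using h unfolding A_def by (intro mult_left_mono K(1)) auto
    moreover have "(A - ?c * ?b) * K = A * K - ?c * ?b * K" by (rule left_diff_distrib)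
    ultimately have "A * (\<Lambda>1 * k) \<le> Jp p (ux - uy) * (wx - wy) * K + \<Lambda>2 * ?c * (?b * k)"
      using cK unfolding e by simp
    moreover have "\<Lambda>1 * (1/2) powr (p - 1) * (wx * my powr (p - 1) * k) = A * (\<Lambda>1 * k)"
      unfolding A_def by simp
    ultimately show ?thesis using h(1) by (simp only: simp_thms if_True)
  next
    assume h: "\<not> 0 < wx" "0 < wy"
    define mx where "mx = max 0 (gx - ux)"
    have e: "wx = 0" "uy - ux = wy + mx + (gy - gx)" using h by (auto simp: wx_def wy_def mx_def)
    have "((1/2) powr (p - 1) * (wy * mx powr (p - 1)) - ?c * \<bar>gy - gx\<bar> powr p) * K \<le> Jp p (wy + mx + (gy - gx)) * wy * K"
      using h K0 by (intro mult_right_mono Jp_lower_pos[OF p]) (auto simp: mx_def)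
    moreover have "0 \<le> (1/2) powr (p - 1) * (wy * mx powr (p - 1)) * K"
      using h K0 by simp
    moreover have "Jp p (ux - uy) = - Jp p (uy - ux)" using Jp_minus[of p "uy - ux"] by simp
    ultimately show ?thesis using h cK unfolding e by (simp add: algebra_simps abs_minus_commute)
  next
    assume h: "\<not> 0 < wx" "\<not> 0 < wy"
    then have "wx = 0" "wy = 0" by (auto simp: wx_def wy_def)
    then show ?thesis by simp
  qed
qed

text \<open>Against a point outside the ball only those values of \<open>u\<close> do harm that exceed the value at the inner point,
  which is above the level.\<close>

lemma weak_integrand_lower_exterior:
  fixes ux uy w K k kk \<Lambda>2 p :: real
  assumes p: "1 < p" and K: "0 \<le> K" "K \<le> \<Lambda>2 * k" and w: "0 \<le> w" and ux: "0 < w \<Longrightarrow> kk \<le> ux"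
  shows "- (\<Lambda>2 * (w * max 0 (uy - kk) powr (p - 1) * k)) \<le> Jp p (ux - uy) * w * K"
proof (cases "0 < w \<and> ux < uy")
  case True
  have "\<bar>Jp p (ux - uy)\<bar> \<le> max 0 (uy - kk) powr (p - 1)"
    unfolding abs_Jp using True ux p by (intro powr_mono2) auto
  then have "\<bar>Jp p (ux - uy)\<bar> * w * K \<le> max 0 (uy - kk) powr (p - 1) * w * (\<Lambda>2 * k)"
    using w K by (intro mult_mono) auto
  moreover have "- (\<bar>Jp p (ux - uy)\<bar> * w * K) \<le> Jp p (ux - uy) * w * K"
    using w K by (metis (no_types, lifting) abs_ge_minus_self abs_mult abs_of_nonneg minus_le_iff mult_nonneg_nonneg mult.assoc)
  ultimately show ?thesis by (simp add: mult_ac)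
next
  case False
  have "0 \<le> Jp p (ux - uy) * w * K"
  proof (cases "w = 0")
    case False
    with \<open>\<not> (0 < w \<and> ux < uy)\<close> w have "0 \<le> ux - uy" by auto
    then show ?thesis using w K by (simp add: Jp_nonneg)
  qed simp
  moreover have "0 \<le> w * max 0 (uy - kk) powr (p - 1) * (\<Lambda>2 * k)"
    by (rule mult_nonneg_nonneg) (use w K in auto)
  ultimately show ?thesis by (simp add: mult_ac)
qed

definition clamp :: "real \<Rightarrow> real" where "clamp t = max 0 (min 1 t)"

lemma clamp_lipschitz: "\<bar>clamp s - clamp t\<bar> \<le> \<bar>s - t\<bar>"
  by (auto simp: clamp_def max_def min_def)

lemma clamp_range: "0 \<le> clamp t" "clamp t \<le> 1"
  by (auto simp: clamp_def)

text \<open>A ball of radius \<open>r\<close> in which \<open>u \<le> k + \<tau>\<close>; the barrier rises from \<open>k\<close> to \<open>k + \<tau>\<close> between the radii \<open>\<rho>1\<close>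
  and \<open>\<rho>2\<close>.\<close>

locale barrier = subsolution_ball +
  fixes k \<tau> \<rho>1 \<rho>2 :: real
  assumes \<rho>: "0 \<le> \<rho>1" "\<rho>1 < \<rho>2" "\<rho>2 \<le> r / 2" and \<tau>: "0 < \<tau>"
    and u_le: "AE x in lborel. x \<in> ball x0 r \<longrightarrow> u x \<le> k + \<tau>"
begin

definition g :: "'a \<Rightarrow> real" where "g x = k + \<tau> * clamp ((norm (x - x0) - \<rho>1) / (\<rho>2 - \<rho>1))"

text \<open>In the ball this is \<open>(u - g)\<^sup>+\<close> up to a null set.  The truncations make it bounded and compactly supported at
  every point, as \<open>u \<le> k + \<tau>\<close> is known only almost everywhere.\<close>

definition w :: "'a \<Rightarrow> real" where "w x = (if x \<in> ball x0 \<rho>2 then min \<tau> (max 0 (u x - g x)) else 0)"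

definition m :: "'a \<Rightarrow> real" where "m x = max 0 (g x - u x)"

lemma g_ge: "k \<le> g x" and g_le: "g x \<le> k + \<tau>"
  using clamp_range[of "(norm (x - x0) - \<rho>1) / (\<rho>2 - \<rho>1)"] \<tau> by (auto simp: g_def mult_left_le)

lemma g_inner: "x \<in> ball x0 \<rho>1 \<Longrightarrow> g x = k"
  using \<rho> divide_nonpos_pos[of "norm (x - x0) - \<rho>1" "\<rho>2 - \<rho>1"]
  by (auto simp: g_def clamp_def dist_norm norm_minus_commute)

lemma g_outer: "x \<notin> ball x0 \<rho>2 \<Longrightarrow> g x = k + \<tau>"
  using \<rho> by (auto simp: g_def clamp_def dist_norm norm_minus_commute min_def)

lemma g_lipschitz: "\<bar>g x - g y\<bar> \<le> \<tau> / (\<rho>2 - \<rho>1) * norm (x - y)"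
proof -
  let ?t = "\<lambda>x. (norm (x - x0) - \<rho>1) / (\<rho>2 - \<rho>1)"
  have "\<bar>g x - g y\<bar> = \<tau> * \<bar>clamp (?t x) - clamp (?t y)\<bar>"
    using \<tau> by (simp add: g_def right_diff_distrib[symmetric] abs_mult)
  also have "\<dots> \<le> \<tau> * \<bar>?t x - ?t y\<bar>" using \<tau> by (intro mult_left_mono clamp_lipschitz) auto
  also have "?t x - ?t y = (norm (x - x0) - norm (y - x0)) / (\<rho>2 - \<rho>1)" by (simp add: diff_divide_distrib)
  also have "\<bar>\<dots>\<bar> \<le> norm (x - y) / (\<rho>2 - \<rho>1)"
    using \<rho> norm_triangle_ineq3[of "x - x0" "y - x0"] by (simp add: abs_divide divide_right_mono)
  finally show ?thesis using \<tau> by simp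
qed

lemma barrier_measurable [measurable]:
  "g \<in> borel_measurable borel" "w \<in> borel_measurable borel" "m \<in> borel_measurable borel"
proof -
  show [measurable]: "g \<in> borel_measurable borel" unfolding g_def clamp_def by measurable
  show "w \<in> borel_measurable borel" unfolding w_def by measurable
  show "m \<in> borel_measurable borel" unfolding m_def by measurable
qed

lemma w_range: "0 \<le> w x" "w x \<le> \<tau>" using \<tau> by (auto simp: w_def)

lemma w_pos: "0 < w x \<Longrightarrow> x \<in> ball x0 \<rho>2 \<and> k < u x"
  using g_ge[of x] by (auto simp: w_def min_def max_def split: if_splits)

lemma w_eq: "u x \<le> k + \<tau> \<Longrightarrow> w x = max 0 (u x - g x)"
  using g_ge[of x] g_outer[of x] \<tau> by (auto simp: w_def min_def max_def)

lemma ker_far_half: "x \<in> ball x0 (r / 2) \<Longrightarrow> y \<notin> ball x0 r \<Longrightarrow> ker x y \<le> 2 powr q * norm (y - x0) powr (- q)"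
proof -
  assume x: "x \<in> ball x0 (r / 2)" and y: "y \<notin> ball x0 r"
  have "norm (y - x0) / 2 \<le> norm (x - y)"
    using x y dist_triangle[of x0 y x] by (auto simp: dist_norm norm_minus_commute)
  moreover have "0 < norm (y - x0)" using y r by (auto simp: dist_norm norm_minus_commute)
  ultimately have "ker x y \<le> (norm (y - x0) / 2) powr (- q)"
    unfolding ker_def using q by (intro powr_mono2') auto
  also have "\<dots> = 2 powr q * norm (y - x0) powr (- q)"
    by (simp add: powr_divide powr_minus field_simps)
  finally show ?thesis .
qed

lemma barrier_local_energy:
  assumes x: "x \<in> ball x0 r"
  shows "(\<integral>\<^sup>+y. ennreal (\<bar>g x - g y\<bar> powr p * ker x y) * indicator (ball x0 r) y \<partial>lborel)
    \<le> ennreal ((\<tau> / (\<rho>2 - \<rho>1)) powr p * (kernel_const TYPE('a) (p - p * s) * (2 * r) powr (p - p * s)))"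
proof -
  let ?L = "\<tau> / (\<rho>2 - \<rho>1)"
  have L: "0 < ?L" using \<tau> \<rho> by simp
  have pps: "0 < p - p * s" using p s by simp
  have "(\<integral>\<^sup>+y. ennreal (\<bar>g x - g y\<bar> powr p * ker x y) * indicator (ball x0 r) y \<partial>lborel)
    \<le> (\<integral>\<^sup>+y. ennreal (?L powr p) * (ennreal (norm (y - x) powr ((p - p * s) - real DIM('a))) * indicator (ball x (2 * r)) y) \<partial>lborel)"
  proof (rule nn_integral_mono)
    fix y
    show "ennreal (\<bar>g x - g y\<bar> powr p * ker x y) * indicator (ball x0 r) y
      \<le> ennreal (?L powr p) * (ennreal (norm (y - x) powr ((p - p * s) - real DIM('a))) * indicator (ball x (2 * r)) y)"
    proof (cases "y \<in> ball x0 r")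
      case True
      then have y: "y \<in> ball x (2 * r)" using x dist_triangle[of x y x0] by (simp add: dist_commute)
      have "\<bar>g x - g y\<bar> powr p \<le> (?L * norm (x - y)) powr p"
        using p by (intro powr_mono2 g_lipschitz) auto
      then have "\<bar>g x - g y\<bar> powr p * ker x y \<le> (?L * norm (x - y)) powr p * ker x y"
        by (intro mult_right_mono ker_nonneg)
      also have "\<dots> = ?L powr p * (norm (x - y) powr p * norm (x - y) powr (- q))"
        by (simp only: ker_def powr_mult mult.assoc)
      also have "norm (x - y) powr p * norm (x - y) powr (- q) = norm (y - x) powr ((p - p * s) - real DIM('a))"
        proof -
          have "p + - q = (p - p * s) - real DIM('a)" by (simp add: q_def)
          then show ?thesis by (simp only: powr_add[symmetric] norm_minus_commute[of x y])
        qed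
      finally show ?thesis using True y by (simp add: ennreal_mult'[symmetric] ennreal_leI)
    qed simp
  qed
  also have "\<dots> = ennreal (?L powr p) * (\<integral>\<^sup>+y. ennreal (norm (y - x) powr ((p - p * s) - real DIM('a))) * indicator (ball x (2 * r)) y \<partial>lborel)"
    by (rule nn_integral_cmult) measurable
  also have "\<dots> \<le> ennreal (?L powr p) * ennreal (kernel_const TYPE('a) (p - p * s) * (2 * r) powr (p - p * s))"
    using r pps by (intro mult_left_mono kernel_near_integral) auto
  finally show ?thesis by (simp add: ennreal_mult'[symmetric])
qed

text \<open>In the ball the differences of \<open>w\<close> are at most those of \<open>u\<close> plus those of the barrier, and outside the ball of
  radius \<open>r / 2\<close> the function vanishes, so that the remaining interactions are at distance at least \<open>r / 2\<close>.\<close>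

lemma w_energy_finite: "gagliardo_energy q p w < \<infinity>"
proof -
  let ?V = "ball x0 r"
  define C1 where "C1 = (\<tau> / (\<rho>2 - \<rho>1)) powr p * (kernel_const TYPE('a) (p - p * s) * (2 * r) powr (p - p * s))"
  define C2 where "C2 = kernel_const TYPE('a) (p * s) * (r / 2) powr (- (p * s))"
  define FA where "FA x y = ennreal (2 powr p) * (ennreal (\<bar>u x - u y\<bar> powr p * ker x y) * indicator ?V x * indicator ?V y)" for x y
  define FB where "FB x y = ennreal (2 powr p) * (ennreal (\<bar>g x - g y\<bar> powr p * ker x y) * indicator ?V y) * indicator ?V x" for x y
  define FC where "FC x y = ennreal (\<tau> powr p) * (ennreal (norm (y - x) powr (- (real DIM('a) + p * s))) * indicator (- ball x (r / 2)) y) * indicator ?V x" for x y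
  have FAm[measurable]: "(\<lambda>z. FA (fst z) (snd z)) \<in> borel_measurable lborel2"
    unfolding FA_def by measurable
  have FBm[measurable]: "(\<lambda>z. FB (fst z) (snd z)) \<in> borel_measurable lborel2"
    unfolding FB_def by measurable
  have FC_alt: "FC x y = (if x \<in> ?V \<and> r / 2 \<le> dist x y
      then ennreal (\<tau> powr p) * ennreal (norm (y - x) powr (- (real DIM('a) + p * s))) else 0)" for x y
    by (auto simp: FC_def indicator_def)
  have FCm[measurable]: "(\<lambda>z. FC (fst z) (snd z)) \<in> borel_measurable lborel2"
    unfolding FC_alt by measurable
  have FCm'[measurable]: "(\<lambda>z. FC (snd z) (fst z)) \<in> borel_measurable lborel2"
    unfolding FC_alt by measurable
  have "gagliardo_energy q p w \<le> (\<integral>\<^sup>+z. FA (fst z) (snd z) + FB (fst z) (snd z) + FC (fst z) (snd z) + FC (snd z) (fst z) \<partial>lborel2)"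
  proof -
    have "gagliardo_energy q p w = (\<integral>\<^sup>+z. ennreal (\<bar>w (fst z) - w (snd z)\<bar> powr p * ker (fst z) (snd z)) \<partial>lborel2)"
      unfolding gagliardo_energy_def ker_def by (subst nn_integral_lborel2) measurable
    also have "\<dots> \<le> (\<integral>\<^sup>+z. FA (fst z) (snd z) + FB (fst z) (snd z) + FC (fst z) (snd z) + FC (snd z) (fst z) \<partial>lborel2)"
    proof (rule nn_integral_mono_AE, use AE_lborel2_coordinate[OF u_le] in eventually_elim)
      fix z :: "'a \<times> 'a"
      obtain x y where z: "z = (x, y)" by (cases z)
      assume ae: "fst z \<in> ?V \<longrightarrow> u (fst z) \<le> k + \<tau>" "snd z \<in> ?V \<longrightarrow> u (snd z) \<le> k + \<tau>"
      have far: "ennreal (\<bar>w x - w y\<bar> powr p * ker x y) \<le> FC x y" if x: "x \<in> ball x0 \<rho>2" and y: "y \<notin> ?V" for x y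
      proof -
        have xr: "x \<in> ball x0 (r / 2)" "x \<in> ?V" using x \<rho> r by auto
        have "y \<notin> ball x (r / 2)" using xr(1) y dist_triangle[of x0 y x] by (auto simp: dist_commute)
        moreover have "\<bar>w x - w y\<bar> powr p \<le> \<tau> powr p"
          using w_range[of x] w_range[of y] p by (intro powr_mono2) auto
        ultimately show ?thesis using xr
          by (simp add: FC_def ker_def q_def norm_minus_commute ennreal_mult'[symmetric] mult_right_mono ennreal_leI)
      qed
      have near: "ennreal (\<bar>w x - w y\<bar> powr p * ker x y) \<le> FA x y + FB x y" if x: "x \<in> ?V" and y: "y \<in> ?V"
      proof -
        have "w x = max 0 (u x - g x)" "w y = max 0 (u y - g y)" using ae x y z by (auto intro: w_eq)
        then have "\<bar>w x - w y\<bar> \<le> \<bar>u x - u y\<bar> + \<bar>g x - g y\<bar>" by (auto simp: max_def)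
        then have "\<bar>w x - w y\<bar> powr p \<le> (\<bar>u x - u y\<bar> + \<bar>g x - g y\<bar>) powr p"
          using p by (intro powr_mono2) auto
        also have "\<dots> \<le> 2 powr p * (\<bar>u x - u y\<bar> powr p + \<bar>g x - g y\<bar> powr p)"
          using p by (intro powr_add_le) auto
        finally have "\<bar>w x - w y\<bar> powr p * ker x y \<le> 2 powr p * (\<bar>u x - u y\<bar> powr p + \<bar>g x - g y\<bar> powr p) * ker x y"
          by (intro mult_right_mono ker_nonneg)
        also have "\<dots> = 2 powr p * (\<bar>u x - u y\<bar> powr p * ker x y) + 2 powr p * (\<bar>g x - g y\<bar> powr p * ker x y)"
          by (simp add: algebra_simps)
        finally show ?thesis using x y ker_nonneg
          by (simp add: FA_def FB_def ennreal_mult'[symmetric] ennreal_plus[symmetric] ennreal_leI del: ennreal_plus)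
      qed
      have "ennreal (\<bar>w x - w y\<bar> powr p * ker x y) \<le> FA x y + FB x y + FC x y + FC y x"
      proof (cases "x \<in> ?V \<and> y \<in> ?V")
        case True
        then show ?thesis by (intro add_increasing2[OF zero_le add_increasing2[OF zero_le near]]) auto
      next
        case False
        consider "w x = 0" "w y = 0" | "x \<in> ball x0 \<rho>2" "y \<notin> ?V" | "y \<in> ball x0 \<rho>2" "x \<notin> ?V"
          using False w_pos[of x] w_pos[of y] w_range[of x] w_range[of y] \<rho> r by force
        then show ?thesis
        proof cases
          case 1 then show ?thesis using p by simp
        next
          case 2
          show ?thesis by (rule add_increasing2[OF zero_le add_increasing[OF zero_le far[OF 2]]])
        next
          case 3
          have "ker y x = ker x y" by (simp add: ker_def norm_minus_commute)
          with far[OF 3] have "ennreal (\<bar>w x - w y\<bar> powr p * ker x y) \<le> FC y x"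
            by (simp add: abs_minus_commute)
          then show ?thesis by (rule add_increasing[OF zero_le])
        qed
      qed
      then show "ennreal (\<bar>w (fst z) - w (snd z)\<bar> powr p * ker (fst z) (snd z)) \<le> FA (fst z) (snd z) + FB (fst z) (snd z) + FC (fst z) (snd z) + FC (snd z) (fst z)"
        by (simp add: z)
    qed
    finally show ?thesis .
  qed
  also have "\<dots> = (\<integral>\<^sup>+z. FA (fst z) (snd z) \<partial>lborel2) + (\<integral>\<^sup>+z. FB (fst z) (snd z) \<partial>lborel2) + (\<integral>\<^sup>+z. FC (fst z) (snd z) \<partial>lborel2) + (\<integral>\<^sup>+z. FC (snd z) (fst z) \<partial>lborel2)"
    by (rule nn_integral_add4[OF FAm FBm FCm FCm'])
  also have "\<dots> < \<infinity>"
  proof -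
    have A: "(\<integral>\<^sup>+z. FA (fst z) (snd z) \<partial>lborel2) < \<infinity>"
    proof -
      have "(\<integral>\<^sup>+z. FA (fst z) (snd z) \<partial>lborel2) = (\<integral>\<^sup>+z. ennreal (2 powr p) * (ennreal (\<bar>u (fst z) - u (snd z)\<bar> powr p * near z)) \<partial>lborel2)"
        by (intro nn_integral_cong) (auto simp: FA_def near_def split_beta indicator_def)
      also have "\<dots> = ennreal (2 powr p) * (\<integral>\<^sup>+(x, y). ennreal (\<bar>u x - u y\<bar> powr p * near (x, y)) \<partial>lborel2)"
        unfolding case_prod_beta' prod.collapse by (rule nn_integral_cmult) measurable
      finally show ?thesis using near_energy_finite by (simp add: ennreal_mult_less_top)
    qed
    have V: "emeasure lborel ?V < \<infinity>" using emeasure_lborel_ball_finite by simp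
    have B: "(\<integral>\<^sup>+z. FB (fst z) (snd z) \<partial>lborel2) < \<infinity>"
    proof -
      have "(\<integral>\<^sup>+z. FB (fst z) (snd z) \<partial>lborel2) = (\<integral>\<^sup>+x. \<integral>\<^sup>+y. FB x y \<partial>lborel \<partial>lborel)"
        using nn_integral_lborel2[OF FBm] by simp
      also have "\<dots> \<le> (\<integral>\<^sup>+x. ennreal (2 powr p) * ennreal C1 * indicator ?V x \<partial>lborel)"
      proof (rule nn_integral_mono)
        fix x
        have "(\<integral>\<^sup>+y. FB x y \<partial>lborel) = ennreal (2 powr p) * (\<integral>\<^sup>+y. ennreal (\<bar>g x - g y\<bar> powr p * ker x y) * indicator ?V y \<partial>lborel) * indicator ?V x"
          by (simp add: FB_def nn_integral_cmult nn_integral_multc)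
        also have "\<dots> \<le> ennreal (2 powr p) * ennreal C1 * indicator ?V x"
        proof (cases "x \<in> ?V")
          case True
          then show ?thesis using barrier_local_energy[OF True] unfolding C1_def by (simp add: mult_left_mono)
        qed simp
        finally show "(\<integral>\<^sup>+y. FB x y \<partial>lborel) \<le> ennreal (2 powr p) * ennreal C1 * indicator ?V x" .
      qed
      also have "\<dots> < \<infinity>" using V by (simp add: nn_integral_cmult_indicator ennreal_mult_less_top)
      finally show ?thesis .
    qed
    have F: "(\<integral>\<^sup>+x. \<integral>\<^sup>+y. FC x y \<partial>lborel \<partial>lborel) < \<infinity>"
    proof -
      have "(\<integral>\<^sup>+x. \<integral>\<^sup>+y. FC x y \<partial>lborel \<partial>lborel) \<le> (\<integral>\<^sup>+x. ennreal (\<tau> powr p) * ennreal C2 * indicator ?V x \<partial>lborel)"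
      proof (rule nn_integral_mono)
        fix x
        have "(\<integral>\<^sup>+y. FC x y \<partial>lborel) = ennreal (\<tau> powr p) * (\<integral>\<^sup>+y. ennreal (norm (y - x) powr (- (real DIM('a) + p * s))) * indicator (- ball x (r / 2)) y \<partial>lborel) * indicator ?V x"
          by (simp add: FC_def nn_integral_cmult nn_integral_multc)
        also have "\<dots> \<le> ennreal (\<tau> powr p) * ennreal C2 * indicator ?V x"
          using r unfolding C2_def by (intro mult_right_mono mult_left_mono kernel_far_integral ps) auto
        finally show "(\<integral>\<^sup>+y. FC x y \<partial>lborel) \<le> ennreal (\<tau> powr p) * ennreal C2 * indicator ?V x" .
      qed
      also have "\<dots> < \<infinity>" using V by (simp add: nn_integral_cmult_indicator ennreal_mult_less_top)
      finally show ?thesis .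
    qed
    have F1: "(\<integral>\<^sup>+z. FC (fst z) (snd z) \<partial>lborel2) < \<infinity>"
      using nn_integral_lborel2[OF FCm] F by simp
    have F2: "(\<integral>\<^sup>+z. FC (snd z) (fst z) \<partial>lborel2) < \<infinity>"
      using nn_integral_lborel2_swap[OF FCm'] F by simp
    show ?thesis using A B F1 F2 by (simp add: ennreal_add_less_top)
  qed
  finally show ?thesis .
qed

text \<open>The weak inequality tested with \<open>w\<close>.  Two points in the ball contribute at least the integrand on the left side
  minus \<open>|g x - g y| powr p\<close>, the latter only if one of them lies in \<open>{u > k}\<close>; the Lipschitz bound of \<open>g\<close>
  makes this integrable against the kernel.\<close>

lemma cut_energy_estimate:
  fixes T :: ennreal
  assumes T: "excess_energy q p u k x0 r \<le> T"
  defines "A \<equiv> {x \<in> ball x0 \<rho>2. k < u x}"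
  shows "ennreal (\<Lambda>1 * (1/2) powr (p - 1)) *
      (\<integral>\<^sup>+x. \<integral>\<^sup>+y. ennreal (w x * m y powr (p - 1) * ker x y) * indicator (ball x0 r) x * indicator (ball x0 r) y \<partial>lborel \<partial>lborel)
    \<le> ennreal (2 * \<Lambda>2) * (ennreal ((3 powr p + 2) * (\<tau> / (\<rho>2 - \<rho>1)) powr p * (kernel_const TYPE('a) (p - p * s) * (2 * r) powr (p - p * s)))
        + ennreal (\<tau> * 2 powr q) * T) * emeasure lborel A"
proof -
  let ?V = "ball x0 r"
  have [measurable]: "A \<in> sets borel"
  proof -
    have "A = ball x0 \<rho>2 \<inter> {x. k < u x}" by (auto simp: A_def)
    then show ?thesis by simp
  qed
  have wA: "x \<in> A" if "0 < w x" for x using w_pos[OF that] by (simp add: A_def)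
  have AV: "x \<in> ?V" "x \<in> ball x0 (r / 2)" if "x \<in> A" for x using that \<rho> r by (auto simp: A_def)
  define good where "good = (\<lambda>(x, y). \<Lambda>1 * (1/2) powr (p - 1) * (w x * m y powr (p - 1) * ker x y) * (indicator ?V x * indicator ?V y))"
  define bad1 where "bad1 x y = (3 powr p + 2) * (\<bar>g x - g y\<bar> powr p * ker x y) * (indicator A x * indicator ?V y)" for x y
  define bad2 where "bad2 x y = w x * max 0 (u y - k) powr (p - 1) * ker x y * indicator (- ?V) y" for x y
  define bad where "bad = (\<lambda>(x, y). \<Lambda>2 * (bad1 x y + bad2 x y) + \<Lambda>2 * (bad1 y x + bad2 y x))"
  have bnn: "0 \<le> bad1 x y" "0 \<le> bad2 x y" for x y using ker_nonneg w_range by (auto simp: bad1_def bad2_def)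
  have [measurable]: "good \<in> borel_measurable lborel2" unfolding good_def by measurable
  have [measurable]: "(\<lambda>z. bad1 (fst z) (snd z)) \<in> borel_measurable lborel2" "(\<lambda>z. bad1 (snd z) (fst z)) \<in> borel_measurable lborel2"
    "(\<lambda>z. bad2 (fst z) (snd z)) \<in> borel_measurable lborel2" "(\<lambda>z. bad2 (snd z) (fst z)) \<in> borel_measurable lborel2"
    unfolding bad1_def bad2_def by measurable
  have badm[measurable]: "bad \<in> borel_measurable lborel2" unfolding bad_def case_prod_beta' by measurable
  have ker_sym: "ker y x = ker x y" for x y by (simp add: ker_def norm_minus_commute)
  have supp: "x \<notin> ball x0 (r / 2) \<Longrightarrow> w x = 0" for x using \<rho> by (auto simp: w_def)
  have le1: "(\<integral>\<^sup>+z. ennreal (good z) \<partial>lborel2) \<le> (\<integral>\<^sup>+z. ennreal (bad z) \<partial>lborel2)"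
  proof (rule nn_integral_le_of_integral_nonpos)
    show "integrable lborel2 (weak_integrand w)"
      "(\<integral>z. (weak_integrand w) z \<partial>lborel2) \<le> 0"
      using weak_testfun[of w \<tau>] w_range supp w_energy_finite by auto
    show "AE z in lborel2. good z \<le> (weak_integrand w) z + bad z"
      using AE_lborel2_coordinate[OF u_le] K_bounds
    proof eventually_elim
      case (elim z)
      obtain x y where z: "z = (x, y)" by (cases z)
      have K: "\<Lambda>1 * ker x y \<le> K (x, y)" "K (x, y) \<le> \<Lambda>2 * ker x y" using elim z by auto
      have K0: "0 \<le> K (x, y)" using K(1) \<Lambda> ker_nonneg[of x y] by (smt (verit) mult_nonneg_nonneg)
      have L2: "0 \<le> \<Lambda>2" using \<Lambda> by simp
      have badz: "bad z = \<Lambda>2 * (bad1 x y + bad2 x y) + \<Lambda>2 * (bad1 y x + bad2 y x)" by (simp add: bad_def z)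
      have bad0: "0 \<le> \<Lambda>2 * bad1 x y" "0 \<le> \<Lambda>2 * bad2 x y" "0 \<le> \<Lambda>2 * bad1 y x" "0 \<le> \<Lambda>2 * bad2 y x"
        using bnn L2 by (auto intro: mult_nonneg_nonneg)
      have ext: "- (\<Lambda>2 * (w x * max 0 (u y - k) powr (p - 1) * ker x y)) \<le> Jp p (u x - u y) * w x * K'"
        if "0 \<le> K'" "K' \<le> \<Lambda>2 * ker x y" for x y K'
        by (rule weak_integrand_lower_exterior[OF p that w_range(1)]) (use w_pos[of x] in auto)
      show ?case
      proof (cases "x \<in> ?V"; cases "y \<in> ?V")
        assume V: "x \<in> ?V" "y \<in> ?V"
        have we: "w x = max 0 (u x - g x)" "w y = max 0 (u y - g y)" using elim V z by (auto intro: w_eq)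
        have "\<Lambda>1 * (1/2) powr (p - 1) * (w x * m y powr (p - 1) * ker x y)
          \<le> Jp p (u x - u y) * (w x - w y) * K (x, y) + (if 0 < w x \<or> 0 < w y then \<Lambda>2 * (3 powr p + 2) * (\<bar>g x - g y\<bar> powr p * ker x y) else 0)"
          unfolding we m_def by (rule weak_integrand_lower_interior[OF p K \<Lambda>(1) ker_nonneg])
        also have "(if 0 < w x \<or> 0 < w y then \<Lambda>2 * (3 powr p + 2) * (\<bar>g x - g y\<bar> powr p * ker x y) else 0) \<le> \<Lambda>2 * bad1 x y + \<Lambda>2 * bad1 y x"
          using wA[of x] wA[of y] V bad0 unfolding bad1_def by (auto simp: abs_minus_commute ker_sym mult.assoc)
        also have "\<Lambda>2 * bad1 x y + \<Lambda>2 * bad1 y x \<le> bad z" unfolding badz distrib_left using bad0 by linarith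
        finally show ?thesis using V by (simp add: good_def z)
      next
        assume V: "x \<in> ?V" "y \<notin> ?V"
        then have wy: "w y = 0" using w_pos[of y] w_range(1)[of y] AV[OF wA, of y] by force
        have "- (\<Lambda>2 * bad2 x y) \<le> Jp p (u x - u y) * w x * K (x, y)"
          using ext[OF K0 K(2)] V by (simp add: bad2_def)
        then show ?thesis using V wy bad0 unfolding badz distrib_left by (simp add: good_def z)
      next
        assume V: "x \<notin> ?V" "y \<in> ?V"
        then have wx: "w x = 0" using w_pos[of x] w_range(1)[of x] AV[OF wA, of x] by force
        have "- (\<Lambda>2 * bad2 y x) \<le> Jp p (u y - u x) * w y * K (x, y)"
          using ext[OF K0, of y x] K(2) V by (simp add: bad2_def ker_sym)
        moreover have "Jp p (u x - u y) = - Jp p (u y - u x)" using Jp_minus[of p "u y - u x"] by simp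
        ultimately show ?thesis using V wx bad0 unfolding badz distrib_left by (simp add: good_def z)
      next
        assume V: "x \<notin> ?V" "y \<notin> ?V"
        then have "w x = 0" "w y = 0" using w_range(1) AV[OF wA] by (metis less_eq_real_def)+
        then show ?thesis using V bad0 unfolding badz distrib_left by (simp add: good_def z)
      qed
    qed
    show "0 \<le> good z" for z using \<Lambda> w_range ker_nonneg by (auto simp: good_def split_beta)
    show "0 \<le> bad z" for z using \<Lambda> bnn by (auto simp: bad_def split_beta intro!: add_nonneg_nonneg mult_nonneg_nonneg)
  qed measurable
  have eq2: "(\<integral>\<^sup>+z. ennreal (bad z) \<partial>lborel2) = ennreal (2 * \<Lambda>2) * (\<integral>\<^sup>+x. \<integral>\<^sup>+y. ennreal (bad1 x y) + ennreal (bad2 x y) \<partial>lborel \<partial>lborel)"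
  proof -
    have L2: "0 \<le> \<Lambda>2" using \<Lambda> by simp
    define bb where "bb x y = ennreal (bad1 x y) + ennreal (bad2 x y)" for x y
    have m1: "(\<lambda>z. bb (fst z) (snd z)) \<in> borel_measurable lborel2" and m2: "(\<lambda>z. bb (snd z) (fst z)) \<in> borel_measurable lborel2"
      unfolding bb_def by measurable
    let ?I = "\<integral>\<^sup>+x. \<integral>\<^sup>+y. bb x y \<partial>lborel \<partial>lborel"
    have "(\<integral>\<^sup>+z. ennreal (bad z) \<partial>lborel2) = (\<integral>\<^sup>+z. ennreal \<Lambda>2 * bb (fst z) (snd z) + ennreal \<Lambda>2 * bb (snd z) (fst z) \<partial>lborel2)"
    proof (rule nn_integral_cong)
      fix z
      show "ennreal (bad z) = ennreal \<Lambda>2 * bb (fst z) (snd z) + ennreal \<Lambda>2 * bb (snd z) (fst z)"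
        using bnn L2 by (simp add: bad_def bb_def split_beta ennreal_mult'[symmetric] ennreal_plus[symmetric] del: ennreal_plus)
    qed
    also have "\<dots> = (\<integral>\<^sup>+z. ennreal \<Lambda>2 * bb (fst z) (snd z) \<partial>lborel2) + (\<integral>\<^sup>+z. ennreal \<Lambda>2 * bb (snd z) (fst z) \<partial>lborel2)"
      using m1 m2 by (intro nn_integral_add borel_measurable_times_ennreal borel_measurable_const)
    also have "\<dots> = ennreal \<Lambda>2 * ?I + ennreal \<Lambda>2 * ?I"
      unfolding nn_integral_cmult[OF m1] nn_integral_cmult[OF m2] nn_integral_lborel2[OF m1] nn_integral_lborel2_swap[OF m2] fst_conv snd_conv ..
    also have "\<dots> = ennreal (2 * \<Lambda>2) * ?I"
    proof -
      have "ennreal (2 * \<Lambda>2) = ennreal \<Lambda>2 + ennreal \<Lambda>2"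
        using L2 by (simp add: ennreal_plus[symmetric] del: ennreal_plus)
      then show ?thesis by (simp only: distrib_right)
    qed
    finally show ?thesis unfolding bb_def .
  qed
  have "(\<integral>\<^sup>+x. \<integral>\<^sup>+y. ennreal (bad1 x y) + ennreal (bad2 x y) \<partial>lborel \<partial>lborel)
    \<le> (\<integral>\<^sup>+x. (ennreal ((3 powr p + 2) * (\<tau> / (\<rho>2 - \<rho>1)) powr p * (kernel_const TYPE('a) (p - p * s) * (2 * r) powr (p - p * s)))
        + ennreal (\<tau> * 2 powr q) * T) * indicator A x \<partial>lborel)"
  proof (rule nn_integral_mono)
    fix x
    show "(\<integral>\<^sup>+y. ennreal (bad1 x y) + ennreal (bad2 x y) \<partial>lborel) \<le> (ennreal ((3 powr p + 2) * (\<tau> / (\<rho>2 - \<rho>1)) powr p * (kernel_const TYPE('a) (p - p * s) * (2 * r) powr (p - p * s)))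
        + ennreal (\<tau> * 2 powr q) * T) * indicator A x"
    proof (cases "x \<in> A")
      case False
      then have "w x = 0" using wA[of x] w_range(1)[of x] by fastforce
      then show ?thesis using False by (simp add: bad1_def bad2_def)
    next
      case True
      have "(\<integral>\<^sup>+y. ennreal (bad1 x y) + ennreal (bad2 x y) \<partial>lborel)
        \<le> (\<integral>\<^sup>+y. ennreal (3 powr p + 2) * (ennreal (\<bar>g x - g y\<bar> powr p * ker x y) * indicator ?V y)
          + ennreal (\<tau> * 2 powr q) * (ennreal (max 0 (u y - k) powr (p - 1) * norm (y - x0) powr (- q)) * indicator (- ?V) y) \<partial>lborel)"
      proof (intro nn_integral_mono add_mono)
        fix y
        show "ennreal (bad1 x y) \<le> ennreal (3 powr p + 2) * (ennreal (\<bar>g x - g y\<bar> powr p * ker x y) * indicator ?V y)"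
          using True unfolding bad1_def by (cases "y \<in> ?V") (simp_all add: ennreal_mult'[symmetric] del: ennreal_plus)
        show "ennreal (bad2 x y) \<le> ennreal (\<tau> * 2 powr q) * (ennreal (max 0 (u y - k) powr (p - 1) * norm (y - x0) powr (- q)) * indicator (- ?V) y)"
        proof (cases "y \<in> ?V")
          case False
          have "bad2 x y \<le> \<tau> * max 0 (u y - k) powr (p - 1) * (2 powr q * norm (y - x0) powr (- q))"
          proof -
            have "bad2 x y = w x * max 0 (u y - k) powr (p - 1) * ker x y" using False by (simp add: bad2_def)
            also have "\<dots> \<le> \<tau> * max 0 (u y - k) powr (p - 1) * (2 powr q * norm (y - x0) powr (- q))"
              by (intro mult_mono mult_right_mono w_range ker_far_half[OF AV(2)[OF True] False] mult_nonneg_nonneg)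
                 (use \<tau> ker_nonneg in auto)
            finally show ?thesis .
          qed
          also have "\<dots> = (\<tau> * 2 powr q) * (max 0 (u y - k) powr (p - 1) * norm (y - x0) powr (- q))" by simp
          finally show ?thesis using False \<tau> by (simp add: ennreal_mult'[symmetric] ennreal_leI)
        qed (simp add: bad2_def)
      qed
      also have "\<dots> = ennreal (3 powr p + 2) * (\<integral>\<^sup>+y. ennreal (\<bar>g x - g y\<bar> powr p * ker x y) * indicator ?V y \<partial>lborel)
          + ennreal (\<tau> * 2 powr q) * (\<integral>\<^sup>+y. ennreal (max 0 (u y - k) powr (p - 1) * norm (y - x0) powr (- q)) * indicator (- ?V) y \<partial>lborel)"
      proof -
        have m1: "(\<lambda>y. ennreal (\<bar>g x - g y\<bar> powr p * ker x y) * indicator ?V y) \<in> borel_measurable lborel"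
          unfolding ker_def by measurable
        have m2: "(\<lambda>y. ennreal (max 0 (u y - k) powr (p - 1) * norm (y - x0) powr (- q)) * indicator (- ?V) y) \<in> borel_measurable lborel"
          by measurable
        show ?thesis
          unfolding nn_integral_cmult[OF m1, symmetric] nn_integral_cmult[OF m2, symmetric]
          by (rule nn_integral_add; rule borel_measurable_times_ennreal, rule borel_measurable_const, rule m1 m2)
      qed
      also have "\<dots> \<le> ennreal (3 powr p + 2) * ennreal ((\<tau> / (\<rho>2 - \<rho>1)) powr p * (kernel_const TYPE('a) (p - p * s) * (2 * r) powr (p - p * s)))
          + ennreal (\<tau> * 2 powr q) * T"
        using T by (intro add_mono mult_left_mono barrier_local_energy AV(1) True) auto
      finally show ?thesis using True by (simp add: ennreal_mult'[symmetric] mult.assoc del: ennreal_plus)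
    qed
  qed
  also have "\<dots> = (ennreal ((3 powr p + 2) * (\<tau> / (\<rho>2 - \<rho>1)) powr p * (kernel_const TYPE('a) (p - p * s) * (2 * r) powr (p - p * s)))
        + ennreal (\<tau> * 2 powr q) * T) * emeasure lborel A"
    by (rule nn_integral_cmult_indicator) simp
  finally have le3: "(\<integral>\<^sup>+x. \<integral>\<^sup>+y. ennreal (bad1 x y) + ennreal (bad2 x y) \<partial>lborel \<partial>lborel)
    \<le> (ennreal ((3 powr p + 2) * (\<tau> / (\<rho>2 - \<rho>1)) powr p * (kernel_const TYPE('a) (p - p * s) * (2 * r) powr (p - p * s)))
        + ennreal (\<tau> * 2 powr q) * T) * emeasure lborel A" .
  have eq5: "(\<integral>\<^sup>+z. ennreal (good z) \<partial>lborel2) = ennreal (\<Lambda>1 * (1/2) powr (p - 1)) *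
      (\<integral>\<^sup>+x. \<integral>\<^sup>+y. ennreal (w x * m y powr (p - 1) * ker x y) * indicator ?V x * indicator ?V y \<partial>lborel \<partial>lborel)"
  proof -
    define gd where "gd x y = ennreal (w x * m y powr (p - 1) * ker x y) * indicator ?V x * indicator ?V y" for x y
    have gm: "(\<lambda>z. gd (fst z) (snd z)) \<in> borel_measurable lborel2" unfolding gd_def by measurable
    have "(\<integral>\<^sup>+z. ennreal (good z) \<partial>lborel2) = (\<integral>\<^sup>+z. ennreal (\<Lambda>1 * (1/2) powr (p - 1)) * gd (fst z) (snd z) \<partial>lborel2)"
    proof (rule nn_integral_cong)
      fix z
      show "ennreal (good z) = ennreal (\<Lambda>1 * (1/2) powr (p - 1)) * gd (fst z) (snd z)"
        using \<Lambda> by (simp add: good_def gd_def split_beta indicator_def ennreal_mult'[symmetric])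
    qed
    then show ?thesis
      unfolding nn_integral_cmult[OF gm] nn_integral_lborel2[OF gm] fst_conv snd_conv unfolding gd_def .
  qed
  from le1 mult_left_mono[OF le3, of "ennreal (2 * \<Lambda>2)"] show ?thesis
    unfolding eq2 eq5 mult.assoc by (rule order_trans) simp
qed

definition level_const :: real where
  "level_const = 2 * \<Lambda>2 * 2 powr (p - 1) / \<Lambda>1 *
     max ((3 powr p + 2) * kernel_const TYPE('a) (p - p * s) * 2 powr (p - p * s)) (2 powr q)"

lemma level_const_pos: "0 < level_const"
  unfolding level_const_def using \<Lambda>
  by (intro mult_pos_pos divide_pos_pos) (auto simp: less_max_iff_disj)

text \<open>Where \<open>u > k + h\<close> in the inner ball \<open>w \<ge> h\<close>, and where \<open>u \<le> k - l\<close> one has \<open>m \<ge> l\<close>.  So a point of the first kind with an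
  amount \<open>\<delta>0\<close> of points of the second kind at distance less than \<open>\<rho>\<close> contributes
  \<open>h * l powr (p - 1) * \<rho> powr (- q) * \<delta>0\<close> to the left side of \<open>cut_energy_estimate\<close>.\<close>

lemma level_step:
  fixes T1 h l \<rho> \<delta>0 :: real
  assumes T: "excess_energy q p u k x0 r
      \<le> ennreal (T1 * \<tau> powr (p - 1) * r powr (- (p * s)))" and T1: "0 \<le> T1"
    and h: "0 < h" "h \<le> \<tau>" and l: "0 < l" and \<rho>0: "0 < \<rho>" and \<delta>0: "0 \<le> \<delta>0"
    and dense: "\<And>x. x \<in> ball x0 \<rho>1 \<Longrightarrow> \<delta>0 \<le> measure lborel {y \<in> ball x0 r \<inter> ball x \<rho>. u y \<le> k - l}"
  shows "h * l powr (p - 1) * \<rho> powr (- q) * \<delta>0 * measure lborel {x \<in> ball x0 \<rho>1. k + h < u x}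
    \<le> level_const * \<tau> powr p * r powr (- (p * s)) * ((r / (\<rho>2 - \<rho>1)) powr p + T1) * measure lborel {x \<in> ball x0 \<rho>2. k < u x}"
proof -
  let ?V = "ball x0 r"
  define A A' where "A = {x \<in> ball x0 \<rho>2. k < u x}" and "A' = {x \<in> ball x0 \<rho>1. k + h < u x}"
  have "A = ball x0 \<rho>2 \<inter> {x. k < u x}" "A' = ball x0 \<rho>1 \<inter> {x. k + h < u x}" by (auto simp: A_def A'_def)
  then have [measurable]: "A \<in> sets borel" "A' \<in> sets borel" by simp_all
  have finA: "emeasure lborel A \<noteq> \<infinity>" "emeasure lborel A' \<noteq> \<infinity>"
  proof -
    have "A \<subseteq> ball x0 \<rho>2" "A' \<subseteq> ball x0 \<rho>1" by (auto simp: A_def A'_def)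
    from this[THEN emeasure_subset_ball_finite]
    show "emeasure lborel A \<noteq> \<infinity>" "emeasure lborel A' \<noteq> \<infinity>" by auto
  qed
  define c where "c = \<Lambda>1 * (1/2) powr (p - 1)"
  have c: "0 < c" using \<Lambda> by (simp add: c_def)
  define e where "e = h * l powr (p - 1) * \<rho> powr (- q) * \<delta>0"
  have e: "0 \<le> e" using h l \<delta>0 by (simp add: e_def)
  have lower: "ennreal e * emeasure lborel A'
    \<le> (\<integral>\<^sup>+x. \<integral>\<^sup>+y. ennreal (w x * m y powr (p - 1) * ker x y) * indicator ?V x * indicator ?V y \<partial>lborel \<partial>lborel)"
  proof -
    have "ennreal e * emeasure lborel A' = (\<integral>\<^sup>+x. ennreal e * indicator A' x \<partial>lborel)"
      by (simp add: nn_integral_cmult_indicator)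
    also have "\<dots> \<le> (\<integral>\<^sup>+x. \<integral>\<^sup>+y. ennreal (w x * m y powr (p - 1) * ker x y) * indicator ?V x * indicator ?V y \<partial>lborel \<partial>lborel)"
    proof (rule nn_integral_mono)
      fix x
      show "ennreal e * indicator A' x \<le> (\<integral>\<^sup>+y. ennreal (w x * m y powr (p - 1) * ker x y) * indicator ?V x * indicator ?V y \<partial>lborel)"
      proof (cases "x \<in> A'")
        case True
        then have x: "x \<in> ball x0 \<rho>1" "k + h < u x" by (auto simp: A'_def)
        then have xV: "x \<in> ?V" using \<rho> r by auto
        have "x \<in> ball x0 \<rho>2" using x(1) \<rho> by auto
        then have wx: "h \<le> w x" using x g_inner[OF x(1)] h by (auto simp: w_def)
        let ?D = "{y \<in> ?V \<inter> ball x \<rho>. u y \<le> k - l}"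
        have "?D = ?V \<inter> ball x \<rho> \<inter> {y. u y \<le> k - l}" by auto
        then have [measurable]: "?D \<in> sets borel" by simp
        have finD: "emeasure lborel ?D \<noteq> \<infinity>"
        proof -
          have "?D \<subseteq> ball x0 r" by auto
          from emeasure_subset_ball_finite[OF this] show ?thesis by simp
        qed
        have "ennreal e = ennreal (h * l powr (p - 1) * \<rho> powr (- q)) * ennreal \<delta>0"
          using h l \<delta>0 by (simp add: e_def ennreal_mult'[symmetric])
        also have "\<dots> \<le> ennreal (h * l powr (p - 1) * \<rho> powr (- q)) * emeasure lborel ?D"
          using dense[OF x(1)] finD by (intro mult_left_mono) (auto simp: emeasure_eq_ennreal_measure ennreal_leI)
        also have "\<dots> = (\<integral>\<^sup>+y. ennreal (h * l powr (p - 1) * \<rho> powr (- q)) * indicator ?D y \<partial>lborel)"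
          by (simp add: nn_integral_cmult_indicator)
        also have "\<dots> \<le> (\<integral>\<^sup>+y. ennreal (w x * m y powr (p - 1) * ker x y) * indicator ?V x * indicator ?V y \<partial>lborel)"
        proof (rule nn_integral_mono)
          fix y
          show "ennreal (h * l powr (p - 1) * \<rho> powr (- q)) * indicator ?D y
            \<le> ennreal (w x * m y powr (p - 1) * ker x y) * indicator ?V x * indicator ?V y"
          proof (cases "y \<in> ?D")
            case True
            then have y: "y \<in> ?V" "norm (x - y) < \<rho>" "u y \<le> k - l" by (auto simp: dist_norm)
            \<comment> \<open>matters because the kernel has the value \<open>0\<close> on the diagonal\<close>
            have "x \<noteq> y" using x(2) y(3) h l by auto
            then have "\<rho> powr (- q) \<le> ker x y" unfolding ker_def using y q by (intro powr_mono2') auto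
            moreover have "l \<le> m y" using y(3) g_ge[of y] by (auto simp: m_def)
            then have "l powr (p - 1) \<le> m y powr (p - 1)" using l p by (intro powr_mono2) auto
            ultimately have "h * l powr (p - 1) * \<rho> powr (- q) \<le> w x * m y powr (p - 1) * ker x y"
              using wx h by (intro mult_mono) (auto intro!: mult_nonneg_nonneg w_range)
            then show ?thesis using True xV y by (simp add: ennreal_leI)
          qed simp
        qed
        finally show ?thesis using True by simp
      qed simp
    qed
    finally show ?thesis .
  qed
  define M where "M = max ((3 powr p + 2) * kernel_const TYPE('a) (p - p * s) * 2 powr (p - p * s)) (2 powr q)"
  have M: "(3 powr p + 2) * kernel_const TYPE('a) (p - p * s) * 2 powr (p - p * s) \<le> M" "2 powr q \<le> M"
    by (auto simp: M_def)
  define P where "P = (3 powr p + 2) * (\<tau> / (\<rho>2 - \<rho>1)) powr p * (kernel_const TYPE('a) (p - p * s) * (2 * r) powr (p - p * s))"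
  define Q where "Q = \<tau> * 2 powr q * (T1 * \<tau> powr (p - 1) * r powr (- (p * s)))"
  have kc: "0 < kernel_const TYPE('a) (p - p * s)" using p s by (intro kernel_const_pos) simp
  have P0: "0 \<le> P" unfolding P_def using kc by (intro mult_nonneg_nonneg) auto
  have Q0: "0 \<le> Q" unfolding Q_def using \<tau> T1 by (intro mult_nonneg_nonneg) auto
  have L2: "0 < \<Lambda>2" using \<Lambda> by simp
  have "ennreal c * (ennreal e * emeasure lborel A') \<le> ennreal (2 * \<Lambda>2) * (ennreal P + ennreal (\<tau> * 2 powr q) * ennreal (T1 * \<tau> powr (p - 1) * r powr (- (p * s)))) * emeasure lborel A"
    using mult_left_mono[OF lower, of "ennreal c"] cut_energy_estimate[OF T]
    unfolding c_def P_def A_def by (rule order_trans) simp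
  also have "ennreal (\<tau> * 2 powr q) * ennreal (T1 * \<tau> powr (p - 1) * r powr (- (p * s))) = ennreal Q"
    using \<tau> by (simp add: Q_def ennreal_mult'[symmetric])
  finally have "ennreal (c * (e * measure lborel A')) \<le> ennreal (2 * \<Lambda>2 * (P + Q) * measure lborel A)"
    using finA c e P0 Q0 L2
    by (simp add: emeasure_eq_ennreal_measure ennreal_mult'[symmetric] ennreal_plus[symmetric] del: ennreal_plus)
  then have "c * (e * measure lborel A') \<le> 2 * \<Lambda>2 * (P + Q) * measure lborel A"
    using P0 Q0 L2 by (subst (asm) ennreal_le_iff) auto
  then have "e * measure lborel A' \<le> 2 * \<Lambda>2 * (P + Q) * measure lborel A / c"
    using c by (simp add: field_simps)
  also have "\<dots> = (2 * \<Lambda>2 / c) * (P + Q) * measure lborel A" by simp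
  also have "\<dots> \<le> (2 * \<Lambda>2 / c) * (M * (\<tau> powr p * r powr (- (p * s)) * ((r / (\<rho>2 - \<rho>1)) powr p + T1))) * measure lborel A"
  proof (intro mult_right_mono mult_left_mono)
    have "P = ((3 powr p + 2) * kernel_const TYPE('a) (p - p * s) * 2 powr (p - p * s)) * (\<tau> powr p * r powr (- (p * s)) * (r / (\<rho>2 - \<rho>1)) powr p)"
    proof -
      have "r powr (p - p * s) = r powr p * r powr (- (p * s))" by (subst powr_add[symmetric]) simp
      then show ?thesis by (simp add: P_def powr_mult powr_divide)
    qed
    also have "\<dots> \<le> M * (\<tau> powr p * r powr (- (p * s)) * (r / (\<rho>2 - \<rho>1)) powr p)"
      using M by (intro mult_right_mono) auto
    finally have 1: "P \<le> M * (\<tau> powr p * r powr (- (p * s)) * (r / (\<rho>2 - \<rho>1)) powr p)" .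
    have "Q = 2 powr q * (\<tau> powr p * r powr (- (p * s)) * T1)"
      using \<tau> by (simp add: Q_def powr_diff)
    also have "\<dots> \<le> M * (\<tau> powr p * r powr (- (p * s)) * T1)"
      using M T1 by (intro mult_right_mono) auto
    finally have "Q \<le> M * (\<tau> powr p * r powr (- (p * s)) * T1)" .
    with 1 show "P + Q \<le> M * (\<tau> powr p * r powr (- (p * s)) * ((r / (\<rho>2 - \<rho>1)) powr p + T1))"
      by (simp add: distrib_left)
  qed (use c L2 in auto)
  also have "\<dots> = level_const * \<tau> powr p * r powr (- (p * s)) * ((r / (\<rho>2 - \<rho>1)) powr p + T1) * measure lborel A"
    unfolding level_const_def M_def[symmetric] by (simp add: c_def powr_divide)
  finally show ?thesis unfolding e_def A_def A'_def .
qed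

end

section \<open>Decrease of the supremum\<close>

lemma measure_mono_in_ball:
  fixes A B :: "'a::euclidean_space set"
  assumes "A \<subseteq> B" "B \<in> sets borel" "B \<subseteq> ball x r"
  shows "measure lborel A \<le> measure lborel B"
proof (cases "A \<in> sets lborel")
  case True
  then show ?thesis using assms emeasure_subset_ball_finite[OF assms(3)]
    by (intro measure_mono_fmeasurable) (auto simp: fmeasurable_def)
qed (simp add: measure_notin_sets)

context subsolution_ball
begin

abbreviation "V \<equiv> ball x0 r"

definition tail_above :: "real \<Rightarrow> ennreal" where
  "tail_above k = excess_energy q p u k x0 r"

lemma tail_above_antimono: "k \<le> k' \<Longrightarrow> tail_above k' \<le> tail_above k"
  unfolding tail_above_def using p
  by (intro nn_integral_mono mult_right_mono ennreal_leI powr_mono2) auto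

lemma superlevel_measurable [measurable]: "{x \<in> ball a \<rho>. k < u x} \<in> sets borel"
proof -
  have "{x \<in> ball a \<rho>. k < u x} = ball a \<rho> \<inter> {x. k < u x}" by auto
  then show ?thesis by simp
qed

lemma measure_ball: "0 \<le> \<rho> \<Longrightarrow> measure lborel (ball (a::'a) \<rho>) = unit_ball_vol (real DIM('a)) * \<rho> ^ DIM('a)"
  using content_ball[of \<rho> a] by simp

text \<open>The levels \<open>kk j\<close> increase from \<open>M - t / 2\<close> to \<open>M - t / 4\<close> and the radii \<open>rr j\<close> decrease from \<open>r / 4\<close> to
  \<open>r / 8\<close>.  The claim carried along is \<open>|A j| \<le> \<omega> / 2 * \<rho>\<^sub>j\<^sub>+\<^sub>1 ^ N\<close> with \<open>\<rho>\<^sub>j = \<sigma> Q ^ j r\<close>: it says that at least half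
  of a ball of radius \<open>\<rho>\<^sub>j\<^sub>+\<^sub>1\<close> lies below the level \<open>kk j\<close>, so that \<open>level_step\<close> applies with this radius.  The
  resulting factor \<open>\<rho>\<^sub>j powr (p s)\<close> has to absorb the loss \<open>2 ^ (2 j p)\<close> from the shrinking gaps between levels
  and radii, whence \<open>Q powr (p s) = 4 powr (- p)\<close>.\<close>

lemma de_giorgi:
  fixes T1 \<sigma> Q t M :: real
  defines "Q \<equiv> 4 powr (- 1 / s)" and "L \<equiv> barrier.level_const TYPE('a) p s \<Lambda>1 \<Lambda>2"
    and "\<omega> \<equiv> unit_ball_vol (real DIM('a))"
  assumes T1: "0 \<le> T1" and \<sigma>: "0 < \<sigma>" "\<sigma> \<le> 1 / 8"
    and \<sigma>_small: "\<sigma> powr (p * s) * (16 * 4 powr (p - 1) * L * (16 powr p + T1)) \<le> \<omega> * Q ^ DIM('a)"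
    and t: "0 < t" and u_le: "AE x in lborel. x \<in> V \<longrightarrow> u x \<le> M"
    and tail_le: "tail_above (M - t) \<le> ennreal (T1 * t powr (p - 1) * r powr (- (p * s)))"
    and start: "measure lborel {x \<in> ball x0 (r / 4). M - t / 2 < u x} \<le> \<omega> / 2 * (\<sigma> * Q\<^sup>2 * r) ^ DIM('a)"
  shows "AE x in lborel. x \<in> ball x0 (r / 8) \<longrightarrow> u x \<le> M - t / 4"
proof -
  let ?N = "DIM('a)"
  have \<omega>: "0 < \<omega>" by (simp add: \<omega>_def)
  have Q: "0 < Q" "Q \<le> 1 / 4"
  proof -
    show "0 < Q" by (simp add: Q_def)
    have "Q \<le> 4 powr (- 1)" unfolding Q_def using s by (intro powr_mono) auto
    then show "Q \<le> 1 / 4" by (simp add: powr_minus)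
  qed
  define kk where "kk j = M - t / 4 - t / 4 / 2 ^ j" for j :: nat
  define rr where "rr j = r / 8 + r / 8 / 2 ^ j" for j :: nat
  define A where "A j = {x \<in> ball x0 (rr j). kk j < u x}" for j
  have pow2: "1 \<le> (2::real) ^ j" for j by simp
  have rr: "r / 8 \<le> rr j" "rr j \<le> r / 4" "rr (Suc j) < rr j" for j
    using r pow2[of j] by (auto simp: rr_def field_simps)
  have kk: "M - t / 2 \<le> kk j" "kk j \<le> M - t / 4" "kk j \<le> kk (Suc j)" for j
    using t pow2[of j] by (auto simp: kk_def field_simps)
  have [measurable]: "A j \<in> sets borel" for j unfolding A_def by measurable
  have A_mono: "measure lborel (A (Suc j)) \<le> measure lborel (A j)" for j
    by (rule measure_mono_in_ball[where x = x0 and r = "rr j"]) (use rr(3)[of j] kk(3)[of j] in \<open>auto simp: A_def\<close>)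
  have step: "measure lborel (A (Suc (Suc i))) \<le> Q ^ ?N * measure lborel (A (Suc i))"
    if small: "measure lborel (A i) \<le> \<omega> / 2 * (\<sigma> * Q ^ Suc i * r) ^ ?N" for i
  proof -
    define j where "j = Suc i"
    define B :: real where "B = 2 ^ j"
    have B: "1 \<le> B" by (simp add: B_def)
    define \<rho> where "\<rho> = \<sigma> * Q ^ j * r"
    have \<rho>0: "0 < \<rho>" using \<sigma> Q r by (simp add: \<rho>_def)
    have rho_le: "\<rho> \<le> r / 8 / B"
    proof -
      have "Q ^ j \<le> (1 / 2) ^ j" using Q by (intro power_mono) auto
      then have "\<sigma> * Q ^ j * r \<le> 1 / 8 * (1 / 2) ^ j * r"
        using \<sigma> Q r by (intro mult_mono) auto
      then show ?thesis by (simp add: \<rho>_def B_def power_divide)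
    qed
    interpret b: barrier p s \<Lambda>1 \<Lambda>2 K \<Omega> u x0 r "kk j" t "rr (Suc j)" "rr j"
    proof
      show "0 \<le> rr (Suc j)" "rr (Suc j) < rr j" "rr j \<le> r / 2" "0 < t" using rr[of j] rr[of "Suc j"] r t by auto
      show "AE x in lborel. x \<in> V \<longrightarrow> u x \<le> kk j + t"
        using u_le by eventually_elim (use kk(1)[of j] t in auto)
    qed
    define h l where "h = t / 8 / B" and "l = t / 4 / B"
    have hl: "0 < h" "h \<le> t" "0 < l" using t B by (auto simp: h_def l_def field_simps)
    have kj: "kk j + h = kk (Suc j)" "kk j - l = kk i"
      by (auto simp: kk_def h_def l_def B_def j_def field_simps)
    have main: "h * l powr (p - 1) * \<rho> powr (- q) * (\<omega> / 2 * \<rho> ^ ?N) * measure lborel {x \<in> ball x0 (rr (Suc j)). kk j + h < u x}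
      \<le> L * t powr p * r powr (- (p * s)) * ((r / (rr j - rr (Suc j))) powr p + T1) * measure lborel {x \<in> ball x0 (rr j). kk j < u x}"
      unfolding L_def
    proof (rule b.level_step[OF _ T1 hl \<rho>0])
      have "M - t \<le> kk j" using kk(1)[of j] t by linarith
      from tail_above_antimono[OF this] tail_le
      show "excess_energy q p u (kk j) x0 r
        \<le> ennreal (T1 * t powr (p - 1) * r powr (- (p * s)))"
        unfolding tail_above_def by (rule order_trans)
      show "0 \<le> \<omega> / 2 * \<rho> ^ ?N" using \<omega> \<rho>0 by simp
      fix x assume x: "x \<in> ball x0 (rr (Suc j))"
      have sub: "ball x \<rho> \<subseteq> ball x0 (rr i)"
      proof
        fix y assume "y \<in> ball x \<rho>"
        then have "dist x0 y < rr (Suc j) + \<rho>" using x dist_triangle[of x0 y x] by auto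
        also have "\<dots> \<le> rr i"
          using rho_le r B by (simp add: rr_def j_def B_def field_simps)
        finally show "y \<in> ball x0 (rr i)" by simp
      qed
      let ?D = "{y \<in> V \<inter> ball x \<rho>. u y \<le> kk j - l}"
      have D: "?D = ball x \<rho> - A i"
        using sub rr(2)[of i] r unfolding kj A_def by (auto simp: subset_iff)
      have "\<omega> * \<rho> ^ ?N = measure lborel (ball x \<rho>)"
        using \<rho>0 by (simp add: measure_ball \<omega>_def)
      also have "\<dots> \<le> measure lborel (?D \<union> A i)"
        by (rule measure_mono_in_ball[where x = x0 and r = r]) (use D sub rr(2)[of i] r in \<open>auto simp: A_def\<close>)
      also have "\<dots> \<le> measure lborel ?D + measure lborel (A i)"
        by (rule measure_Un_le) (simp_all add: D)
      also have "\<dots> \<le> measure lborel ?D + \<omega> / 2 * \<rho> ^ ?N"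
        using small by (simp add: \<rho>_def j_def)
      finally show "\<omega> / 2 * \<rho> ^ ?N \<le> measure lborel ?D" by simp
    qed
    define X where "X = t powr p * r powr (- (p * s)) * B powr p"
    have X: "0 < X" using t r B by (simp add: X_def)
    have BQ: "(Q ^ j) powr (p * s) = B powr (- 2 * p)"
    proof -
      have "(Q ^ j) powr (p * s) = (Q powr (p * s)) ^ j" using Q by (intro powr_power_commute)
      also have "Q powr (p * s) = 4 powr (- p)" using s by (simp add: Q_def powr_powr)
      also have "(4::real) powr (- p) = 2 powr (- 2 * p)"
        using powr_powr[of 2 2 "- p"] by simp
      also have "(2 powr (- 2 * p)) ^ j = B powr (- 2 * p)"
        unfolding B_def by (rule powr_power_commute[symmetric]) simp
      finally show ?thesis .
    qed
    have "\<rho> powr (- q) * \<rho> ^ ?N = \<rho> powr (- (p * s))"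
    proof -
      have "\<rho> ^ ?N = \<rho> powr real ?N" using \<rho>0 by (simp add: powr_realpow)
      then show ?thesis by (simp add: powr_add[symmetric] q_def)
    qed
    also have "\<dots> = inverse (\<sigma> powr (p * s)) * B powr (2 * p) * r powr (- (p * s))"
      unfolding \<rho>_def powr_mult powr_minus BQ by (simp add: powr_minus mult_ac)
    finally have rho: "\<rho> powr (- q) * \<rho> ^ ?N = inverse (\<sigma> powr (p * s)) * B powr (2 * p) * r powr (- (p * s))" .
    have "h * l powr (p - 1) = t powr p / (8 * 4 powr (p - 1)) * B powr (- p)"
      using t B by (simp add: h_def l_def powr_divide powr_diff powr_minus powr_mult field_simps)
    then have lhs: "h * l powr (p - 1) * \<rho> powr (- q) * (\<omega> / 2 * \<rho> ^ ?N) = X * (\<omega> / (16 * 4 powr (p - 1)) * inverse (\<sigma> powr (p * s)))"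
    proof -
      assume hl': "h * l powr (p - 1) = t powr p / (8 * 4 powr (p - 1)) * B powr (- p)"
      have "h * l powr (p - 1) * \<rho> powr (- q) * (\<omega> / 2 * \<rho> ^ ?N) = (h * l powr (p - 1)) * (\<rho> powr (- q) * \<rho> ^ ?N) * (\<omega> / 2)"
        by simp
      also have "\<dots> = t powr p * r powr (- (p * s)) * (B powr (- p) * B powr (2 * p)) * (\<omega> / (16 * 4 powr (p - 1)) * inverse (\<sigma> powr (p * s)))"
        unfolding hl' rho by simp
      also have "B powr (- p) * B powr (2 * p) = B powr p" by (subst powr_add[symmetric]) simp
      finally show ?thesis by (simp add: X_def)
    qed
    have "r / (rr j - rr (Suc j)) = 16 * B" using r by (simp add: rr_def B_def field_simps)
    then have "(r / (rr j - rr (Suc j))) powr p + T1 \<le> B powr p * (16 powr p + T1)"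
      using T1 B p ge_one_powr_ge_zero[of B p] by (simp add: powr_mult distrib_left mult_le_cancel_right1)
    then have "L * t powr p * r powr (- (p * s)) * ((r / (rr j - rr (Suc j))) powr p + T1) \<le> L * t powr p * r powr (- (p * s)) * (B powr p * (16 powr p + T1))"
      using b.level_const_pos by (intro mult_left_mono) (auto simp: L_def)
    also have "\<dots> = X * (L * (16 powr p + T1))" by (simp add: X_def)
    finally have rhs: "L * t powr p * r powr (- (p * s)) * ((r / (rr j - rr (Suc j))) powr p + T1) \<le> X * (L * (16 powr p + T1))" .
    have "X * (\<omega> / (16 * 4 powr (p - 1)) * inverse (\<sigma> powr (p * s))) * measure lborel (A (Suc j)) \<le> X * (L * (16 powr p + T1)) * measure lborel (A j)"
      using main mult_right_mono[OF rhs, of "measure lborel (A j)"] unfolding lhs kj A_def by simp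
    then have "\<omega> / (16 * 4 powr (p - 1)) * inverse (\<sigma> powr (p * s)) * measure lborel (A (Suc j)) \<le> L * (16 powr p + T1) * measure lborel (A j)"
      unfolding mult.assoc[of X] by (simp only: mult_le_cancel_left_pos[OF X])
    then have "\<omega> * measure lborel (A (Suc j)) \<le> \<sigma> powr (p * s) * (16 * 4 powr (p - 1) * L * (16 powr p + T1)) * measure lborel (A j)"
      using \<sigma> by (simp add: field_simps)
    also have "\<dots> \<le> \<omega> * Q ^ ?N * measure lborel (A j)"
      by (intro mult_right_mono \<sigma>_small) simp
    finally show ?thesis using \<omega> by (simp add: j_def mult.assoc)
  qed
  have decay: "measure lborel (A i) \<le> \<omega> / 2 * (\<sigma> * Q ^ Suc i * r) ^ ?N \<and> measure lborel (A (Suc i)) \<le> \<omega> / 2 * (\<sigma> * Q ^ Suc (Suc i) * r) ^ ?N" for i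
  proof (induction i)
    case 0
    have "rr 0 = r / 4" "kk 0 = M - t / 2" by (simp_all add: rr_def kk_def)
    then have "A 0 = {x \<in> ball x0 (r / 4). M - t / 2 < u x}" by (simp only: A_def)
    then have a0: "measure lborel (A 0) \<le> \<omega> / 2 * (\<sigma> * Q\<^sup>2 * r) ^ ?N" using start by simp
    moreover have "\<omega> / 2 * (\<sigma> * Q\<^sup>2 * r) ^ ?N \<le> \<omega> / 2 * (\<sigma> * Q * r) ^ ?N"
      using \<omega> \<sigma> Q r by (intro mult_left_mono power_mono mult_right_mono) (auto simp: power2_eq_square mult_left_le)
    ultimately show ?case using A_mono[of 0] by (simp add: power2_eq_square)
  next
    case (Suc i)
    have "measure lborel (A (Suc (Suc i))) \<le> Q ^ ?N * measure lborel (A (Suc i))" using Suc by (intro step) simp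
    also have "\<dots> \<le> Q ^ ?N * (\<omega> / 2 * (\<sigma> * Q ^ Suc (Suc i) * r) ^ ?N)"
      using Suc Q by (intro mult_left_mono) auto
    also have "\<dots> = \<omega> / 2 * (\<sigma> * Q ^ Suc (Suc (Suc i)) * r) ^ ?N"
      by (simp add: power_mult_distrib)
    finally show ?case using Suc by simp
  qed
  let ?Z = "{x \<in> ball x0 (r / 8). M - t / 4 < u x}"
  have "measure lborel ?Z \<le> 0"
  proof (rule LIMSEQ_le_const)
    have "(\<lambda>i. Q ^ Suc i) \<longlonglongrightarrow> 0" using Q by (intro LIMSEQ_Suc LIMSEQ_power_zero) auto
    then have "(\<lambda>i. \<omega> / 2 * (\<sigma> * Q ^ Suc i * r) ^ ?N) \<longlonglongrightarrow> \<omega> / 2 * (\<sigma> * 0 * r) ^ ?N"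
      by (intro tendsto_intros)
    moreover have "\<omega> / 2 * (\<sigma> * 0 * r) ^ ?N = 0" by (simp add: power_0_left)
    ultimately show "(\<lambda>i. \<omega> / 2 * (\<sigma> * Q ^ Suc i * r) ^ ?N) \<longlonglongrightarrow> 0" by (simp only:)
    show "\<exists>N. \<forall>i\<ge>N. measure lborel ?Z \<le> \<omega> / 2 * (\<sigma> * Q ^ Suc i * r) ^ ?N"
    proof (intro exI allI impI)
      fix i
      have "measure lborel ?Z \<le> measure lborel (A i)"
        by (rule measure_mono_in_ball[where x = x0 and r = "rr i"]) (use rr(1)[of i] kk(2)[of i] in \<open>auto simp: A_def\<close>)
      then show "measure lborel ?Z \<le> \<omega> / 2 * (\<sigma> * Q ^ Suc i * r) ^ ?N" using decay[of i] by simp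
    qed
  qed
  then have "measure lborel ?Z = 0" by (simp add: antisym)
  moreover have "emeasure lborel ?Z < \<infinity>" by (rule emeasure_subset_ball_finite[of _ x0 "r / 8"]) auto
  ultimately have "emeasure lborel ?Z = 0" by (simp add: emeasure_eq_ennreal_measure)
  then have "AE x in lborel. x \<notin> ?Z" by (intro AE_not_in) (auto simp: null_sets_def)
  then show ?thesis by eventually_elim auto
qed

text \<open>One application of \<open>level_step\<close> at the level \<open>M - \<tau> H\<close>, which lies only \<open>\<tau> H\<close> below the supremum: the right side is
  of order \<open>(\<tau> H) powr p\<close>, while the left side contains \<open>\<tau> H * H powr (p - 1)\<close>, because half of the ball lies
  \<open>H\<close> below the supremum.\<close>

lemma measure_shrinking:
  fixes T1 \<tau> H M :: real
  defines "L \<equiv> barrier.level_const TYPE('a) p s \<Lambda>1 \<Lambda>2" and "\<omega> \<equiv> unit_ball_vol (real DIM('a))"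
  assumes T1: "0 \<le> T1" and \<tau>: "0 < \<tau>" "\<tau> \<le> 1 / 2" and H: "0 < H"
    and u_le: "AE x in lborel. x \<in> V \<longrightarrow> u x \<le> M"
    and half: "\<omega> / 2 * r ^ DIM('a) \<le> measure lborel {x \<in> V. u x \<le> M - H}"
    and tail_le: "tail_above (M - \<tau> * H) \<le> ennreal (T1 * (\<tau> * H) powr (p - 1) * r powr (- (p * s)))"
  shows "measure lborel {x \<in> ball x0 (r / 4). M - \<tau> * H / 2 < u x}
    \<le> 4 * 2 powr (p - 1) * 2 powr q * L * (4 powr p + T1) * \<tau> powr (p - 1) * r ^ DIM('a)"
proof -
  let ?N = "DIM('a)"
  have \<omega>: "0 < \<omega>" by (simp add: \<omega>_def)
  define t where "t = \<tau> * H"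
  have t: "0 < t" "t \<le> H / 2" using \<tau> H by (auto simp: t_def)
  interpret b: barrier p s \<Lambda>1 \<Lambda>2 K \<Omega> u x0 r "M - t" t "r / 4" "r / 2"
    by unfold_locales (use r t u_le in auto)
  have L: "0 < L" unfolding L_def by (rule b.level_const_pos)
  have main: "t / 2 * (H / 2) powr (p - 1) * (2 * r) powr (- q) * (\<omega> / 2 * r ^ ?N) * measure lborel {x \<in> ball x0 (r / 4). M - t + t / 2 < u x}
    \<le> L * t powr p * r powr (- (p * s)) * ((r / (r / 2 - r / 4)) powr p + T1) * measure lborel {x \<in> ball x0 (r / 2). M - t < u x}"
    unfolding L_def
  proof (rule b.level_step[OF _ T1])
    show "excess_energy q p u (M - t) x0 r
        \<le> ennreal (T1 * t powr (p - 1) * r powr (- (p * s)))"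
      using tail_le unfolding tail_above_def t_def .
    fix x assume x: "x \<in> ball x0 (r / 4)"
    have sub: "V \<subseteq> ball x (2 * r)"
    proof
      fix y assume "y \<in> V"
      then show "y \<in> ball x (2 * r)" using x r dist_triangle[of x y x0] by (auto simp: dist_commute)
    qed
    note half
    also have "measure lborel {x \<in> V. u x \<le> M - H} \<le> measure lborel {y \<in> V \<inter> ball x (2 * r). u y \<le> M - t - H / 2}"
    proof (rule measure_mono_in_ball[where x = x0 and r = r])
      have "{y \<in> V \<inter> ball x (2 * r). u y \<le> M - t - H / 2} = V \<inter> ball x (2 * r) \<inter> {y. u y \<le> M - t - H / 2}" by auto
      then show "{y \<in> V \<inter> ball x (2 * r). u y \<le> M - t - H / 2} \<in> sets borel" by simp
    qed (use sub t in auto)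
    finally show "\<omega> / 2 * r ^ ?N \<le> measure lborel {y \<in> V \<inter> ball x (2 * r). u y \<le> M - t - H / 2}" .
  qed (use t H r \<omega> in auto)
  define m where "m = measure lborel {x \<in> ball x0 (r / 4). M - t / 2 < u x}"
  have "measure lborel {x \<in> ball x0 (r / 2). M - t < u x} \<le> measure lborel V"
    by (rule measure_mono_in_ball[where x = x0 and r = r]) (use r in auto)
  also have "\<dots> = \<omega> * r ^ ?N" using r by (simp add: measure_ball \<omega>_def)
  finally have "L * t powr p * r powr (- (p * s)) * ((r / (r / 2 - r / 4)) powr p + T1) * measure lborel {x \<in> ball x0 (r / 2). M - t < u x}
    \<le> L * t powr p * r powr (- (p * s)) * ((r / (r / 2 - r / 4)) powr p + T1) * (\<omega> * r ^ ?N)"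
    using L T1 by (intro mult_left_mono) auto
  with main have "t / 2 * (H / 2) powr (p - 1) * (2 * r) powr (- q) * (\<omega> / 2 * r ^ ?N) * m
    \<le> L * t powr p * r powr (- (p * s)) * (4 powr p + T1) * (\<omega> * r ^ ?N)"
    using r by (simp add: m_def)
  moreover have "(2 * r) powr (- q) = r powr (- (p * s)) / (2 powr q * r ^ ?N)"
    using r by (simp add: powr_mult q_def powr_add powr_minus powr_realpow powr_diff field_simps)
  moreover have "t powr p = t * (\<tau> powr (p - 1) * H powr (p - 1))"
  proof -
    have "\<tau> powr (p - 1) * H powr (p - 1) = t powr (p - 1)" by (simp only: t_def powr_mult)
    then show ?thesis using t by (simp add: powr_diff)
  qed
  ultimately have "(t * r powr (- (p * s)) * \<omega> * r ^ ?N * H powr (p - 1)) * (m / (4 * 2 powr (p - 1) * 2 powr q * r ^ ?N))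
    \<le> (t * r powr (- (p * s)) * \<omega> * r ^ ?N * H powr (p - 1)) * (L * (4 powr p + T1) * \<tau> powr (p - 1))"
    using r by (simp add: powr_divide mult_ac)
  then have "m / (4 * 2 powr (p - 1) * 2 powr q * r ^ ?N) \<le> L * (4 powr p + T1) * \<tau> powr (p - 1)"
    using t r \<omega> H by (subst (asm) mult_le_cancel_left_pos) auto
  then show ?thesis using r unfolding m_def t_def by (simp add: field_simps)
qed

end

text \<open>The constant \<open>T1\<close> in the assumption on the exterior is fixed before \<open>\<tau>\<close> is chosen: first \<open>\<sigma>\<close> is taken small
  enough for \<open>de_giorgi\<close>, then \<open>\<tau>\<close> small enough for \<open>measure_shrinking\<close> to produce its starting condition.\<close>

lemma growth_lemma:
  fixes p s \<Lambda>1 \<Lambda>2 T1 :: real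
  assumes p: "1 < p" and s: "0 < s" and T1: "0 \<le> T1"
  obtains \<tau> where "0 < \<tau>" "\<tau> \<le> 1 / 2"
    "\<And>(K :: 'a::euclidean_space \<times> 'a \<Rightarrow> real) \<Omega> u x0 r M H.
      subsolution_ball p s \<Lambda>1 \<Lambda>2 K \<Omega> u x0 r \<Longrightarrow> 0 < H \<Longrightarrow>
      AE x in lborel. x \<in> ball x0 r \<longrightarrow> u x \<le> M \<Longrightarrow>
      measure lborel (ball x0 r) / 2 \<le> measure lborel {x \<in> ball x0 r. u x \<le> M - H} \<Longrightarrow>
      subsolution_ball.tail_above p s u x0 r (M - \<tau> * H) \<le> ennreal (T1 * (\<tau> * H) powr (p - 1) * r powr (- (p * s))) \<Longrightarrow>
      AE x in lborel. x \<in> ball x0 (r / 8) \<longrightarrow> u x \<le> M - \<tau> * H / 4"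
proof -
  let ?N = "DIM('a)"
  define \<omega> where "\<omega> = unit_ball_vol (real DIM('a))"
  define Q :: real where "Q = 4 powr (- 1 / s)"
  define L where "L = barrier.level_const TYPE('a) p s \<Lambda>1 \<Lambda>2"
  have \<omega>: "0 < \<omega>" by (simp add: \<omega>_def)
  have Q: "0 < Q" by (simp add: Q_def)
  have small: "\<exists>y::real. 0 < y \<and> y \<le> b \<and> y powr c * X \<le> e" if "0 < b" "0 < c" "0 < e" for b c X e :: real
  proof (intro exI conjI)
    let ?y = "min b ((e / (\<bar>X\<bar> + 1)) powr (1 / c))"
    show "0 < ?y" "?y \<le> b" using that by auto
    have "?y powr c * X \<le> ?y powr c * (\<bar>X\<bar> + 1)" by (intro mult_left_mono) auto
    also have "\<dots> \<le> ((e / (\<bar>X\<bar> + 1)) powr (1 / c)) powr c * (\<bar>X\<bar> + 1)"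
      using that by (intro mult_right_mono powr_mono2) auto
    also have "\<dots> = e" using that by (simp add: powr_powr)
    finally show "?y powr c * X \<le> e" .
  qed
  obtain \<sigma> where \<sigma>: "0 < \<sigma>" "\<sigma> \<le> 1 / 8" "\<sigma> powr (p * s) * (16 * 4 powr (p - 1) * L * (16 powr p + T1)) \<le> \<omega> * Q ^ ?N"
    using small[of "1 / 8" "p * s" "\<omega> * Q ^ ?N"] p s \<omega> Q by auto
  define \<epsilon> where "\<epsilon> = \<omega> / 2 * (\<sigma> * Q\<^sup>2) ^ ?N"
  have \<epsilon>: "0 < \<epsilon>" using \<omega> \<sigma> Q by (simp add: \<epsilon>_def)
  define q where "q = real ?N + p * s"
  obtain \<tau> where \<tau>: "0 < \<tau>" "\<tau> \<le> 1 / 2" "\<tau> powr (p - 1) * (4 * 2 powr (p - 1) * 2 powr q * L * (4 powr p + T1)) \<le> \<epsilon>"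
    using small[of "1 / 2" "p - 1" \<epsilon>] p \<epsilon> by auto
  show ?thesis
  proof (rule that[OF \<tau>(1,2)])
    fix K :: "'a \<times> 'a \<Rightarrow> real" and \<Omega> u x0 r M H
    assume sb: "subsolution_ball p s \<Lambda>1 \<Lambda>2 K \<Omega> u x0 r" and H: "0 < H"
      and u_le: "AE x in lborel. x \<in> ball x0 r \<longrightarrow> u x \<le> M"
      and half: "measure lborel (ball x0 r) / 2 \<le> measure lborel {x \<in> ball x0 r. u x \<le> M - H}"
      and tail_le: "subsolution_ball.tail_above p s u x0 r (M - \<tau> * H) \<le> ennreal (T1 * (\<tau> * H) powr (p - 1) * r powr (- (p * s)))"
    interpret subsolution_ball p s \<Lambda>1 \<Lambda>2 K \<Omega> u x0 r by (rule sb)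
    have qq: "q = subsolution_ball.q TYPE('a) p s" by (simp add: \<open>q = real ?N + p * s\<close> q_def)
    show "AE x in lborel. x \<in> ball x0 (r / 8) \<longrightarrow> u x \<le> M - \<tau> * H / 4"
    proof (rule de_giorgi[OF T1 \<sigma>(1,2) _ _ u_le tail_le])
      show "\<sigma> powr (p * s) * (16 * 4 powr (p - 1) * barrier.level_const TYPE('a) p s \<Lambda>1 \<Lambda>2 * (16 powr p + T1))
        \<le> unit_ball_vol (real DIM('a)) * (4 powr (- 1 / s)) ^ ?N"
        using \<sigma>(3) unfolding L_def \<omega>_def Q_def .
      show "0 < \<tau> * H" using \<tau> H by simp
      have "measure lborel {x \<in> ball x0 (r / 4). M - \<tau> * H / 2 < u x}
        \<le> 4 * 2 powr (p - 1) * 2 powr q * L * (4 powr p + T1) * \<tau> powr (p - 1) * r ^ ?N"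
        unfolding L_def qq using half r
        by (intro measure_shrinking[OF T1 \<tau>(1,2) H u_le _ tail_le]) (simp add: measure_ball)
      also have "\<dots> \<le> \<epsilon> * r ^ ?N"
        using \<tau>(3) r by (intro mult_right_mono) (auto simp: mult_ac)
      also have "\<dots> = \<omega> / 2 * (\<sigma> * Q\<^sup>2 * r) ^ ?N" by (simp add: \<epsilon>_def power_mult_distrib)
      finally show "measure lborel {x \<in> ball x0 (r / 4). M - \<tau> * H / 2 < u x} \<le> unit_ball_vol (real DIM('a)) / 2 * (\<sigma> * (4 powr (- 1 / s))\<^sup>2 * r) ^ ?N"
        unfolding \<omega>_def Q_def .
    qed
  qed
qed

section \<open>Decay of oscillation\<close>

lemma powr_minus_one_le:
  fixes x \<alpha> \<beta> :: real
  assumes "1 \<le> x" "0 < \<alpha>" "\<alpha> \<le> \<beta>"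
  shows "x powr \<alpha> - 1 \<le> \<alpha> / \<beta> * x powr \<beta>"
proof -
  define \<theta> where "\<theta> = \<alpha> / \<beta>"
  have \<theta>: "0 < \<theta>" "\<theta> \<le> 1" using assms by (auto simp: \<theta>_def)
  have "(x powr \<beta>) powr \<theta> * 1 powr (1 - \<theta>) \<le> \<theta> * x powr \<beta> + (1 - \<theta>) * 1"
    using assms \<theta> by (intro Youngs_inequality_0) auto
  moreover have "(x powr \<beta>) powr \<theta> = x powr \<alpha>" using assms by (simp add: powr_powr \<theta>_def)
  ultimately have "x powr \<alpha> - 1 \<le> \<theta> * x powr \<beta> - \<theta>" by simp
  then show ?thesis using \<theta> unfolding \<theta>_def by linarith
qed

definition tail_const :: "'a::euclidean_space itself \<Rightarrow> real \<Rightarrow> real \<Rightarrow> real" where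
  "tail_const T p s = 2 powr (p - 1) * (3 powr (p - 1) * 8 powr (p * s / 2) * kernel_const T (p * s / 2) + 1)"

text \<open>Let \<open>t = |y - x0| / r\<close> with \<open>r = R / 8 ^ j\<close>.  In the annuli between \<open>r\<close> and \<open>R\<close> the bounds \<open>b i\<close> of the
  larger balls give \<open>u y - b j \<le> 2 H j ((8 t) powr \<alpha> - 1)\<close>, and as \<open>\<alpha> \<le> \<beta> \<tau>\<close> this is at most
  \<open>2 \<tau> H j (8 t) powr \<beta>\<close>: a small constant at the expense of a larger, fixed growth \<open>\<beta>\<close>, which is still
  integrable against the kernel.  Beyond \<open>R\<close> one has \<open>S \<le> \<tau> H j t powr \<alpha>\<close> by the choice \<open>H 0 = S / \<tau>\<close>.  All
  constants are independent of \<open>\<tau>\<close>, as \<open>growth_lemma\<close> requires.\<close>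

lemma tail_control:
  fixes u :: "'a::euclidean_space \<Rightarrow> real" and p s R S \<tau> \<alpha> \<beta> :: real and b :: "nat \<Rightarrow> real" and j :: nat
  defines "q \<equiv> real DIM('a) + p * s" and "\<beta> \<equiv> p * s / (2 * (p - 1))"
  defines "H \<equiv> (\<lambda>i. S / \<tau> * 8 powr (- (\<alpha> * real i)))"
  assumes p: "1 < p" and s: "0 < s" and u[measurable]: "u \<in> borel_measurable borel"
    and R: "0 < R" and S: "0 < S" and \<tau>: "0 < \<tau>" "\<tau> \<le> 1" and \<alpha>: "0 < \<alpha>" "\<alpha> \<le> \<beta> * \<tau>"
    and uS: "AE x in lborel. x \<in> ball x0 R \<longrightarrow> \<bar>u x\<bar> \<le> S"
    and tail: "tail_energy q p u x0 R
      \<le> ennreal (S powr (p - 1) * R powr (- (p * s)))"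
    and ub: "\<And>i. i \<le> j \<Longrightarrow> AE x in lborel. x \<in> ball x0 (R / 8 ^ i) \<longrightarrow> u x \<le> b i"
    and nested: "\<And>i. i \<le> j \<Longrightarrow> b i - b j \<le> 2 * (H i - H j)"
  shows "excess_energy q p u (b j - \<tau> * H j) x0 (R / 8 ^ j)
    \<le> ennreal (tail_const TYPE('a) p s * (\<tau> * H j) powr (p - 1) * (R / 8 ^ j) powr (- (p * s)))"
proof -
  define r where "r = R / 8 ^ j"
  have r: "0 < r" "r \<le> R" using R by (auto simp: r_def field_simps)
  have \<beta>: "0 < \<beta>" using p s by (simp add: \<beta>_def)
  have \<beta>p: "\<beta> * (p - 1) = p * s / 2"
  proof -
    have "\<beta> = p * s / 2 / (p - 1)" by (simp add: \<beta>_def)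
    then show ?thesis using p by (simp only: nonzero_eq_divide_eq)
  qed
  have \<alpha>\<beta>: "\<alpha> \<le> \<beta>" "\<alpha> / \<beta> \<le> \<tau>"
  proof -
    have "\<beta> * \<tau> \<le> \<beta> * 1" using \<tau> \<beta> by (intro mult_left_mono) auto
    then show "\<alpha> \<le> \<beta>" using \<alpha> by linarith
    show "\<alpha> / \<beta> \<le> \<tau>" using \<alpha> \<beta> by (simp add: pos_divide_le_eq mult.commute)
  qed
  have H0: "0 < H i" for i using S \<tau> by (simp add: H_def)
  have H_scale: "H i = H j * (8 ^ (j - i)) powr \<alpha>" if "i \<le> j" for i
  proof -
    have "H j * (8 ^ (j - i)) powr \<alpha> = S / \<tau> * (8 powr (- (\<alpha> * real j)) * 8 powr (\<alpha> * real (j - i)))"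
      by (simp add: H_def powr_realpow[symmetric] powr_powr mult.commute)
    also have "8 powr (- (\<alpha> * real j)) * 8 powr (\<alpha> * real (j - i)) = 8 powr (- (\<alpha> * real i))"
      using that by (subst powr_add[symmetric]) (simp add: of_nat_diff algebra_simps)
    finally have "H j * (8 ^ (j - i)) powr \<alpha> = S / \<tau> * 8 powr (- (\<alpha> * real i))" .
    moreover have "H i = S / \<tau> * 8 powr (- (\<alpha> * real i))" by (simp add: H_def)
    ultimately show ?thesis by (simp only:)
  qed
  have Rr: "R = 8 ^ j * r" by (simp add: r_def)
  have S_eq: "S = \<tau> * H j * (R / r) powr \<alpha>"
    using H_scale[of 0] \<tau> r(1) by (simp add: H_def Rr)
  have bS: "- S \<le> b j"
  proof (rule ccontr)
    assume "\<not> - S \<le> b j"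
    have "AE x in lborel. x \<notin> ball x0 r"
      using ub[OF order_refl, folded r_def] uS
      by eventually_elim (use \<open>\<not> - S \<le> b j\<close> r(2) in auto)
    then have "emeasure lborel (ball x0 r) = 0"
      by (subst (asm) AE_iff_measurable[of "ball x0 r"]) auto
    then show False using r(1) content_ball_gt_0_iff[of x0 r] by (simp add: measure_def)
  qed
  have "AE y in lborel. \<forall>i\<in>{..j}. y \<in> ball x0 (R / 8 ^ i) \<longrightarrow> u y \<le> b i"
    using ub by (intro AE_finite_allI) auto
  then have pointwise: "AE y in lborel. y \<notin> ball x0 r \<longrightarrow>
      max 0 (u y - (b j - \<tau> * H j)) \<le> 3 * \<tau> * H j * (8 * (norm (y - x0) / r)) powr \<beta> + \<bar>u y\<bar> * indicator (- ball x0 R) y"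
  proof eventually_elim
    case (elim y)
    show ?case
    proof
      assume y: "y \<notin> ball x0 r"
      define t where "t = norm (y - x0) / r"
      have t: "1 \<le> t" using y r by (auto simp: t_def dist_norm norm_minus_commute)
      define X where "X = (8 * t) powr \<beta>"
      have X: "1 \<le> X" unfolding X_def using t \<beta> by (intro ge_one_powr_ge_zero) auto
      have HX: "\<tau> * H j \<le> \<tau> * H j * X" using H0[of j] \<tau> X by simp
      show "max 0 (u y - (b j - \<tau> * H j)) \<le> 3 * \<tau> * H j * (8 * (norm (y - x0) / r)) powr \<beta> + \<bar>u y\<bar> * indicator (- ball x0 R) y"
      proof (cases "y \<in> ball x0 R")
        case True
        \<comment> \<open>\<open>y\<close> lies in the ball number \<open>j - l - 1\<close>, whose radius is at most \<open>8 |y - x0|\<close>\<close>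
        obtain l where l: "8 ^ l \<le> t" "t < 8 ^ Suc l" using geometric_scale[of 8 t] t by auto
        have "norm (y - x0) < 8 ^ j * r" using True Rr by (simp add: dist_norm norm_minus_commute)
        then have "t < 8 ^ j" using r by (simp add: t_def pos_divide_less_eq)
        then have "(8::real) ^ l < 8 ^ j" using l by linarith
        then have lj: "l < j" by (simp add: power_strict_increasing_iff)
        define i where "i = j - Suc l"
        have i: "i \<le> j" "j - i = Suc l" using lj by (auto simp: i_def)
        have "R / 8 ^ i = 8 ^ Suc l * r"
        proof -
          have "j = i + Suc l" using i by simp
          then have "(8::real) ^ j = 8 ^ i * 8 ^ Suc l" by (simp only: power_add)
          then show ?thesis by (simp add: Rr)
        qed
        moreover have "norm (y - x0) < 8 ^ Suc l * r" using l(2) r by (simp add: t_def pos_divide_less_eq)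
        ultimately have "y \<in> ball x0 (R / 8 ^ i)" by (simp add: dist_norm norm_minus_commute)
        then have "u y \<le> b i" using elim i by auto
        then have "u y - b j \<le> 2 * (H i - H j)" using nested[OF i(1)] by linarith
        also have "H i \<le> H j * (8 * t) powr \<alpha>"
          unfolding H_scale[OF i(1)] i(2) using l(1) H0[of j] \<alpha> by (intro mult_left_mono powr_mono2) auto
        also have "2 * (H j * (8 * t) powr \<alpha> - H j) = 2 * H j * ((8 * t) powr \<alpha> - 1)" by (simp add: algebra_simps)
        also have "\<dots> \<le> 2 * H j * (\<alpha> / \<beta> * X)"
          unfolding X_def using t \<alpha> \<alpha>\<beta> H0[of j] by (intro mult_left_mono powr_minus_one_le) auto
        also have "\<dots> \<le> 2 * H j * (\<tau> * X)"
          using \<alpha>\<beta> X H0[of j] by (intro mult_left_mono mult_right_mono) auto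
        finally have "u y - b j \<le> 2 * (\<tau> * H j * X)" by (simp add: mult_ac)
        then have "u y - (b j - \<tau> * H j) \<le> 3 * \<tau> * H j * X" using HX by linarith
        moreover have "0 \<le> 3 * \<tau> * H j * X" using HX H0[of j] \<tau> X by simp
        ultimately show ?thesis using True by (simp add: X_def t_def)
      next
        case False
        have "R / r \<le> t" using False r(1) by (auto simp: t_def dist_norm norm_minus_commute divide_right_mono)
        then have "(R / r) powr \<alpha> \<le> (8 * t) powr \<alpha>" using r R \<alpha> t by (intro powr_mono2) auto
        also have "\<dots> \<le> X" unfolding X_def using t \<alpha>\<beta> by (intro powr_mono) auto
        finally have "S \<le> \<tau> * H j * X"
          by (subst S_eq) (use H0[of j] \<tau> in \<open>auto intro: mult_left_mono\<close>)
        then have "u y - (b j - \<tau> * H j) \<le> \<bar>u y\<bar> + 3 * \<tau> * H j * X" 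
        proof -
          have "0 < \<tau> * H j" using H0[of j] \<tau> by simp
          moreover have "3 * \<tau> * H j * X = 3 * (\<tau> * H j * X)" by simp
          ultimately show ?thesis using HX bS \<open>S \<le> \<tau> * H j * X\<close> abs_ge_self[of "u y"] by linarith
        qed
        moreover have "0 \<le> \<bar>u y\<bar> + 3 * \<tau> * H j * X" using HX H0[of j] \<tau> X by simp
        ultimately show ?thesis using False by (simp add: X_def t_def)
      qed
    qed
  qed
  let ?c = "2 powr (p - 1) * ((3 * \<tau> * H j) powr (p - 1) * 8 powr (p * s / 2) * r powr (- (p * s / 2)))"
  have c0: "0 \<le> ?c" by simp
  have "excess_energy q p u (b j - \<tau> * H j) x0 r
    \<le> (\<integral>\<^sup>+y. ennreal ?c * (ennreal (norm (y - x0) powr (- (real DIM('a) + p * s / 2))) * indicator (- ball x0 r) y)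
        + ennreal (2 powr (p - 1)) * (ennreal (\<bar>u y\<bar> powr (p - 1) * norm (y - x0) powr (- q)) * indicator (- ball x0 R) y) \<partial>lborel)"
  proof (rule nn_integral_mono_AE, use pointwise in eventually_elim)
    fix y
    assume pw: "y \<notin> ball x0 r \<longrightarrow>
      max 0 (u y - (b j - \<tau> * H j)) \<le> 3 * \<tau> * H j * (8 * (norm (y - x0) / r)) powr \<beta> + \<bar>u y\<bar> * indicator (- ball x0 R) y"
    show "ennreal (max 0 (u y - (b j - \<tau> * H j)) powr (p - 1) * norm (y - x0) powr (- q)) * indicator (- ball x0 r) y
      \<le> ennreal ?c * (ennreal (norm (y - x0) powr (- (real DIM('a) + p * s / 2))) * indicator (- ball x0 r) y)
        + ennreal (2 powr (p - 1)) * (ennreal (\<bar>u y\<bar> powr (p - 1) * norm (y - x0) powr (- q)) * indicator (- ball x0 R) y)"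
    proof (cases "y \<in> ball x0 r")
      case False
      define n where "n = norm (y - x0)"
      have n: "0 < n" using False r by (auto simp: n_def dist_norm norm_minus_commute)
      let ?i = "indicator (- ball x0 R) y :: real"
      have "max 0 (u y - (b j - \<tau> * H j)) powr (p - 1) \<le> (3 * \<tau> * H j * (8 * (n / r)) powr \<beta> + \<bar>u y\<bar> * ?i) powr (p - 1)"
        using pw False p by (intro powr_mono2) (auto simp: n_def)
      also have "\<dots> \<le> 2 powr (p - 1) * ((3 * \<tau> * H j * (8 * (n / r)) powr \<beta>) powr (p - 1) + (\<bar>u y\<bar> * ?i) powr (p - 1))"
        using H0[of j] \<tau> p by (intro powr_add_le) auto
      also have "(\<bar>u y\<bar> * ?i) powr (p - 1) = \<bar>u y\<bar> powr (p - 1) * ?i" by (simp add: indicator_def)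
      also have "(3 * \<tau> * H j * (8 * (n / r)) powr \<beta>) powr (p - 1) = (3 * \<tau> * H j) powr (p - 1) * (8 powr (p * s / 2) * (n powr (p * s / 2) * r powr (- (p * s / 2))))"
      proof -
        show ?thesis
          by (simp only: powr_mult powr_powr \<beta>p powr_divide powr_minus) (simp only: divide_inverse mult.assoc)
      qed
      finally have "max 0 (u y - (b j - \<tau> * H j)) powr (p - 1) * n powr (- q)
        \<le> 2 powr (p - 1) * ((3 * \<tau> * H j) powr (p - 1) * (8 powr (p * s / 2) * (n powr (p * s / 2) * r powr (- (p * s / 2)))) + \<bar>u y\<bar> powr (p - 1) * ?i) * n powr (- q)"
        by (intro mult_right_mono) auto
      also have "\<dots> = ?c * (n powr (p * s / 2) * n powr (- q)) + 2 powr (p - 1) * (\<bar>u y\<bar> powr (p - 1) * n powr (- q)) * ?i"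
        by (simp add: algebra_simps)
      also have "n powr (p * s / 2) * n powr (- q) = n powr (- (real DIM('a) + p * s / 2))"
      proof -
        have "p * s / 2 + - q = - (real DIM('a) + p * s / 2)" by (simp add: q_def)
        then show ?thesis by (simp only: powr_add[symmetric])
      qed
      finally have "ennreal (max 0 (u y - (b j - \<tau> * H j)) powr (p - 1) * n powr (- q))
        \<le> ennreal (?c * n powr (- (real DIM('a) + p * s / 2)) + 2 powr (p - 1) * (\<bar>u y\<bar> powr (p - 1) * n powr (- q)) * ?i)"
        by (rule ennreal_leI)
      also have "\<dots> = ennreal (?c * n powr (- (real DIM('a) + p * s / 2))) + ennreal (2 powr (p - 1) * (\<bar>u y\<bar> powr (p - 1) * n powr (- q)) * ?i)"
        by (rule ennreal_plus) auto
      also have "ennreal (2 powr (p - 1) * (\<bar>u y\<bar> powr (p - 1) * n powr (- q)) * ?i) = ennreal (2 powr (p - 1)) * (ennreal (\<bar>u y\<bar> powr (p - 1) * n powr (- q)) * indicator (- ball x0 R) y)"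
        by (simp add: indicator_def ennreal_mult')
      also have "ennreal (?c * n powr (- (real DIM('a) + p * s / 2))) = ennreal ?c * ennreal (n powr (- (real DIM('a) + p * s / 2)))"
        by (rule ennreal_mult'[OF c0])
      finally show ?thesis using False by (simp add: n_def)
    qed simp
  qed
  also have "\<dots> = ennreal ?c * (\<integral>\<^sup>+y. ennreal (norm (y - x0) powr (- (real DIM('a) + p * s / 2))) * indicator (- ball x0 r) y \<partial>lborel)
      + ennreal (2 powr (p - 1)) * tail_energy q p u x0 R"
  proof -
    have m1: "(\<lambda>y. ennreal (norm (y - x0) powr (- (real DIM('a) + p * s / 2))) * indicator (- ball x0 r) y) \<in> borel_measurable lborel"
      by measurable
    have m2: "(\<lambda>y. ennreal (\<bar>u y\<bar> powr (p - 1) * norm (y - x0) powr (- q)) * indicator (- ball x0 R) y) \<in> borel_measurable lborel"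
      by measurable
    show ?thesis
      unfolding nn_integral_cmult[OF m1, symmetric] nn_integral_cmult[OF m2, symmetric]
      by (rule nn_integral_add; rule borel_measurable_times_ennreal, rule borel_measurable_const, rule m1 m2)
  qed
  also have "\<dots> \<le> ennreal ?c * ennreal (kernel_const TYPE('a) (p * s / 2) * r powr (- (p * s / 2)))
      + ennreal (2 powr (p - 1)) * ennreal ((\<tau> * H j) powr (p - 1) * r powr (- (p * s)))"
  proof (intro add_mono mult_left_mono kernel_far_integral r order_trans[OF tail] ennreal_leI)
    have "S powr (p - 1) * R powr (- (p * s)) = (\<tau> * H j) powr (p - 1) * ((R / r) powr (\<alpha> * (p - 1)) * R powr (- (p * s)))"
      by (subst S_eq) (simp add: powr_mult powr_powr)
    also have "\<dots> \<le> (\<tau> * H j) powr (p - 1) * ((R / r) powr (p * s) * R powr (- (p * s)))"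
    proof (intro mult_left_mono mult_right_mono powr_mono)
      have "\<alpha> * (p - 1) \<le> \<beta> * (p - 1)" using \<alpha>\<beta> p by (intro mult_right_mono) auto
      also have "\<beta> * (p - 1) = p * s / 2" by (rule \<beta>p)
      also have "\<dots> \<le> p * s" using p s by simp
      finally show "\<alpha> * (p - 1) \<le> p * s" .
      show "1 \<le> R / r" using r by simp
    qed auto
    also have "(R / r) powr (p * s) * R powr (- (p * s)) = r powr (- (p * s))"
      using r R by (simp add: powr_divide powr_minus field_simps)
    finally show "S powr (p - 1) * R powr (- (p * s)) \<le> (\<tau> * H j) powr (p - 1) * r powr (- (p * s))" .
  qed (use p s in auto)
  also have "\<dots> = ennreal (?c * (kernel_const TYPE('a) (p * s / 2) * r powr (- (p * s / 2))) + 2 powr (p - 1) * ((\<tau> * H j) powr (p - 1) * r powr (- (p * s))))"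
  proof -
    have "0 < kernel_const TYPE('a) (p * s / 2)" using p s by (intro kernel_const_pos) simp
    then show ?thesis by (simp add: ennreal_mult'[symmetric] ennreal_plus[symmetric] del: ennreal_plus)
  qed
  also have "?c * (kernel_const TYPE('a) (p * s / 2) * r powr (- (p * s / 2))) + 2 powr (p - 1) * ((\<tau> * H j) powr (p - 1) * r powr (- (p * s)))
    = tail_const TYPE('a) p s * (\<tau> * H j) powr (p - 1) * r powr (- (p * s))"
  proof -
    have "r powr (- (p * s / 2)) * r powr (- (p * s / 2)) = r powr (- (p * s))" by (subst powr_add[symmetric]) simp
    then have "?c * (kernel_const TYPE('a) (p * s / 2) * r powr (- (p * s / 2)))
      = 2 powr (p - 1) * ((3 * (\<tau> * H j)) powr (p - 1) * 8 powr (p * s / 2) * kernel_const TYPE('a) (p * s / 2)) * r powr (- (p * s))"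
      by (simp add: mult_ac)
    then show ?thesis unfolding tail_const_def powr_mult by (simp add: algebra_simps)
  qed
  finally show ?thesis unfolding r_def .
qed

lemma subsolution_ballI:
  assumes "1 < p" "0 < s" "s < 1" "0 < \<Lambda>1" "\<Lambda>1 \<le> \<Lambda>2" "borel_subsolution p s \<Lambda>1 \<Lambda>2 K \<Omega> u" "0 < r" "cball x0 r \<subseteq> \<Omega>"
  shows "subsolution_ball p s \<Lambda>1 \<Lambda>2 K \<Omega> u x0 r"
  using assms by unfold_locales auto

text \<open>Intervals \<open>[a j, a j + 2 H j]\<close> that contain the values of \<open>u\<close> in the ball of radius \<open>R / 8 ^ j\<close> are constructed
  recursively.  The next interval is cut off at the top if the upper bound permits it; otherwise \<open>growth_lemma\<close>
  for \<open>u\<close> cannot have been applicable, so \<open>- u\<close> satisfies the half-ball condition and the next interval is cut off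
  at the bottom.\<close>

theorem oscillation_decay:
  fixes p s \<Lambda>1 \<Lambda>2 :: real
  assumes p: "1 < p" and s: "0 < s" "s < 1" and \<Lambda>: "0 < \<Lambda>1" "\<Lambda>1 \<le> \<Lambda>2"
  obtains \<alpha> C where "0 < \<alpha>" "\<alpha> < 1" "0 < C"
    "\<And>(K :: 'a::euclidean_space \<times> 'a \<Rightarrow> real) \<Omega> u x0 R S.
      borel_subsolution p s \<Lambda>1 \<Lambda>2 K \<Omega> u \<Longrightarrow> borel_subsolution p s \<Lambda>1 \<Lambda>2 K \<Omega> (\<lambda>x. - u x) \<Longrightarrow>
      0 < R \<Longrightarrow> cball x0 R \<subseteq> \<Omega> \<Longrightarrow> 0 < S \<Longrightarrow> AE x in lborel. x \<in> ball x0 R \<longrightarrow> \<bar>u x\<bar> \<le> S \<Longrightarrow>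
      tail_energy (real DIM('a) + p * s) p u x0 R
        \<le> ennreal (S powr (p - 1) * R powr (- (p * s))) \<Longrightarrow>
      \<exists>c. \<forall>r. 0 < r \<and> r \<le> R \<longrightarrow> (AE x in lborel. x \<in> ball x0 r \<longrightarrow> \<bar>u x - c\<bar> \<le> C * S * (r / R) powr \<alpha>)"
proof -
  define T1 where "T1 = tail_const TYPE('a) p s"
  have T1: "0 \<le> T1"
  proof -
    have "0 < kernel_const TYPE('a) (p * s / 2)" using p s by (intro kernel_const_pos) simp
    then show ?thesis by (simp add: T1_def tail_const_def)
  qed
  obtain \<tau> where \<tau>: "0 < \<tau>" "\<tau> \<le> 1 / 2" and growth:
    "\<And>(K :: 'a \<times> 'a \<Rightarrow> real) \<Omega> u x0 r M H.
      subsolution_ball p s \<Lambda>1 \<Lambda>2 K \<Omega> u x0 r \<Longrightarrow> 0 < H \<Longrightarrow>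
      AE x in lborel. x \<in> ball x0 r \<longrightarrow> u x \<le> M \<Longrightarrow>
      measure lborel (ball x0 r) / 2 \<le> measure lborel {x \<in> ball x0 r. u x \<le> M - H} \<Longrightarrow>
      subsolution_ball.tail_above p s u x0 r (M - \<tau> * H) \<le> ennreal (T1 * (\<tau> * H) powr (p - 1) * r powr (- (p * s))) \<Longrightarrow>
      AE x in lborel. x \<in> ball x0 (r / 8) \<longrightarrow> u x \<le> M - \<tau> * H / 4"
    by (rule growth_lemma[OF p s(1) T1, where 'a = 'a and ?\<Lambda>1.0 = \<Lambda>1 and ?\<Lambda>2.0 = \<Lambda>2]) (rule that)
  define \<beta> where "\<beta> = p * s / (2 * (p - 1))"
  have \<beta>: "0 < \<beta>" using p s by (simp add: \<beta>_def)
  \<comment> \<open>the second bound serves \<open>tail_control\<close>; the third gives \<open>contraction\<close>, as \<open>ln 8 \<le> 7\<close>\<close>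
  define \<alpha> where "\<alpha> = min (1 / 2) (min (\<beta> * \<tau>) (\<tau> / 56))"
  have \<alpha>: "0 < \<alpha>" "\<alpha> \<le> 1 / 2" "\<alpha> \<le> \<beta> * \<tau>" "\<alpha> \<le> \<tau> / 56" using \<beta> \<tau> by (auto simp: \<alpha>_def)
  have contraction: "1 - \<tau> / 8 \<le> 8 powr (- \<alpha>)"
  proof -
    have "ln (8::real) \<le> 7" using ln_le_minus_one[of "8::real"] by simp
    then have "\<alpha> * ln 8 \<le> \<tau> / 56 * 7" using \<alpha> by (intro mult_mono) auto
    then have "1 - \<tau> / 8 \<le> 1 + (- \<alpha> * ln 8)" by simp
    also have "\<dots> \<le> exp (- \<alpha> * ln 8)" by (rule exp_ge_add_one_self)
    finally show ?thesis by (simp add: powr_def)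
  qed
  show ?thesis
  proof (rule that[of \<alpha> "16 / \<tau>"])
    show "0 < \<alpha>" "\<alpha> < 1" "0 < 16 / \<tau>" using \<alpha> \<tau> by auto
    fix K :: "'a \<times> 'a \<Rightarrow> real" and \<Omega> u x0 R S
    assume sub: "borel_subsolution p s \<Lambda>1 \<Lambda>2 K \<Omega> u" and sub': "borel_subsolution p s \<Lambda>1 \<Lambda>2 K \<Omega> (\<lambda>x. - u x)"
      and R: "0 < R" and ball: "cball x0 R \<subseteq> \<Omega>" and S: "0 < S" and uS: "AE x in lborel. x \<in> ball x0 R \<longrightarrow> \<bar>u x\<bar> \<le> S"
      and tail: "tail_energy (real DIM('a) + p * s) p u x0 R
        \<le> ennreal (S powr (p - 1) * R powr (- (p * s)))"
    have um[measurable]: "u \<in> borel_measurable borel" using sub by (simp add: borel_subsolution_def)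
    define H where "H i = S / \<tau> * 8 powr (- (\<alpha> * real i))" for i :: nat
    have H0: "0 < H i" for i using S \<tau> by (simp add: H_def)
    have HSuc: "H i * (1 - \<tau> / 8) \<le> H (Suc i)" "H (Suc i) \<le> H i" for i
    proof -
      have e: "H (Suc i) = H i * 8 powr (- \<alpha>)"
        by (simp add: H_def powr_add[symmetric] algebra_simps)
      show "H i * (1 - \<tau> / 8) \<le> H (Suc i)" unfolding e using contraction H0[of i] by (intro mult_left_mono) auto
      have "8 powr (- \<alpha>) \<le> (1::real)"
        using \<alpha> ge_one_powr_ge_zero[of 8 \<alpha>] by (simp add: powr_minus field_simps)
      then show "H (Suc i) \<le> H i" unfolding e using H0[of i] by simp
    qed
    \<comment> \<open>the test in the recursion is whether the upper bound already holds in the smaller ball\<close>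
    define a where "a = rec_nat (- H 0) (\<lambda>j x. if AE y in lborel. y \<in> ball x0 (R / 8 ^ Suc j) \<longrightarrow> u y \<le> x + 2 * H (Suc j)
       then x else x + 2 * H j - 2 * H (Suc j))"
    have a_0: "a 0 = - H 0" by (simp add: a_def)
    have a_Suc: "a (Suc j) = (if AE y in lborel. y \<in> ball x0 (R / 8 ^ Suc j) \<longrightarrow> u y \<le> a j + 2 * H (Suc j)
       then a j else a j + 2 * H j - 2 * H (Suc j))" for j by (simp add: a_def)
    have nest1: "a j \<le> a (Suc j)" "a (Suc j) + 2 * H (Suc j) \<le> a j + 2 * H j" for j
      using HSuc(2)[of j] by (auto simp: a_Suc)
    have nest: "a i \<le> a j" "a j + 2 * H j \<le> a i + 2 * H i" if "i \<le> j" for i j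
      using that lift_Suc_mono_le[of a i j] lift_Suc_antimono_le[of "\<lambda>j. a j + 2 * H j" i j] nest1 by auto
    have main: "AE y in lborel. y \<in> ball x0 (R / 8 ^ j) \<longrightarrow> a j \<le> u y \<and> u y \<le> a j + 2 * H j" for j
    proof (induction j rule: less_induct)
      case (less n)
      show ?case
      proof (cases n)
        case 0
        have "S \<le> H 0" using S \<tau> by (simp add: H_def field_simps)
        then show ?thesis using uS unfolding 0 a_0 by (auto elim!: eventually_mono)
      next
        case (Suc j)
        define r where "r = R / 8 ^ j"
        have r: "0 < r" "r \<le> R" using R by (auto simp: r_def field_simps)
        have r8: "R / 8 ^ Suc j = r / 8" by (simp add: r_def)
        have IH: "AE y in lborel. y \<in> ball x0 (R / 8 ^ i) \<longrightarrow> a i \<le> u y \<and> u y \<le> a i + 2 * H i" if "i \<le> j" for i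
          using less that Suc by simp
        have small: "AE y in lborel. y \<in> ball x0 (r / 8) \<longrightarrow> a j \<le> u y \<and> u y \<le> a j + 2 * H j"
          using IH[OF order_refl] r by (auto simp: r_def[symmetric] elim!: eventually_mono)
        have cb: "cball x0 r \<subseteq> \<Omega>" using ball r by auto
        have \<tau>1: "\<tau> \<le> 1" using \<tau> by simp
        show ?thesis
        proof (cases "AE y in lborel. y \<in> ball x0 (R / 8 ^ Suc j) \<longrightarrow> u y \<le> a j + 2 * H (Suc j)")
          case True
          then have aS: "a (Suc j) = a j" by (simp add: a_Suc)
          show ?thesis using True small unfolding Suc r8 aS by eventually_elim auto
        next
          case False
          then have aS: "a (Suc j) = a j + 2 * H j - 2 * H (Suc j)" by (simp add: a_Suc)
          have not_half: "\<not> measure lborel (ball x0 r) / 2 \<le> measure lborel {x \<in> ball x0 r. u x \<le> a j + 2 * H j - H j}"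
          proof
            assume half: "measure lborel (ball x0 r) / 2 \<le> measure lborel {x \<in> ball x0 r. u x \<le> a j + 2 * H j - H j}"
            interpret sb: subsolution_ball p s \<Lambda>1 \<Lambda>2 K \<Omega> u x0 r
              by (rule subsolution_ballI[OF p s \<Lambda> sub r(1) cb])
            have "AE x in lborel. x \<in> ball x0 (r / 8) \<longrightarrow> u x \<le> a j + 2 * H j - \<tau> * H j / 4"
            proof (rule growth[OF sb.subsolution_ball_axioms H0 _ half])
              show "AE x in lborel. x \<in> ball x0 r \<longrightarrow> u x \<le> a j + 2 * H j"
                using IH[OF order_refl] by (auto simp: r_def[symmetric] elim!: eventually_mono)
              show "sb.tail_above (a j + 2 * H j - \<tau> * H j) \<le> ennreal (T1 * (\<tau> * H j) powr (p - 1) * r powr (- (p * s)))"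
                unfolding sb.tail_above_def sb.q_def T1_def unfolding H_def r_def
              proof (rule tail_control[OF p s(1) um R S \<tau>(1) \<tau>1 \<alpha>(1) \<alpha>(3)[unfolded \<beta>_def] uS tail,
                  where b = "\<lambda>i. a i + 2 * (S / \<tau> * 8 powr (- (\<alpha> * real i)))"])
                fix i assume i: "i \<le> j"
                show "AE x in lborel. x \<in> ball x0 (R / 8 ^ i) \<longrightarrow> u x \<le> a i + 2 * (S / \<tau> * 8 powr (- (\<alpha> * real i)))"
                  using IH[OF i] unfolding H_def by (auto elim!: eventually_mono)
                show "a i + 2 * (S / \<tau> * 8 powr (- (\<alpha> * real i))) - (a j + 2 * (S / \<tau> * 8 powr (- (\<alpha> * real j))))
                  \<le> 2 * (S / \<tau> * 8 powr (- (\<alpha> * real i)) - S / \<tau> * 8 powr (- (\<alpha> * real j)))"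
                  using nest(1)[OF i] by simp
              qed
            qed
            moreover have "a j + 2 * H j - \<tau> * H j / 4 \<le> a j + 2 * H (Suc j)"
              using HSuc(1)[of j] by (simp add: algebra_simps)
            ultimately have "AE y in lborel. y \<in> ball x0 (r / 8) \<longrightarrow> u y \<le> a j + 2 * H (Suc j)"
              by (auto elim!: eventually_mono)
            then show False using False unfolding r8 by blast
          qed
          interpret sb: subsolution_ball p s \<Lambda>1 \<Lambda>2 K \<Omega> "\<lambda>x. - u x" x0 r
            by (rule subsolution_ballI[OF p s \<Lambda> sub' r(1) cb])
          have half': "measure lborel (ball x0 r) / 2 \<le> measure lborel {x \<in> ball x0 r. - u x \<le> - a j - H j}"
          proof -
            let ?A = "{x \<in> ball x0 r. u x \<le> a j + 2 * H j - H j}" and ?B = "{x \<in> ball x0 r. - u x \<le> - a j - H j}"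
            have "?A = ball x0 r \<inter> {x. u x \<le> a j + 2 * H j - H j}" "?B = ball x0 r \<inter> {x. - u x \<le> - a j - H j}" by auto
            then have meas: "?A \<in> sets borel" "?B \<in> sets borel" by simp_all
            have "measure lborel (ball x0 r) \<le> measure lborel (?A \<union> ?B)"
              by (rule measure_mono_in_ball[where x = x0 and r = r]) (use meas in auto)
            also have "\<dots> \<le> measure lborel ?A + measure lborel ?B"
              by (rule measure_Un_le) (use meas in auto)
            finally show ?thesis using not_half by linarith
          qed
          have uS': "AE x in lborel. x \<in> ball x0 R \<longrightarrow> \<bar>- u x\<bar> \<le> S" using uS by simp
          have tail': "tail_energy (real DIM('a) + p * s) p (\<lambda>x. - u x) x0 R
            \<le> ennreal (S powr (p - 1) * R powr (- (p * s)))" using tail by simp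
          have um': "(\<lambda>x. - u x) \<in> borel_measurable borel" by measurable
          have "AE x in lborel. x \<in> ball x0 (r / 8) \<longrightarrow> - u x \<le> - a j - \<tau> * H j / 4"
          proof (rule growth[OF sb.subsolution_ball_axioms H0 _ half'])
            show "AE x in lborel. x \<in> ball x0 r \<longrightarrow> - u x \<le> - a j"
              using IH[OF order_refl] by (auto simp: r_def[symmetric] elim!: eventually_mono)
            show "sb.tail_above (- a j - \<tau> * H j) \<le> ennreal (T1 * (\<tau> * H j) powr (p - 1) * r powr (- (p * s)))"
              unfolding sb.tail_above_def sb.q_def T1_def unfolding H_def r_def
            proof (rule tail_control[OF p s(1) um' R S \<tau>(1) \<tau>1 \<alpha>(1) \<alpha>(3)[unfolded \<beta>_def] uS' tail',
                where b = "\<lambda>i. - a i"])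
              fix i assume i: "i \<le> j"
              show "AE x in lborel. x \<in> ball x0 (R / 8 ^ i) \<longrightarrow> - u x \<le> - a i"
                using IH[OF i] by (auto elim!: eventually_mono)
              show "- a i - - a j \<le> 2 * (S / \<tau> * 8 powr (- (\<alpha> * real i)) - S / \<tau> * 8 powr (- (\<alpha> * real j)))"
                using nest(2)[OF i] unfolding H_def by (simp add: algebra_simps)
            qed
          qed
          then have "AE y in lborel. y \<in> ball x0 (r / 8) \<longrightarrow> a j + \<tau> * H j / 4 \<le> u y"
            by (auto elim!: eventually_mono)
          moreover have "a j + 2 * H j - 2 * H (Suc j) \<le> a j + \<tau> * H j / 4"
            using HSuc(1)[of j] by (simp add: algebra_simps)
          ultimately show ?thesis using small unfolding Suc r8 aS by (auto elim!: eventually_elim2)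
        qed
      qed
    qed
    define c where "c = (SUP j. a j)"
    have a_le: "a i \<le> a j + 2 * H j" for i j
      using nest(1)[of i "max i j"] nest(2)[of j "max i j"] H0[of "max i j"] by simp
    have c: "a j \<le> c" "c \<le> a j + 2 * H j" for j
    proof -
      show "a j \<le> c" unfolding c_def using a_le[of _ 0] by (intro cSUP_upper bdd_aboveI2) auto
      show "c \<le> a j + 2 * H j" unfolding c_def using a_le by (intro cSUP_least) auto
    qed
    show "\<exists>c. \<forall>r. 0 < r \<and> r \<le> R \<longrightarrow> (AE x in lborel. x \<in> ball x0 r \<longrightarrow> \<bar>u x - c\<bar> \<le> 16 / \<tau> * S * (r / R) powr \<alpha>)"
    proof (intro exI[of _ c] allI impI)
      fix r assume r: "0 < r \<and> r \<le> R"
      then obtain j where j: "8 ^ j \<le> R / r" "R / r < 8 ^ Suc j" using geometric_scale[of 8 "R / r"] by auto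
      have rj: "r \<le> R / 8 ^ j" using j(1) r by (simp add: pos_le_divide_eq mult.commute)
      define B :: real where "B = 8 ^ Suc j"
      have B: "0 < B" by (simp add: B_def)
      have "R < B * r" using j(2) r unfolding B_def[symmetric] by (simp add: pos_divide_less_eq)
      then have "1 / B \<le> r / R" using R B by (simp add: pos_divide_le_eq pos_le_divide_eq mult.commute)
      then have jr: "1 / 8 ^ Suc j \<le> r / R" unfolding B_def .
      have le: "2 * H j \<le> 16 / \<tau> * S * (r / R) powr \<alpha>"
      proof -
        have "8 powr (- (\<alpha> * real j)) = 8 powr \<alpha> * (1 / 8 ^ Suc j) powr \<alpha>"
        proof -
          have "1 / 8 ^ Suc j = (8::real) powr (- real (Suc j))"
            by (subst powr_minus, subst powr_realpow, simp, rule inverse_eq_divide[symmetric])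
          then have "8 powr \<alpha> * (1 / 8 ^ Suc j) powr \<alpha> = 8 powr (\<alpha> + - real (Suc j) * \<alpha>)"
            by (simp only: powr_powr powr_add)
          also have "\<alpha> + - real (Suc j) * \<alpha> = - (\<alpha> * real j)" by (simp add: algebra_simps)
          finally show ?thesis by (rule sym)
        qed
        also have "\<dots> \<le> 8 powr 1 * (r / R) powr \<alpha>"
          using jr r R \<alpha> by (intro mult_mono powr_mono powr_mono2) auto
        finally have "8 powr (- (\<alpha> * real j)) \<le> 8 * (r / R) powr \<alpha>" by simp
        then have "2 * (S / \<tau>) * 8 powr (- (\<alpha> * real j)) \<le> 2 * (S / \<tau>) * (8 * (r / R) powr \<alpha>)"
          using S \<tau> by (intro mult_left_mono) auto
        moreover have "2 * H j = 2 * (S / \<tau>) * 8 powr (- (\<alpha> * real j))" by (simp only: H_def mult.assoc)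
        moreover have "2 * (S / \<tau>) * (8 * (r / R) powr \<alpha>) = 16 / \<tau> * S * (r / R) powr \<alpha>" by simp
        ultimately show ?thesis by linarith
      qed
      show "AE x in lborel. x \<in> ball x0 r \<longrightarrow> \<bar>u x - c\<bar> \<le> 16 / \<tau> * S * (r / R) powr \<alpha>"
      proof (rule eventually_mono[OF main[of j]], intro impI)
        fix x assume x: "x \<in> ball x0 (R / 8 ^ j) \<longrightarrow> a j \<le> u x \<and> u x \<le> a j + 2 * H j" and "x \<in> ball x0 r"
        then have "a j \<le> u x \<and> u x \<le> a j + 2 * H j" using rj by auto
        then show "\<bar>u x - c\<bar> \<le> 16 / \<tau> * S * (r / R) powr \<alpha>" using c[of j] le by linarith
      qed
    qed
  qed
qed

section \<open>Borel representatives\<close>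

lemma Lp_loc_measurable:
  fixes u :: "'a::euclidean_space \<Rightarrow> real"
  assumes "u \<in> Lp_loc p UNIV"
  shows "u \<in> borel_measurable lebesgue"
proof (rule borel_measurable_LIMSEQ_real)
  show "(\<lambda>x. indicat_real (cball 0 (real n)) x *\<^sub>R u x) \<in> borel_measurable lebesgue" for n
  proof -
    have "u \<in> borel_measurable (lebesgue_on (cball 0 (real n)))"
      using assms by (auto simp: Lp_loc_def Lp_def)
    then show ?thesis by (subst (asm) borel_measurable_restrict_space_iff) auto
  qed
  fix x
  have "eventually (\<lambda>n. indicat_real (cball 0 (real n)) x *\<^sub>R u x = u x) sequentially"
    using eventually_ge_at_top[of "nat \<lceil>norm x\<rceil>"] by eventually_elim (auto simp: indicator_def nat_le_iff ceiling_le_iff)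
  then show "(\<lambda>n. indicat_real (cball 0 (real n)) x *\<^sub>R u x) \<longlonglongrightarrow> u x"
    by (rule tendsto_eventually)
qed

lemma gagliardo_finite_iff:
  assumes "0 < p"
  shows "gagliardo s p U u < \<infinity> \<longleftrightarrow> (\<integral>\<^sup>+(x, y). ennreal (\<bar>u x - u y\<bar> powr p / norm (x - y) powr (real DIM('a) + p * s))
      \<partial>lebesgue_on (U \<times> U :: ('a::euclidean_space \<times> 'a) set)) < \<infinity>"
  unfolding gagliardo_def enn_powr_def by (auto simp: less_top[symmetric])

lemma powr_divide_eq: "a / b powr q = a * b powr (- q)" for a b q :: real
  by (simp add: powr_minus divide_inverse)

lemma AE_lborel_iff: "(AE x in lebesgue. P x) \<longleftrightarrow> (AE x in lborel. P x)"
  by (rule AE_completion_iff)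

lemma borel_kernel_bounds:
  fixes K :: "'a::euclidean_space \<times> 'a \<Rightarrow> real"
  assumes "K \<in> borel_measurable lebesgue" and "0 < \<Lambda>1"
    and "AE (x, y) in lebesgue. K (x, y) = K (y, x) \<and> \<Lambda>1 \<le> K (x, y) * norm (x - y) powr q \<and> K (x, y) * norm (x - y) powr q \<le> \<Lambda>2"
  obtains K' where "K' \<in> borel_measurable (borel \<Otimes>\<^sub>M borel)" "AE z in lborel2. K z = K' z"
    "AE (x, y) in lborel2. \<Lambda>1 * norm (x - y) powr (- q) \<le> K' (x, y) \<and> K' (x, y) \<le> \<Lambda>2 * norm (x - y) powr (- q)"
proof -
  obtain K' where K': "K' \<in> borel_measurable lborel" "AE z in lborel. K z = K' z"
    using completion_ex_borel_measurable_real[OF assms(1)] by blast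
  show ?thesis
  proof (rule that[of K'])
    show "K' \<in> borel_measurable (borel \<Otimes>\<^sub>M borel)" using K'(1) by (simp add: borel_prod)
    show ae: "AE z in lborel2. K z = K' z" using K'(2) unfolding lborel_prod .
    have b: "AE z in lborel2. case z of (x, y) \<Rightarrow> K (x, y) = K (y, x) \<and> \<Lambda>1 \<le> K (x, y) * norm (x - y) powr q \<and> K (x, y) * norm (x - y) powr q \<le> \<Lambda>2"
      using assms(3) unfolding lborel_prod AE_lborel_iff .
    show "AE (x, y) in lborel2. \<Lambda>1 * norm (x - y) powr (- q) \<le> K' (x, y) \<and> K' (x, y) \<le> \<Lambda>2 * norm (x - y) powr (- q)"
      using ae b
    proof eventually_elim
      case (elim z)
      obtain x y where z: "z = (x, y)" by (cases z)
      have h: "\<Lambda>1 \<le> K' (x, y) * norm (x - y) powr q" "K' (x, y) * norm (x - y) powr q \<le> \<Lambda>2" using elim by (auto simp: z)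
      have n: "0 < norm (x - y) powr q"
        using h(1) assms(2) by (cases "x = y") auto
      show ?case using h n by (simp add: z powr_minus divide_inverse[symmetric] pos_divide_le_eq pos_le_divide_eq)
    qed
  qed
qed

lemma weak_form_borel:
  fixes u u' \<phi> :: "'a::euclidean_space \<Rightarrow> real"
  assumes [measurable]: "u' \<in> borel_measurable borel" "K' \<in> borel_measurable (borel \<Otimes>\<^sub>M borel)" "\<phi> \<in> borel_measurable borel"
    and u: "AE x in lborel. u x = u' x" and K: "AE z in lborel2. K z = K' z"
  shows "weak_form p K u \<phi> = (\<integral>(x, y). Jp p (u' x - u' y) * (\<phi> x - \<phi> y) * K' (x, y) \<partial>lborel2)"
proof -
  let ?f = "\<lambda>(x, y). \<bar>u x - u y\<bar> powr (p - 2) * (u x - u y) * (\<phi> x - \<phi> y) * K (x, y)"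
  let ?f' = "\<lambda>(x, y). Jp p (u' x - u' y) * (\<phi> x - \<phi> y) * K' (x, y)"
  have "AE z in lborel2. ?f z = ?f' z"
    using AE_lborel2_coordinate[OF u] K by eventually_elim (auto simp: Jp_def)
  then have ae: "AE z in lebesgue. ?f' z = ?f z" 
    unfolding AE_lborel_iff lborel_prod by (auto elim: eventually_mono)
  have "?f' \<in> borel_measurable lborel2" by measurable
  then have m': "?f' \<in> borel_measurable lborel" by (simp add: lborel_prod)
  have m: "?f' \<in> borel_measurable lebesgue" by (rule measurable_completion[OF m'])
  have "weak_form p K u \<phi> = (\<integral>z. ?f z \<partial>lebesgue)" by (simp add: weak_form_def)
  also have "\<dots> = (\<integral>z. ?f' z \<partial>lebesgue)"
    by (rule integral_cong_AE[OF borel_measurable_AE[OF m ae] m]) (use ae in \<open>auto elim: eventually_mono\<close>)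
  also have "\<dots> = (\<integral>z. ?f' z \<partial>lborel)" by (rule integral_completion[OF m'])
  finally show ?thesis by (simp add: lborel_prod)
qed

lemma C1c_measurable:
  assumes "\<phi> \<in> C1c \<Omega>" shows "\<phi> \<in> borel_measurable borel"
proof -
  obtain D where "\<And>x. (\<phi> has_derivative blinfun_apply (D x)) (at x)"
    using assms by (auto simp: C1c_def)
  then have "continuous_on UNIV \<phi>"
    by (intro continuous_at_imp_continuous_on ballI has_derivative_continuous)
  then show ?thesis by (rule borel_measurable_continuous_onI)
qed

text \<open>The bound on the energy in a ball comes from the membership of \<open>u\<close> in the local space for that ball, and the weighted integrability
  from its membership for the empty set.  A solution tested with nonnegative functions gives \<open>0\<close>, and \<open>J\<close>
  is odd; so \<open>- u\<close> is a subsolution too.\<close>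

lemma borel_representative:
  fixes \<Omega> :: "'a::euclidean_space set" and K :: "'a \<times> 'a \<Rightarrow> real" and u :: "'a \<Rightarrow> real"
  assumes p: "1 < p" and L: "0 < \<Lambda>1"
    and K: "K \<in> borel_measurable lebesgue"
      "AE (x, y) in lebesgue. K (x, y) = K (y, x) \<and> \<Lambda>1 \<le> K (x, y) * norm (x - y) powr (real DIM('a) + p * s) \<and>
        K (x, y) * norm (x - y) powr (real DIM('a) + p * s) \<le> \<Lambda>2"
    and bdd: "u \<in> Linf_loc \<Omega>" and sol: "weak_solution s p K \<Omega> u"
  obtains u' K' where "u' \<in> borel_measurable borel" "AE x in lborel. u x = u' x"
    "borel_subsolution p s \<Lambda>1 \<Lambda>2 K' \<Omega> u'" "borel_subsolution p s \<Lambda>1 \<Lambda>2 K' \<Omega> (\<lambda>x. - u' x)"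
proof -
  let ?q = "real DIM('a) + p * s"
  have W: "u \<in> Wsp_tilde_loc s p \<Omega>" using sol by (simp add: weak_solution_def weak_supersolution_def)
  then have "u \<in> Lp_loc p UNIV" by (simp add: Wsp_tilde_loc_def)
  then have "u \<in> borel_measurable lebesgue" by (rule Lp_loc_measurable)
  then obtain u' where u'0: "u' \<in> borel_measurable lborel" and ae: "AE x in lborel. u x = u' x"
    using completion_ex_borel_measurable_real by blast
  then have u'[measurable]: "u' \<in> borel_measurable borel" by simp
  obtain K' where K'[measurable]: "K' \<in> borel_measurable (borel \<Otimes>\<^sub>M borel)" and KK': "AE z in lborel2. K z = K' z"
    and Kb: "AE (x, y) in lborel2. \<Lambda>1 * norm (x - y) powr (- ?q) \<le> K' (x, y) \<and> K' (x, y) \<le> \<Lambda>2 * norm (x - y) powr (- ?q)"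
    using borel_kernel_bounds[OF K(1) L K(2)] by blast
  have weak: "(\<integral>(x, y). Jp p (u' x - u' y) * (\<phi> x - \<phi> y) * K' (x, y) \<partial>lborel2) = 0"
    if "\<phi> \<in> C1c \<Omega>" "\<And>x. 0 \<le> \<phi> x" for \<phi>
  proof -
    have "weak_form p K u \<phi> = 0"
      using sol that by (force simp: weak_solution_def weak_supersolution_def weak_subsolution_def)
    then show ?thesis using weak_form_borel[OF u' K' C1c_measurable[OF that(1)] ae KK'] by simp
  qed
  have weak': "(\<integral>(x, y). Jp p (- u' x - - u' y) * (\<phi> x - \<phi> y) * K' (x, y) \<partial>lborel2) = 0"
    if "\<phi> \<in> C1c \<Omega>" "\<And>x. 0 \<le> \<phi> x" for \<phi>
  proof -
    have e: "Jp p (- u' x - - u' y) * c * d = - (Jp p (u' x - u' y) * c * d)" for x y c d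
    proof -
      have "- u' x - - u' y = - (u' x - u' y)" by simp
      then show ?thesis by (simp only: Jp_minus mult_minus_left)
    qed
    have "(\<integral>(x, y). Jp p (- u' x - - u' y) * (\<phi> x - \<phi> y) * K' (x, y) \<partial>lborel2)
        = (\<integral>z. - (case z of (x, y) \<Rightarrow> Jp p (u' x - u' y) * (\<phi> x - \<phi> y) * K' (x, y)) \<partial>lborel2)"
      unfolding e by (rule Bochner_Integration.integral_cong) (auto split: prod.split)
    also have "\<dots> = - 0" unfolding integral_minus weak[OF that] ..
    finally show ?thesis by simp
  qed
  have local_bound: "\<exists>M. AE x in lborel. x \<in> ball x0 r \<longrightarrow> \<bar>u' x\<bar> \<le> M" if "cball x0 r \<subseteq> \<Omega>" for x0 r
  proof -
    have "compact (cball x0 r) \<and> cball x0 r \<subseteq> \<Omega>" using that by simp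
    then obtain M where "AE x in lebesgue_on (cball x0 r). \<bar>u x\<bar> \<le> M"
      using bdd unfolding Linf_loc_def by blast
    then have "AE x in lborel. x \<in> cball x0 r \<longrightarrow> \<bar>u x\<bar> \<le> M"
      by (simp add: AE_restrict_space_iff AE_lborel_iff)
    then have "AE x in lborel. x \<in> ball x0 r \<longrightarrow> \<bar>u' x\<bar> \<le> M"
      using ae by eventually_elim auto
    then show ?thesis by blast
  qed
  have local_energy: "(\<integral>\<^sup>+x. \<integral>\<^sup>+y. ennreal (\<bar>u' x - u' y\<bar> powr p * norm (x - y) powr (- ?q))
       * indicator (ball x0 r) x * indicator (ball x0 r) y \<partial>lborel \<partial>lborel) < \<infinity>" if "cball x0 r \<subseteq> \<Omega>" for x0 r
  proof -
    have "open (ball x0 r) \<and> bounded (ball x0 r) \<and> ball x0 r \<subseteq> \<Omega>" using that by auto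
    then have "u \<in> Wsp_tilde s p (ball x0 r)" using W by (auto simp: Wsp_tilde_loc_def)
    then obtain U where U: "open U" "ball x0 r \<Subset> U" "u \<in> Wsp s p U" by (auto simp: Wsp_tilde_def)
    have sub: "ball x0 r \<subseteq> U" using U(2) closure_subset unfolding compactly_in_def by blast
    have "(\<integral>\<^sup>+(x, y). ennreal (\<bar>u x - u y\<bar> powr p / norm (x - y) powr ?q) \<partial>lebesgue_on (U \<times> U)) < \<infinity>"
      using U(3) p gagliardo_finite_iff[of p s U u] by (simp add: Wsp_def)
    also have "(\<integral>\<^sup>+(x, y). ennreal (\<bar>u x - u y\<bar> powr p / norm (x - y) powr ?q) \<partial>lebesgue_on (U \<times> U))
      = (\<integral>\<^sup>+z. (\<lambda>(x, y). ennreal (\<bar>u x - u y\<bar> powr p / norm (x - y) powr ?q)) z * indicator (U \<times> U) z \<partial>lebesgue)"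
      using U(1) by (intro nn_integral_restrict_space) (simp add: open_Times)
    also have "\<dots> = (\<integral>\<^sup>+z. (\<lambda>(x, y). ennreal (\<bar>u x - u y\<bar> powr p / norm (x - y) powr ?q)) z * indicator (U \<times> U) z \<partial>lborel2)"
      by (simp add: nn_integral_completion lborel_prod)
    finally have fin: "\<dots> < \<infinity>" .
    have m: "(\<lambda>z. ennreal (\<bar>u' (fst z) - u' (snd z)\<bar> powr p * norm (fst z - snd z) powr (- ?q))
       * indicator (ball x0 r) (fst z) * indicator (ball x0 r) (snd z)) \<in> borel_measurable lborel2" by measurable
    have "(\<integral>\<^sup>+x. \<integral>\<^sup>+y. ennreal (\<bar>u' x - u' y\<bar> powr p * norm (x - y) powr (- ?q))
       * indicator (ball x0 r) x * indicator (ball x0 r) y \<partial>lborel \<partial>lborel)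
       = (\<integral>\<^sup>+z. ennreal (\<bar>u' (fst z) - u' (snd z)\<bar> powr p * norm (fst z - snd z) powr (- ?q))
       * indicator (ball x0 r) (fst z) * indicator (ball x0 r) (snd z) \<partial>lborel2)"
      using nn_integral_lborel2[OF m] by simp
    also have "\<dots> \<le> (\<integral>\<^sup>+z. (\<lambda>(x, y). ennreal (\<bar>u x - u y\<bar> powr p / norm (x - y) powr ?q)) z * indicator (U \<times> U) z \<partial>lborel2)"
    proof (rule nn_integral_mono_AE, use AE_lborel2_coordinate[OF ae] in eventually_elim)
      fix z :: "'a \<times> 'a"
      assume "u (fst z) = u' (fst z)" "u (snd z) = u' (snd z)"
      then show "ennreal (\<bar>u' (fst z) - u' (snd z)\<bar> powr p * norm (fst z - snd z) powr (- ?q))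
          * indicator (ball x0 r) (fst z) * indicator (ball x0 r) (snd z)
        \<le> (\<lambda>(x, y). ennreal (\<bar>u x - u y\<bar> powr p / norm (x - y) powr ?q)) z * indicator (U \<times> U) z"
        using sub by (cases z) (auto simp: powr_divide_eq indicator_def)
    qed
    finally show ?thesis using fin by simp
  qed
  have tail: "(\<integral>\<^sup>+x. ennreal (\<bar>u' x\<bar> powr (p - 1) * (1 + norm x) powr (- ?q)) \<partial>lborel) < \<infinity>"
  proof -
    have "u \<in> Wsp_tilde s p {}" using W by (auto simp: Wsp_tilde_loc_def)
    then have "(\<integral>\<^sup>+x. ennreal (\<bar>u x\<bar> powr (p - 1) / (1 + norm x) powr ?q) \<partial>lborel) < \<infinity>"
      by (simp add: Wsp_tilde_def nn_integral_completion)
    also have "(\<integral>\<^sup>+x. ennreal (\<bar>u x\<bar> powr (p - 1) / (1 + norm x) powr ?q) \<partial>lborel) = (\<integral>\<^sup>+x. ennreal (\<bar>u' x\<bar> powr (p - 1) * (1 + norm x) powr (- ?q)) \<partial>lborel)"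
      using ae by (intro nn_integral_cong_AE, eventually_elim) (simp add: powr_divide_eq)
    finally show ?thesis .
  qed
  show ?thesis
  proof (rule that[OF u' ae, of K'])
    show "borel_subsolution p s \<Lambda>1 \<Lambda>2 K' \<Omega> u'"
      unfolding borel_subsolution_def
      using u' K' Kb local_bound local_energy tail weak by (intro conjI allI impI ballI) auto
    have e: "\<bar>- u' x - - u' y\<bar> = \<bar>u' x - u' y\<bar>" for x y by simp
    show "borel_subsolution p s \<Lambda>1 \<Lambda>2 K' \<Omega> (\<lambda>x. - u' x)"
      unfolding borel_subsolution_def e abs_minus_cancel
      using u' K' Kb local_bound local_energy tail weak' by (intro conjI allI impI ballI) auto
  qed
qed

section \<open>The continuous representative\<close>

lemma AE_ball_witness:
  fixes x :: "'a::euclidean_space"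
  assumes "AE y in lborel. y \<in> ball x r \<longrightarrow> P y" and r: "0 < r"
  obtains y where "y \<in> ball x r" "P y"
proof (rule ccontr)
  assume "\<not> thesis"
  then have no: "\<And>y. y \<in> ball x r \<Longrightarrow> \<not> P y" using that by blast
  have "AE y in lborel. y \<notin> ball x r"
    using assms(1) by eventually_elim (use no in auto)
  then have "emeasure lborel (ball x r) = 0"
    by (subst (asm) AE_iff_measurable[of "ball x r"]) auto
  then show False using r content_ball_gt_0_iff[of x r] by (simp add: measure_def)
qed

text \<open>The value that \<open>u\<close> must take at \<open>x\<close> if it is to be continuous there after modification on a null set.\<close>

definition has_ess_limit :: "('a::euclidean_space \<Rightarrow> real) \<Rightarrow> 'a \<Rightarrow> real \<Rightarrow> bool" where
  "has_ess_limit u x c \<longleftrightarrow> (\<forall>e>0. \<exists>r>0. AE y in lborel. y \<in> ball x r \<longrightarrow> \<bar>u y - c\<bar> \<le> e)"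

definition ess_limit :: "('a::euclidean_space \<Rightarrow> real) \<Rightarrow> 'a \<Rightarrow> real" where
  "ess_limit u x = (THE c. has_ess_limit u x c)"

lemma has_ess_limit_unique:
  assumes "has_ess_limit u x c" "has_ess_limit u x c'"
  shows "c = c'"
proof (rule ccontr)
  assume "c \<noteq> c'"
  define e where "e = \<bar>c - c'\<bar> / 3"
  have e: "0 < e" using \<open>c \<noteq> c'\<close> by (simp add: e_def)
  obtain r r' where r: "0 < r" "AE y in lborel. y \<in> ball x r \<longrightarrow> \<bar>u y - c\<bar> \<le> e"
    and r': "0 < r'" "AE y in lborel. y \<in> ball x r' \<longrightarrow> \<bar>u y - c'\<bar> \<le> e"
    using assms e unfolding has_ess_limit_def by blast
  have "AE y in lborel. y \<in> ball x (min r r') \<longrightarrow> \<bar>u y - c\<bar> \<le> e \<and> \<bar>u y - c'\<bar> \<le> e"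
    using r(2) r'(2) by eventually_elim auto
  then obtain y where "\<bar>u y - c\<bar> \<le> e \<and> \<bar>u y - c'\<bar> \<le> e"
    by (rule AE_ball_witness) (use r r' in auto)
  then show False using \<open>c \<noteq> c'\<close> unfolding e_def by (simp add: abs_if split: if_splits)
qed

lemma ess_limit_eq: "has_ess_limit u x c \<Longrightarrow> ess_limit u x = c"
  unfolding ess_limit_def using has_ess_limit_unique by (intro the_equality) auto

text \<open>The conclusion of \<open>oscillation_decay\<close>, with the constant around which \<open>u\<close> oscillates identified.\<close>

definition osc_at :: "real \<Rightarrow> real \<Rightarrow> ('a::euclidean_space \<Rightarrow> real) \<Rightarrow> 'a \<Rightarrow> real \<Rightarrow> real \<Rightarrow> bool" where
  "osc_at \<alpha> C u x R S \<longleftrightarrow> (AE y in lborel. y \<in> ball x R \<longrightarrow> \<bar>u y\<bar> \<le> S) \<and>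
     (\<forall>r. 0 < r \<and> r \<le> R \<longrightarrow> (AE y in lborel. y \<in> ball x r \<longrightarrow> \<bar>u y - ess_limit u x\<bar> \<le> C * S * (r / R) powr \<alpha>))"

lemma powr_small:
  fixes X \<alpha> e :: real
  assumes "0 < \<alpha>" "0 < e" "0 < R"
  obtains r where "0 < r" "r \<le> R" "X * (r / R) powr \<alpha> \<le> e"
proof -
  define t where "t = min 1 ((e / (\<bar>X\<bar> + 1)) powr (1 / \<alpha>))"
  have t: "0 < t" "t \<le> 1" using assms by (auto simp: t_def)
  have "X * t powr \<alpha> \<le> (\<bar>X\<bar> + 1) * t powr \<alpha>" by (intro mult_right_mono) auto
  also have "\<dots> \<le> (\<bar>X\<bar> + 1) * ((e / (\<bar>X\<bar> + 1)) powr (1 / \<alpha>)) powr \<alpha>"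
    using t assms by (intro mult_left_mono powr_mono2) (auto simp: t_def)
  also have "\<dots> = e" using assms by (simp add: powr_powr)
  finally show ?thesis using that[of "t * R"] t assms by simp
qed

lemma osc_atI:
  assumes c: "\<And>r. 0 < r \<Longrightarrow> r \<le> R \<Longrightarrow> AE y in lborel. y \<in> ball x r \<longrightarrow> \<bar>u y - c\<bar> \<le> C * S * (r / R) powr \<alpha>"
    and S: "AE y in lborel. y \<in> ball x R \<longrightarrow> \<bar>u y\<bar> \<le> S" and R: "0 < R" and \<alpha>: "0 < \<alpha>"
  shows "osc_at \<alpha> C u x R S"
proof -
  have "has_ess_limit u x c"
    unfolding has_ess_limit_def
  proof (intro allI impI)
    fix e :: real assume e: "0 < e"
    obtain r where r: "0 < r" "r \<le> R" "C * S * (r / R) powr \<alpha> \<le> e"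
      using powr_small[OF \<alpha> e R] by blast
    have "AE y in lborel. y \<in> ball x r \<longrightarrow> \<bar>u y - c\<bar> \<le> e"
      using c[OF r(1,2)] by eventually_elim (use r(3) in auto)
    then show "\<exists>r>0. AE y in lborel. y \<in> ball x r \<longrightarrow> \<bar>u y - c\<bar> \<le> e" using r(1) by blast
  qed
  then have "ess_limit u x = c" by (rule ess_limit_eq)
  then show ?thesis using c S by (simp add: osc_at_def)
qed

text \<open>If the points are close, the balls of radius twice their distance overlap and any common point compares the two
  values; if they are far apart, the bound on \<open>u\<close> suffices.\<close>

lemma ess_limit_holder:
  assumes o1: "osc_at \<alpha> C u x1 R S" and o2: "osc_at \<alpha> C u x2 R S"
    and R: "0 < R" and S: "0 < S" and C: "0 < C" and \<alpha>: "0 < \<alpha>" "\<alpha> \<le> 1"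
  shows "\<bar>ess_limit u x1 - ess_limit u x2\<bar> \<le> 4 * (C + 1) * S * (dist x1 x2 / R) powr \<alpha>"
proof (cases "x1 = x2")
  case False
  define d where "d = dist x1 x2"
  have d: "0 < d" using False by (simp add: d_def)
  have two: "(2 * d / R) powr \<alpha> \<le> 2 * (d / R) powr \<alpha>"
  proof -
    have "(2 * d / R) powr \<alpha> = 2 powr \<alpha> * (d / R) powr \<alpha>" by (simp add: powr_mult[symmetric])
    also have "\<dots> \<le> 2 powr 1 * (d / R) powr \<alpha>" using \<alpha> by (intro mult_right_mono powr_mono) auto
    finally show ?thesis by simp
  qed
  have "\<bar>ess_limit u x1 - ess_limit u x2\<bar> \<le> 2 * ((C + 1) * S * (2 * d / R) powr \<alpha>)"
  proof (cases "2 * d \<le> R")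
    case True
    have "AE y in lborel. y \<in> ball x1 (2 * d) \<longrightarrow> \<bar>u y - ess_limit u x1\<bar> \<le> C * S * (2 * d / R) powr \<alpha>"
      "AE y in lborel. y \<in> ball x2 (2 * d) \<longrightarrow> \<bar>u y - ess_limit u x2\<bar> \<le> C * S * (2 * d / R) powr \<alpha>"
      using o1 o2 True d by (auto simp: osc_at_def)
    then have "AE y in lborel. y \<in> ball x1 d \<longrightarrow> \<bar>u y - ess_limit u x1\<bar> \<le> C * S * (2 * d / R) powr \<alpha> \<and>
        \<bar>u y - ess_limit u x2\<bar> \<le> C * S * (2 * d / R) powr \<alpha>"
    proof eventually_elim
      case (elim y)
      show ?case
      proof
        assume y: "y \<in> ball x1 d"
        have "dist x2 y < 2 * d" using y dist_triangle[of x2 y x1] by (simp add: d_def dist_commute)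
        then show "\<bar>u y - ess_limit u x1\<bar> \<le> C * S * (2 * d / R) powr \<alpha> \<and> \<bar>u y - ess_limit u x2\<bar> \<le> C * S * (2 * d / R) powr \<alpha>"
          using elim y d by auto
      qed
    qed
    then obtain y where "\<bar>u y - ess_limit u x1\<bar> \<le> C * S * (2 * d / R) powr \<alpha> \<and> \<bar>u y - ess_limit u x2\<bar> \<le> C * S * (2 * d / R) powr \<alpha>"
      by (rule AE_ball_witness) (use d in auto)
    then have "\<bar>ess_limit u x1 - ess_limit u x2\<bar> \<le> 2 * (C * S * (2 * d / R) powr \<alpha>)" by linarith
    also have "\<dots> \<le> 2 * ((C + 1) * S * (2 * d / R) powr \<alpha>)"
      using S by (intro mult_left_mono mult_right_mono) auto
    finally show ?thesis .
  next
    case False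
    have bd: "\<bar>ess_limit u x\<bar> \<le> (C + 1) * S" if o: "osc_at \<alpha> C u x R S" for x
    proof -
      have "AE y in lborel. y \<in> ball x R \<longrightarrow> \<bar>u y\<bar> \<le> S" "AE y in lborel. y \<in> ball x R \<longrightarrow> \<bar>u y - ess_limit u x\<bar> \<le> C * S * (R / R) powr \<alpha>"
        using o R by (auto simp: osc_at_def)
      then have "AE y in lborel. y \<in> ball x R \<longrightarrow> \<bar>u y\<bar> \<le> S \<and> \<bar>u y - ess_limit u x\<bar> \<le> C * S * (R / R) powr \<alpha>"
        by eventually_elim auto
      then obtain y where "\<bar>u y\<bar> \<le> S \<and> \<bar>u y - ess_limit u x\<bar> \<le> C * S * (R / R) powr \<alpha>"
        by (rule AE_ball_witness) (use R in auto)
      then have "\<bar>u y\<bar> \<le> S" "\<bar>u y - ess_limit u x\<bar> \<le> C * S" using R by auto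
      then show ?thesis unfolding distrib_right abs_le_iff by linarith
    qed
    have "(1::real) \<le> (2 * d / R) powr \<alpha>" using False R \<alpha> by (intro ge_one_powr_ge_zero) auto
    then have "(C + 1) * S * 1 \<le> (C + 1) * S * (2 * d / R) powr \<alpha>"
      using C S by (intro mult_left_mono) auto
    then show ?thesis using bd[OF o1] bd[OF o2] by linarith
  qed
  also have "\<dots> \<le> 2 * ((C + 1) * S * (2 * (d / R) powr \<alpha>))"
    using two C S by (intro mult_left_mono) auto
  also have "\<dots> = 4 * (C + 1) * S * (d / R) powr \<alpha>" by (simp only: mult_ac)
  finally show ?thesis unfolding d_def .
qed simp

text \<open>Almost every \<open>y\<close> obeys simultaneously all the estimates \<open>|u y - ess_limit u z| \<le> 1 / (k + 1)\<close> that hold almost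
  everywhere in balls with radius \<open>1 / (n + 1)\<close> and centre \<open>z\<close> in a countable dense set.  Choosing \<open>z\<close> close to
  \<open>y\<close> and using the continuity of \<open>ess_limit u\<close> gives equality.\<close>

lemma ess_limit_ae:
  assumes loc: "\<And>y. y \<in> \<Omega> \<Longrightarrow> \<exists>\<rho> R S. 0 < \<rho> \<and> 0 < R \<and> 0 < S \<and> (\<forall>z\<in>ball y \<rho>. osc_at \<alpha> C u z R S)"
    and C: "0 < C" and \<alpha>: "0 < \<alpha>" "\<alpha> \<le> 1"
  shows "AE y in lborel. y \<in> \<Omega> \<longrightarrow> u y = ess_limit u (y::'a::euclidean_space)"
proof -
  obtain D :: "'a set" where D: "countable D" "\<And>X. open X \<Longrightarrow> X \<noteq> {} \<Longrightarrow> \<exists>d\<in>D. d \<in> X"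
    using countable_dense_setE by blast
  define Q where "Q z n k \<longleftrightarrow> (AE y in lborel. y \<in> ball z (1 / real (Suc n)) \<longrightarrow> \<bar>u y - ess_limit u z\<bar> \<le> 1 / real (Suc k))" for z n k
  have "AE y in lborel. \<forall>n k. Q z n k \<longrightarrow> y \<in> ball z (1 / real (Suc n)) \<longrightarrow> \<bar>u y - ess_limit u z\<bar> \<le> 1 / real (Suc k)" for z
    unfolding AE_all_countable by (auto simp: Q_def)
  then have "AE y in lborel. \<forall>z\<in>D. \<forall>n k. Q z n k \<longrightarrow> y \<in> ball z (1 / real (Suc n)) \<longrightarrow> \<bar>u y - ess_limit u z\<bar> \<le> 1 / real (Suc k)"
    using D(1) by (intro AE_ball_countable[THEN iffD2] ballI)
  then show ?thesis
  proof eventually_elim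
    case (elim y)
    show ?case
    proof
      assume "y \<in> \<Omega>"
      then obtain \<rho> R S where h: "0 < \<rho>" "0 < R" "0 < S" "\<And>z. z \<in> ball y \<rho> \<Longrightarrow> osc_at \<alpha> C u z R S"
        using loc by blast
      have close: "\<bar>u y - ess_limit u y\<bar> \<le> 2 / real (Suc k)" for k
      proof -
        obtain r where r: "0 < r" "r \<le> R" "4 * (C + 1) * S * (r / R) powr \<alpha> \<le> 1 / real (Suc k)"
          using powr_small[OF \<alpha>(1) _ h(2), of "1 / real (Suc k)"] by auto
        obtain n where n: "1 / real (Suc n) < min \<rho> r"
          using reals_Archimedean[of "min \<rho> r"] h(1) r(1) by (auto simp: inverse_eq_divide)
        define t where "t = 1 / real (Suc n)"
        have t: "0 < t" "t < \<rho>" "t < r" using n by (auto simp: t_def)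
        obtain z where z: "z \<in> D" "z \<in> ball y t" using D(2)[of "ball y t"] t by auto
        have tr: "(t / R) powr \<alpha> \<le> (r / R) powr \<alpha>"
          using t h \<alpha> by (intro powr_mono2 divide_right_mono) auto
        have zy: "osc_at \<alpha> C u z R S" "osc_at \<alpha> C u y R S" using h z t by auto
        have CS: "C * S * (t / R) powr \<alpha> \<le> 1 / real (Suc k)"
        proof -
          have "C * S * (t / R) powr \<alpha> \<le> (4 * (C + 1)) * S * (r / R) powr \<alpha>"
            using tr C h by (intro mult_mono) auto
          then show ?thesis using r(3) by simp
        qed
        have "AE y in lborel. y \<in> ball z t \<longrightarrow> \<bar>u y - ess_limit u z\<bar> \<le> C * S * (t / R) powr \<alpha>"
          using zy(1) t r by (auto simp: osc_at_def)
        then have "Q z n k" unfolding Q_def t_def[symmetric]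
          by eventually_elim (use CS in auto)
        then have 1: "\<bar>u y - ess_limit u z\<bar> \<le> 1 / real (Suc k)"
          using elim z unfolding t_def by (auto simp: dist_commute)
        have "\<bar>ess_limit u z - ess_limit u y\<bar> \<le> 4 * (C + 1) * S * (dist z y / R) powr \<alpha>"
          by (rule ess_limit_holder[OF zy h(2,3) C \<alpha>])
        also have "\<dots> \<le> 4 * (C + 1) * S * (r / R) powr \<alpha>"
          using z t h C \<alpha> by (intro mult_left_mono powr_mono2 divide_right_mono) (auto simp: dist_commute)
        finally show ?thesis using 1 r(3) by linarith
      qed
      have "\<bar>u y - ess_limit u y\<bar> \<le> 0"
      proof (rule LIMSEQ_le_const)
        show "(\<lambda>k. 2 / real (Suc k)) \<longlonglongrightarrow> 0"
          using tendsto_mult_right_zero[OF LIMSEQ_inverse_real_of_nat, of 2] by (simp only: divide_inverse)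
        show "\<exists>N. \<forall>k\<ge>N. \<bar>u y - ess_limit u y\<bar> \<le> 2 / real (Suc k)" using close by blast
      qed
      then show "u y = ess_limit u y" by simp
    qed
  qed
qed

text \<open>One radius and one bound serve all centres in a compact set, since the weight \<open>(1 + |y|) powr (- q)\<close>
  dominates the kernels centred there.\<close>

lemma uniform_local_data:
  fixes u :: "'a::euclidean_space \<Rightarrow> real"
  assumes p: "1 < p" and s: "0 < s" and [measurable]: "u \<in> borel_measurable borel"
    and bdd: "\<And>B. compact B \<Longrightarrow> B \<subseteq> \<Omega> \<Longrightarrow> \<exists>M. AE x in lborel. x \<in> B \<longrightarrow> \<bar>u x\<bar> \<le> M"
    and tail: "(\<integral>\<^sup>+x. ennreal (\<bar>u x\<bar> powr (p - 1) * (1 + norm x) powr (- (real DIM('a) + p * s))) \<partial>lborel) < \<infinity>"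
    and A: "compact A" "A \<subseteq> \<Omega>" "A \<noteq> {}" and \<Omega>: "open \<Omega>"
  obtains R S where "0 < R" "0 < S" "\<And>z. z \<in> A \<Longrightarrow> cball z R \<subseteq> \<Omega>"
    "\<And>z. z \<in> A \<Longrightarrow> AE x in lborel. x \<in> ball z R \<longrightarrow> \<bar>u x\<bar> \<le> S"
    "\<And>z. z \<in> A \<Longrightarrow> tail_energy (real DIM('a) + p * s) p u z R
        \<le> ennreal (S powr (p - 1) * R powr (- (p * s)))"
proof -
  let ?q = "real DIM('a) + p * s"
  have q: "0 < ?q" using p s by (simp add: add_nonneg_pos)
  obtain R where R: "0 < R" "(\<Union>x\<in>A. cball x R) \<subseteq> \<Omega>"
    using compact_subset_open_imp_cball_epsilon_subset[OF A(1) \<Omega> A(2)] by blast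
  define B where "B = {x. infdist x A \<le> R}"
  have zB: "ball z R \<subseteq> B" if "z \<in> A" for z
    using infdist_le[OF that] by (force simp: B_def dist_commute intro: order_trans)
  have "compact B" unfolding B_def using A R by (intro compact_infdist_le) auto
  moreover have "B \<subseteq> \<Omega>"
  proof
    fix x assume "x \<in> B"
    obtain z where "z \<in> A" "infdist x A = dist x z"
      using infdist_attains_inf[of A x] A compact_imp_closed by blast
    then have "x \<in> cball z R" using \<open>x \<in> B\<close> by (simp add: B_def dist_commute)
    then show "x \<in> \<Omega>" using R(2) \<open>z \<in> A\<close> by blast
  qed
  ultimately obtain M where M: "AE x in lborel. x \<in> B \<longrightarrow> \<bar>u x\<bar> \<le> M" using bdd by blast
  obtain b where b: "\<And>z. z \<in> A \<Longrightarrow> norm z \<le> b" using compact_imp_bounded[OF A(1)] by (auto simp: bounded_iff)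
  obtain W where W: "(\<integral>\<^sup>+x. ennreal (\<bar>u x\<bar> powr (p - 1) * (1 + norm x) powr (- ?q)) \<partial>lborel) = ennreal W" "0 \<le> W"
    using tail by (cases "\<integral>\<^sup>+x. ennreal (\<bar>u x\<bar> powr (p - 1) * (1 + norm x) powr (- ?q)) \<partial>lborel" rule: ennreal_cases) simp_all
  define c where "c = (1 + \<bar>b\<bar>) / R + 1"
  have c: "0 < c" using R by (auto simp: c_def intro!: add_nonneg_pos)
  define S where "S = max (max M 1) ((c powr ?q * W * R powr (p * s)) powr (1 / (p - 1)))"
  show ?thesis
  proof (rule that[OF R(1), of S])
    show "0 < S" by (simp add: S_def)
    fix z assume z: "z \<in> A"
    show "cball z R \<subseteq> \<Omega>" using R(2) z by blast
    show "AE x in lborel. x \<in> ball z R \<longrightarrow> \<bar>u x\<bar> \<le> S"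
      using M
    proof eventually_elim
      case (elim x)
      have "M \<le> S" by (simp add: S_def)
      then show ?case using elim zB[OF z] by auto
    qed
    have "tail_energy ?q p u z R
      \<le> (\<integral>\<^sup>+y. ennreal (c powr ?q) * ennreal (\<bar>u y\<bar> powr (p - 1) * (1 + norm y) powr (- ?q)) \<partial>lborel)"
    proof (rule nn_integral_mono)
      fix y
      show "ennreal (\<bar>u y\<bar> powr (p - 1) * norm (y - z) powr (- ?q)) * indicator (- ball z R) y
        \<le> ennreal (c powr ?q) * ennreal (\<bar>u y\<bar> powr (p - 1) * (1 + norm y) powr (- ?q))"
      proof (cases "y \<in> ball z R")
        case False
        define n where "n = norm (y - z)"
        have n: "R \<le> n" using False by (simp add: n_def dist_norm norm_minus_commute)
        have "norm y \<le> norm z + n" using norm_triangle_ineq[of z "y - z"] by (simp add: n_def)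
        then have "1 + norm y \<le> (1 + \<bar>b\<bar>) * 1 + n" using b[OF z] abs_ge_self[of b] unfolding mult_1_right by linarith
        also have "\<dots> \<le> (1 + \<bar>b\<bar>) * (n / R) + n" using n R by (intro add_right_mono mult_left_mono) auto
        also have "\<dots> = c * n" by (simp add: c_def distrib_right)
        finally have "(1 + norm y) / c \<le> n" using c by (simp add: pos_divide_le_eq mult.commute)
        moreover have y1: "0 < 1 + norm y" by (rule add_pos_nonneg) auto
        ultimately have "n powr (- ?q) \<le> ((1 + norm y) / c) powr (- ?q)"
          using q c by (intro powr_mono2' divide_pos_pos) auto
        also have "\<dots> = c powr ?q * (1 + norm y) powr (- ?q)"
          using c y1 by (simp only: powr_divide powr_minus) (simp add: divide_inverse)
        finally have "\<bar>u y\<bar> powr (p - 1) * n powr (- ?q) \<le> \<bar>u y\<bar> powr (p - 1) * (c powr ?q * (1 + norm y) powr (- ?q))"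
          by (intro mult_left_mono) auto
        then have "ennreal (\<bar>u y\<bar> powr (p - 1) * n powr (- ?q)) \<le> ennreal (c powr ?q * (\<bar>u y\<bar> powr (p - 1) * (1 + norm y) powr (- ?q)))"
          by (intro ennreal_leI) (simp add: mult_ac)
        then show ?thesis using False by (simp add: n_def ennreal_mult')
      qed simp
    qed
    also have "\<dots> = ennreal (c powr ?q) * ennreal W" unfolding W(1)[symmetric] by (rule nn_integral_cmult) measurable
    also have "\<dots> = ennreal (c powr ?q * W)" by (simp add: ennreal_mult')
    also have "\<dots> \<le> ennreal (S powr (p - 1) * R powr (- (p * s)))"
    proof (rule ennreal_leI)
      have "c powr ?q * W = (c powr ?q * W * R powr (p * s)) * R powr (- (p * s))"
        using R by (simp add: powr_minus)
      also have "c powr ?q * W * R powr (p * s) = ((c powr ?q * W * R powr (p * s)) powr (1 / (p - 1))) powr (p - 1)"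
        using p W(2) by (simp add: powr_powr)
      also have "\<dots> \<le> S powr (p - 1)" using p by (intro powr_mono2) (auto simp: S_def)
      finally show "c powr ?q * W \<le> S powr (p - 1) * R powr (- (p * s))" by (simp add: mult_right_mono)
    qed
    finally show "tail_energy ?q p u z R
        \<le> ennreal (S powr (p - 1) * R powr (- (p * s)))" .
  qed
qed

text \<open>The tails are bounded at almost every centre only.  Centres converging to \<open>x\<close> give the bound outside
  \<open>cball x R\<close> by Fatou's lemma; in the remaining annulus \<open>u\<close> itself is bounded.\<close>

lemma tail_at_center:
  fixes u :: "'a::euclidean_space \<Rightarrow> real"
  assumes p: "1 < p" and s: "0 < s" and [measurable]: "u \<in> borel_measurable borel" and R: "0 < R" and S: "0 \<le> S"
    and uS: "AE z in lborel. z \<in> cball x R \<longrightarrow> \<bar>u z\<bar> \<le> S"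
    and tails: "AE z in lborel. z \<in> cball x R \<longrightarrow>
      tail_energy (real DIM('a) + p * s) p u z R
        \<le> ennreal (S powr (p - 1) * R powr (- (p * s)))"
  shows "tail_energy (real DIM('a) + p * s) p u x (R / 2)
        \<le> ennreal ((1 + kernel_const TYPE('a) (p * s)) * S powr (p - 1) * (R / 2) powr (- (p * s)))"
proof -
  let ?q = "real DIM('a) + p * s"
  let ?f = "\<lambda>z y. ennreal (\<bar>u y\<bar> powr (p - 1) * norm (y - z) powr (- ?q))"
  have ps: "0 < p * s" using p s by simp
  have "\<exists>z. z \<in> ball x (R / real (Suc n)) \<and> (\<integral>\<^sup>+y. ?f z y * indicator (- ball z R) y \<partial>lborel) \<le> ennreal (S powr (p - 1) * R powr (- (p * s)))" for n
  proof -
    have "R / real (Suc n) \<le> R" using R by (simp add: field_simps)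
    then have "AE z in lborel. z \<in> ball x (R / real (Suc n)) \<longrightarrow> (\<integral>\<^sup>+y. ?f z y * indicator (- ball z R) y \<partial>lborel) \<le> ennreal (S powr (p - 1) * R powr (- (p * s)))"
      using tails by (auto elim!: eventually_mono)
    then show ?thesis by (rule AE_ball_witness) (use R in simp, rule exI, rule conjI)
  qed
  then have "\<forall>n. \<exists>z. z \<in> ball x (R / real (Suc n)) \<and> (\<integral>\<^sup>+y. ?f z y * indicator (- ball z R) y \<partial>lborel) \<le> ennreal (S powr (p - 1) * R powr (- (p * s)))"
    by (rule allI)
  from choice[OF this] obtain z where zz: "\<forall>n. z n \<in> ball x (R / real (Suc n)) \<and>
      (\<integral>\<^sup>+y. ?f (z n) y * indicator (- ball (z n) R) y \<partial>lborel) \<le> ennreal (S powr (p - 1) * R powr (- (p * s)))"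
    by (rule exE)
  have z: "\<And>n. z n \<in> ball x (R / real (Suc n))"
    and zt: "\<And>n. (\<integral>\<^sup>+y. ?f (z n) y * indicator (- ball (z n) R) y \<partial>lborel) \<le> ennreal (S powr (p - 1) * R powr (- (p * s)))"
    by (rule conjunct1[OF spec[OF zz]], rule conjunct2[OF spec[OF zz]])
  have zx: "z \<longlonglongrightarrow> x"
  proof (rule metric_tendsto_imp_tendsto[OF LIMSEQ_inverse_real_of_nat[THEN tendsto_mult_right_zero, of R]])
    show "\<forall>\<^sub>F n in sequentially. dist (z n) x \<le> dist (R * inverse (real (Suc n))) 0"
      using z R by (auto simp: dist_commute divide_inverse less_imp_le simp del: of_nat_Suc intro!: always_eventually)
  qed
  have outer: "(\<integral>\<^sup>+y. ?f x y * indicator (- cball x R) y \<partial>lborel) \<le> ennreal (S powr (p - 1) * R powr (- (p * s)))"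
  proof -
    have "(\<integral>\<^sup>+y. ?f x y * indicator (- cball x R) y \<partial>lborel) \<le> (\<integral>\<^sup>+y. liminf (\<lambda>n. ?f (z n) y * indicator (- ball (z n) R) y) \<partial>lborel)"
    proof (rule nn_integral_mono)
      fix y
      show "?f x y * indicator (- cball x R) y \<le> liminf (\<lambda>n. ?f (z n) y * indicator (- ball (z n) R) y)"
      proof (cases "y \<in> cball x R")
        case False
        have "(\<lambda>n. dist (z n) y) \<longlonglongrightarrow> dist x y" by (intro tendsto_intros zx)
        moreover have "R < dist x y" using False by simp
        ultimately have ev: "eventually (\<lambda>n. R < dist (z n) y) sequentially" by (rule order_tendstoD)
        have "norm (y - x) \<noteq> 0" using False R by auto
        then have "(\<lambda>n. ?f (z n) y) \<longlonglongrightarrow> ?f x y"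
          by (intro tendsto_ennrealI tendsto_mult tendsto_const tendsto_powr tendsto_norm tendsto_diff zx)
        moreover have "eventually (\<lambda>n. ?f (z n) y = ?f (z n) y * indicator (- ball (z n) R) y) sequentially"
          using ev by eventually_elim auto
        ultimately have "(\<lambda>n. ?f (z n) y * indicator (- ball (z n) R) y) \<longlonglongrightarrow> ?f x y"
          by (rule Lim_transform_eventually)
        from lim_imp_Liminf[OF sequentially_bot this] show ?thesis using False by simp
      qed simp
    qed
    also have "\<dots> \<le> liminf (\<lambda>n. \<integral>\<^sup>+y. ?f (z n) y * indicator (- ball (z n) R) y \<partial>lborel)"
      by (rule nn_integral_liminf) measurable
    also have "\<dots> \<le> liminf (\<lambda>n. ennreal (S powr (p - 1) * R powr (- (p * s))))"
      by (rule Liminf_mono) (use zt in \<open>auto intro: always_eventually\<close>)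
    also have "\<dots> = ennreal (S powr (p - 1) * R powr (- (p * s)))" by (simp add: Liminf_const)
    finally show ?thesis .
  qed
  have "(\<integral>\<^sup>+y. ?f x y * indicator (- ball x (R / 2)) y \<partial>lborel)
    \<le> (\<integral>\<^sup>+y. ?f x y * indicator (- cball x R) y + ennreal (S powr (p - 1)) * (ennreal (norm (y - x) powr (- ?q)) * indicator (- ball x (R / 2)) y) \<partial>lborel)"
  proof (rule nn_integral_mono_AE, use uS in eventually_elim)
    fix y assume y: "y \<in> cball x R \<longrightarrow> \<bar>u y\<bar> \<le> S"
    show "?f x y * indicator (- ball x (R / 2)) y \<le> ?f x y * indicator (- cball x R) y + ennreal (S powr (p - 1)) * (ennreal (norm (y - x) powr (- ?q)) * indicator (- ball x (R / 2)) y)"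
    proof (cases "y \<in> cball x R")
      case True
      have "\<bar>u y\<bar> powr (p - 1) * norm (y - x) powr (- ?q) \<le> S powr (p - 1) * norm (y - x) powr (- ?q)"
        using y True p by (intro mult_right_mono powr_mono2) auto
      then have "?f x y \<le> ennreal (S powr (p - 1)) * ennreal (norm (y - x) powr (- ?q))"
        by (simp add: ennreal_mult'[symmetric] ennreal_leI)
      then show ?thesis using True by (cases "y \<in> ball x (R / 2)") auto
    next
      case False
      then have "y \<notin> ball x (R / 2)" using R by auto
      then show ?thesis using False by simp
    qed
  qed
  also have "\<dots> = (\<integral>\<^sup>+y. ?f x y * indicator (- cball x R) y \<partial>lborel)
      + ennreal (S powr (p - 1)) * (\<integral>\<^sup>+y. ennreal (norm (y - x) powr (- ?q)) * indicator (- ball x (R / 2)) y \<partial>lborel)"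
  proof -
    have m: "(\<lambda>y. ennreal (norm (y - x) powr (- ?q)) * indicator (- ball x (R / 2)) y) \<in> borel_measurable lborel" by measurable
    show ?thesis unfolding nn_integral_cmult[OF m, symmetric] by (rule nn_integral_add) measurable
  qed
  also have "\<dots> \<le> ennreal (S powr (p - 1) * R powr (- (p * s))) + ennreal (S powr (p - 1)) * ennreal (kernel_const TYPE('a) (p * s) * (R / 2) powr (- (p * s)))"
    using R ps by (intro add_mono outer mult_left_mono kernel_far_integral) auto
  also have "\<dots> \<le> ennreal (S powr (p - 1) * (R / 2) powr (- (p * s))) + ennreal (S powr (p - 1)) * ennreal (kernel_const TYPE('a) (p * s) * (R / 2) powr (- (p * s)))"
    using R ps by (intro add_right_mono ennreal_leI mult_left_mono powr_mono2') auto
  also have "\<dots> = ennreal ((1 + kernel_const TYPE('a) (p * s)) * S powr (p - 1) * (R / 2) powr (- (p * s)))"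
    using kernel_const_pos[OF ps, of "TYPE('a)"]
    by (simp add: ennreal_mult'[symmetric] ennreal_plus[symmetric] algebra_simps del: ennreal_plus)
  finally show ?thesis .
qed

section \<open>The Hoelder estimate\<close>

lemma enn_powr_le_iff:
  assumes "0 < a" "0 \<le> S"
  shows "enn_powr X (1 / a) \<le> ennreal S \<longleftrightarrow> X \<le> ennreal (S powr a)"
proof (cases X)
  case (real x)
  have "x powr (1 / a) \<le> S \<longleftrightarrow> x \<le> S powr a"
  proof
    assume "x powr (1 / a) \<le> S"
    then have "(x powr (1 / a)) powr a \<le> S powr a" using assms by (intro powr_mono2) auto
    then show "x \<le> S powr a" using assms real by (simp add: powr_powr)
  next
    assume "x \<le> S powr a"
    then have "x powr (1 / a) \<le> (S powr a) powr (1 / a)" using assms real by (intro powr_mono2) auto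
    then show "x powr (1 / a) \<le> S" using assms by (simp add: powr_powr)
  qed
  then show ?thesis using assms real by (simp add: enn_powr_def)
qed (simp add: enn_powr_def top_unique)

lemma Tail_borel:
  fixes u u' :: "'a::euclidean_space \<Rightarrow> real"
  assumes [measurable]: "u' \<in> borel_measurable borel" and ae: "AE x in lborel. u x = u' x"
    and p: "1 < p" and R: "0 < R" and S: "0 \<le> S" and le: "Tail s p u z R \<le> ennreal S"
  shows "tail_energy (real DIM('a) + p * s) p u' z R
    \<le> ennreal (S powr (p - 1) * R powr (- (p * s)))"
proof -
  let ?q = "real DIM('a) + p * s"
  let ?I = "\<integral>\<^sup>+y. ennreal (\<bar>u' y\<bar> powr (p - 1) * norm (y - z) powr (- ?q)) * indicator (- ball z R) y \<partial>lborel"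
  have "(\<integral>\<^sup>+x. ennreal (\<bar>u x\<bar> powr (p - 1) / norm (x - z) powr ?q) \<partial>lebesgue_on (- ball z R))
    = (\<integral>\<^sup>+x. ennreal (\<bar>u x\<bar> powr (p - 1) / norm (x - z) powr ?q) * indicator (- ball z R) x \<partial>lebesgue)"
    by (rule nn_integral_restrict_space) simp
  also have "\<dots> = (\<integral>\<^sup>+x. ennreal (\<bar>u x\<bar> powr (p - 1) / norm (x - z) powr ?q) * indicator (- ball z R) x \<partial>lborel)"
    by (rule nn_integral_completion)
  also have "\<dots> = ?I"
    using ae by (intro nn_integral_cong_AE, eventually_elim) (simp add: powr_divide_eq)
  finally have I: "(\<integral>\<^sup>+x. ennreal (\<bar>u x\<bar> powr (p - 1) / norm (x - z) powr ?q) \<partial>lebesgue_on (- ball z R)) = ?I" .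
  have "ennreal (R powr (p * s)) * ?I \<le> ennreal (S powr (p - 1))"
    using le p S unfolding Tail_def I by (subst (asm) enn_powr_le_iff) auto
  then have "ennreal (R powr (- (p * s))) * (ennreal (R powr (p * s)) * ?I) \<le> ennreal (R powr (- (p * s))) * ennreal (S powr (p - 1))"
    by (intro mult_left_mono) auto
  moreover have "ennreal (R powr (- (p * s))) * ennreal (R powr (p * s)) = 1"
    using R by (simp add: ennreal_mult'[symmetric] powr_minus)
  ultimately have "?I \<le> ennreal (R powr (- (p * s))) * ennreal (S powr (p - 1))"
    by (simp add: mult.assoc[symmetric])
  then show ?thesis by (simp add: ennreal_mult'[symmetric] mult.commute)
qed

lemma cball_subset_of_setdist_frontier:
  fixes \<Omega> :: "'a::euclidean_space set"
  assumes "setdist \<Omega>' (frontier \<Omega>) = 2 * R" "0 < R" "x \<in> \<Omega>'" "x \<in> \<Omega>"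
  shows "cball x R \<subseteq> \<Omega>"
proof (rule ccontr)
  assume "\<not> cball x R \<subseteq> \<Omega>"
  then have "cball x R - \<Omega> \<noteq> {}" by blast
  moreover have "x \<in> cball x R \<inter> \<Omega>" using assms by simp
  then have "cball x R \<inter> \<Omega> \<noteq> {}" by blast
  ultimately have "cball x R \<inter> frontier \<Omega> \<noteq> {}"
    by (intro connected_Int_frontier connected_cball)
  then obtain y where "y \<in> cball x R" "y \<in> frontier \<Omega>" by blast
  then have "2 * R \<le> dist x y" "dist x y \<le> R"
    using setdist_le_dist[OF assms(3), of y "frontier \<Omega>"] assms(1) by auto
  then show False using assms(2) by linarith
qed

theorem theorem1p1:
  fixes \<Omega> :: "'a::euclidean_space set" and p s \<Lambda>\<^sub>1 \<Lambda>\<^sub>2 :: real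
  assumes "DIM('a) \<ge> 2"
    and "open \<Omega>" and "connected \<Omega>"
    and "p > 1" and "0 < s" and "s < 1" and "p * s < DIM('a)"
    and "0 < \<Lambda>\<^sub>1" and "\<Lambda>\<^sub>1 \<le> \<Lambda>\<^sub>2"
  shows "\<exists>\<alpha> C :: real. 0 < \<alpha> \<and> \<alpha> < 1 \<and> C > 0 \<and>
    (\<forall>(K :: 'a \<times> 'a \<Rightarrow> real) (u :: 'a \<Rightarrow> real).
       K \<in> borel_measurable lebesgue \<and>
       (AE (x, y) in lebesgue. K (x, y) = K (y, x) \<and>
          \<Lambda>\<^sub>1 \<le> K (x, y) * norm (x - y) powr (real DIM('a) + p * s) \<and>
          K (x, y) * norm (x - y) powr (real DIM('a) + p * s) \<le> \<Lambda>\<^sub>2) \<and>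
       u \<in> Linf_loc \<Omega> \<and> weak_solution s p K \<Omega> u \<longrightarrow>
       (\<exists>v. (AE x in lebesgue_on \<Omega>. u x = v x) \<and> locally_holder \<alpha> \<Omega> v \<and>
          (\<forall>\<Omega>' R. \<Omega>' \<Subset> \<Omega> \<and> setdist \<Omega>' (frontier \<Omega>) = 2 * R \<and> R > 0 \<longrightarrow>
             (\<forall>x1\<in>\<Omega>'. \<forall>x2\<in>\<Omega>'.
                ennreal \<bar>v x1 - v x2\<bar>
                \<le> ennreal C *
                  esssup (lebesgue_on {x\<in>\<Omega>. infdist x \<Omega>' \<le> R})
                    (\<lambda>x. ennreal \<bar>u x\<bar> + Tail s p u x R) *
                  ennreal ((dist x1 x2 / R) powr \<alpha>)))))"
proof -
  note \<Omega> = \<open>open \<Omega>\<close> and p = \<open>p > 1\<close> and s = \<open>0 < s\<close> \<open>s < 1\<close> and \<Lambda> = \<open>0 < \<Lambda>\<^sub>1\<close> \<open>\<Lambda>\<^sub>1 \<le> \<Lambda>\<^sub>2\<close>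
  let ?q = "real DIM('a) + p * s"
  obtain \<alpha> C where \<alpha>: "0 < \<alpha>" "\<alpha> < 1" and C: "0 < C" and decay:
    "\<And>(K :: 'a \<times> 'a \<Rightarrow> real) \<Omega> u x0 R S.
      borel_subsolution p s \<Lambda>\<^sub>1 \<Lambda>\<^sub>2 K \<Omega> u \<Longrightarrow> borel_subsolution p s \<Lambda>\<^sub>1 \<Lambda>\<^sub>2 K \<Omega> (\<lambda>x. - u x) \<Longrightarrow>
      0 < R \<Longrightarrow> cball x0 R \<subseteq> \<Omega> \<Longrightarrow> 0 < S \<Longrightarrow> AE x in lborel. x \<in> ball x0 R \<longrightarrow> \<bar>u x\<bar> \<le> S \<Longrightarrow>
      tail_energy ?q p u x0 R
        \<le> ennreal (S powr (p - 1) * R powr (- (p * s))) \<Longrightarrow>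
      \<exists>c. \<forall>r. 0 < r \<and> r \<le> R \<longrightarrow> (AE x in lborel. x \<in> ball x0 r \<longrightarrow> \<bar>u x - c\<bar> \<le> C * S * (r / R) powr \<alpha>)"
    by (rule oscillation_decay[OF p s \<Lambda>, where 'a = 'a]) (rule that)
  have kc: "0 < kernel_const TYPE('a) (p * s)" using p s by (intro kernel_const_pos) simp
  define M where "M = (1 + kernel_const TYPE('a) (p * s)) powr (1 / (p - 1))"
  have M: "1 \<le> M" unfolding M_def using kc p by (intro ge_one_powr_ge_zero) auto
  have Mp: "M powr (p - 1) = 1 + kernel_const TYPE('a) (p * s)"
    using p kc by (simp add: M_def powr_powr)
  define C' where "C' = 8 * (C + 1) * M"
  have C': "0 < C'" using C M by (simp add: C'_def)
  show ?thesis
  proof (rule exI[of _ \<alpha>], rule exI[of _ C'], intro conjI \<alpha> C' allI impI)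
    fix K :: "'a \<times> 'a \<Rightarrow> real" and u :: "'a \<Rightarrow> real"
    assume hyp: "K \<in> borel_measurable lebesgue \<and>
       (AE (x, y) in lebesgue. K (x, y) = K (y, x) \<and>
          \<Lambda>\<^sub>1 \<le> K (x, y) * norm (x - y) powr (real DIM('a) + p * s) \<and>
          K (x, y) * norm (x - y) powr (real DIM('a) + p * s) \<le> \<Lambda>\<^sub>2) \<and>
       u \<in> Linf_loc \<Omega> \<and> weak_solution s p K \<Omega> u"
    obtain u' K' where u'[measurable]: "u' \<in> borel_measurable borel" and ae: "AE x in lborel. u x = u' x"
      and sub: "borel_subsolution p s \<Lambda>\<^sub>1 \<Lambda>\<^sub>2 K' \<Omega> u'" and sub': "borel_subsolution p s \<Lambda>\<^sub>1 \<Lambda>\<^sub>2 K' \<Omega> (\<lambda>x. - u' x)"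
      by (rule borel_representative[OF p \<Lambda>(1), where K = K and u = u and \<Omega> = \<Omega> and s = s and ?\<Lambda>2.0 = "\<Lambda>\<^sub>2"])
         (use hyp in auto)
    have tail: "(\<integral>\<^sup>+x. ennreal (\<bar>u' x\<bar> powr (p - 1) * (1 + norm x) powr (- ?q)) \<partial>lborel) < \<infinity>"
      using sub by (simp add: borel_subsolution_def)
    have bdd: "\<exists>M. AE x in lborel. x \<in> B \<longrightarrow> \<bar>u' x\<bar> \<le> M" if "compact B" "B \<subseteq> \<Omega>" for B
    proof -
      have "u \<in> Linf_loc \<Omega>" using hyp by blast
      with that obtain M where "AE x in lebesgue_on B. \<bar>u x\<bar> \<le> M" unfolding Linf_loc_def by blast
      moreover have "B \<in> sets lebesgue" using that(1) by (simp add: compact_imp_closed borel_closed)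
      ultimately have "AE x in lborel. x \<in> B \<longrightarrow> \<bar>u x\<bar> \<le> M"
        by (simp add: AE_restrict_space_iff AE_lborel_iff)
      then have "AE x in lborel. x \<in> B \<longrightarrow> \<bar>u' x\<bar> \<le> M" using ae by eventually_elim auto
      then show ?thesis by blast
    qed
    define v where "v = ess_limit u'"
    have osc: "osc_at \<alpha> C u' x R S"
      if data: "0 < R" "cball x R \<subseteq> \<Omega>" "0 < S" "AE y in lborel. y \<in> ball x R \<longrightarrow> \<bar>u' y\<bar> \<le> S"
        "tail_energy ?q p u' x R
          \<le> ennreal (S powr (p - 1) * R powr (- (p * s)))" for x R S
    proof -
      obtain c where "\<forall>r. 0 < r \<and> r \<le> R \<longrightarrow> (AE y in lborel. y \<in> ball x r \<longrightarrow> \<bar>u' y - c\<bar> \<le> C * S * (r / R) powr \<alpha>)"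
        using decay[OF sub sub' data] by blast
      then show ?thesis using data(1,4) \<alpha>(1) by (intro osc_atI[where c = c]) auto
    qed
    have osc_uniform: "\<exists>R S. 0 < R \<and> 0 < S \<and> (\<forall>z\<in>A. osc_at \<alpha> C u' z R S)" if A: "compact A" "A \<subseteq> \<Omega>" "A \<noteq> {}" for A
    proof (rule uniform_local_data[OF p s(1) u' bdd tail A \<Omega>])
      fix R S :: real
      assume d: "0 < R" "0 < S" "\<And>z. z \<in> A \<Longrightarrow> cball z R \<subseteq> \<Omega>"
        "\<And>z. z \<in> A \<Longrightarrow> AE x in lborel. x \<in> ball z R \<longrightarrow> \<bar>u' x\<bar> \<le> S"
        "\<And>z. z \<in> A \<Longrightarrow> tail_energy ?q p u' z R
          \<le> ennreal (S powr (p - 1) * R powr (- (p * s)))"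
      show ?thesis
        by (intro exI[of _ R] exI[of _ S] conjI ballI d(1,2) osc d(3,4,5))
    qed
    show "\<exists>v. (AE x in lebesgue_on \<Omega>. u x = v x) \<and> locally_holder \<alpha> \<Omega> v \<and>
          (\<forall>\<Omega>' R. \<Omega>' \<Subset> \<Omega> \<and> setdist \<Omega>' (frontier \<Omega>) = 2 * R \<and> R > 0 \<longrightarrow>
             (\<forall>x1\<in>\<Omega>'. \<forall>x2\<in>\<Omega>'.
                ennreal \<bar>v x1 - v x2\<bar>
                \<le> ennreal C' *
                  esssup (lebesgue_on {x\<in>\<Omega>. infdist x \<Omega>' \<le> R})
                    (\<lambda>x. ennreal \<bar>u x\<bar> + Tail s p u x R) *
                  ennreal ((dist x1 x2 / R) powr \<alpha>)))"
    proof (intro exI[of _ v] conjI allI impI ballI)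
      have "AE x in lborel. x \<in> \<Omega> \<longrightarrow> u' x = v x"
        unfolding v_def
      proof (rule ess_limit_ae[OF _ C \<alpha>(1) less_imp_le[OF \<alpha>(2)]])
        fix y assume "y \<in> \<Omega>"
        then obtain \<rho> where \<rho>: "0 < \<rho>" "cball y \<rho> \<subseteq> \<Omega>" using \<Omega> open_contains_cball by blast
        obtain R S where "0 < R" "0 < S" "\<forall>z\<in>cball y \<rho>. osc_at \<alpha> C u' z R S"
          using osc_uniform[of "cball y \<rho>"] \<rho> by auto
        then show "\<exists>\<rho> R S. 0 < \<rho> \<and> 0 < R \<and> 0 < S \<and> (\<forall>z\<in>ball y \<rho>. osc_at \<alpha> C u' z R S)"
          using \<rho>(1) by (meson ball_subset_cball subset_iff)
      qed
      then have "AE x in lborel. x \<in> \<Omega> \<longrightarrow> u x = v x" using ae by eventually_elim auto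
      then show "AE x in lebesgue_on \<Omega>. u x = v x"
        using \<Omega> by (simp add: AE_restrict_space_iff AE_lborel_iff)
    next
      show "locally_holder \<alpha> \<Omega> v"
        unfolding locally_holder_def
      proof (intro allI impI)
        fix A assume A: "A \<Subset> \<Omega>"
        show "\<exists>M. \<forall>x\<in>A. \<forall>y\<in>A. \<bar>v x - v y\<bar> \<le> M * dist x y powr \<alpha>"
        proof (cases "A = {}")
          case False
          then have "closure A \<noteq> {}" by simp
          with A obtain R S where RS: "0 < R" "0 < S" "\<And>z. z \<in> closure A \<Longrightarrow> osc_at \<alpha> C u' z R S"
            using osc_uniform[of "closure A"] unfolding compactly_in_def by blast
          have "\<bar>v x - v y\<bar> \<le> 4 * (C + 1) * S / R powr \<alpha> * dist x y powr \<alpha>" if "x \<in> A" "y \<in> A" for x y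
          proof -
            have "\<bar>v x - v y\<bar> \<le> 4 * (C + 1) * S * (dist x y / R) powr \<alpha>"
              unfolding v_def using that closure_subset[of A] RS C \<alpha> by (intro ess_limit_holder) auto
            then show ?thesis by (simp add: powr_divide)
          qed
          then show ?thesis by blast
        qed simp
      qed
    next
      fix \<Omega>' R x1 x2
      assume h: "\<Omega>' \<Subset> \<Omega> \<and> setdist \<Omega>' (frontier \<Omega>) = 2 * R \<and> R > 0" and x1: "x1 \<in> \<Omega>'" and x2: "x2 \<in> \<Omega>'"
      define W where "W = {x\<in>\<Omega>. infdist x \<Omega>' \<le> R}"
      define E where "E = esssup (lebesgue_on W) (\<lambda>x. ennreal \<bar>u x\<bar> + Tail s p u x R)"
      have R: "0 < R" using h by simp
      have in\<Omega>: "\<Omega>' \<subseteq> \<Omega>" using h closure_subset unfolding compactly_in_def by blast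
      have cbW: "cball x R \<subseteq> W" if "x \<in> \<Omega>'" for x
      proof
        fix y assume y: "y \<in> cball x R"
        have "infdist y \<Omega>' \<le> dist y x" using that by (rule infdist_le)
        moreover have "cball x R \<subseteq> \<Omega>"
          by (rule cball_subset_of_setdist_frontier) (use h that in\<Omega> in auto)
        then have "y \<in> \<Omega>" using y by blast
        ultimately show "y \<in> W" using y by (simp add: W_def dist_commute)
      qed
      have Wm: "W \<in> sets lebesgue"
      proof -
        have "W = \<Omega> \<inter> {x. infdist x \<Omega>' \<le> R}" by (auto simp: W_def)
        moreover have "closed {x. infdist x \<Omega>' \<le> R}"
          by (intro closed_Collect_le continuous_intros)
        ultimately have "W \<in> sets borel" using \<Omega> by auto
        then show ?thesis by simp
      qed
      have "ennreal \<bar>v x1 - v x2\<bar> \<le> ennreal C' * E * ennreal ((dist x1 x2 / R) powr \<alpha>)"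
      proof (cases "x1 = x2")
        case False
        then have d: "0 < (dist x1 x2 / R) powr \<alpha>" using R by simp
        show ?thesis
        proof (cases E)
          case top
          then show ?thesis using d C' by (simp add: ennreal_mult_top ennreal_top_mult)
        next
          case (real S0)
          have "AE x in lebesgue_on W. ennreal \<bar>u x\<bar> + Tail s p u x R \<le> E"
            unfolding E_def by (rule esssup_AE)
          then have W_ae: "AE x in lborel. x \<in> W \<longrightarrow> ennreal \<bar>u x\<bar> + Tail s p u x R \<le> ennreal S0"
            using Wm real by (simp add: AE_restrict_space_iff AE_lborel_iff)
          have "\<bar>v x1 - v x2\<bar> \<le> C' * (S0 + e) * (dist x1 x2 / R) powr \<alpha>" if e: "0 < e" for e
          proof -
            \<comment> \<open>\<open>M\<close> pays for the passage from the tails at almost every centre to the tail at \<open>x\<close> and for halving the radius; \<open>e\<close> keeps \<open>S\<close> positive\<close>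
            define S where "S = M * (S0 + e)"
            have S0e: "0 < S0 + e" using real e by simp
            have S: "0 < S" "S0 + e \<le> S" using M S0e by (auto simp: S_def)
            have "osc_at \<alpha> C u' x (R / 2) S" if x: "x \<in> \<Omega>'" for x
            proof (rule osc)
              have bound: "AE y in lborel. y \<in> cball x R \<longrightarrow> \<bar>u' y\<bar> \<le> S0 + e"
                using W_ae ae
              proof eventually_elim
                case (elim y)
                show ?case
                proof
                  assume "y \<in> cball x R"
                  then have "ennreal \<bar>u y\<bar> + Tail s p u y R \<le> ennreal S0" using elim cbW[OF x] by blast
                  then have "ennreal \<bar>u y\<bar> \<le> ennreal S0" by (rule order_trans[rotated]) simp
                  then show "\<bar>u' y\<bar> \<le> S0 + e" using elim real e by simp
                qed
              qed
              have tails: "AE z in lborel. z \<in> cball x R \<longrightarrow>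
                tail_energy ?q p u' z R
                  \<le> ennreal ((S0 + e) powr (p - 1) * R powr (- (p * s)))"
                using W_ae
              proof eventually_elim
                case (elim z)
                show ?case
                proof
                  assume "z \<in> cball x R"
                  then have "ennreal \<bar>u z\<bar> + Tail s p u z R \<le> ennreal S0" using elim cbW[OF x] by blast
                  then have "Tail s p u z R \<le> ennreal S0" by (rule order_trans[rotated]) simp
                  also have "\<dots> \<le> ennreal (S0 + e)" using e by (intro ennreal_leI) simp
                  finally show "tail_energy ?q p u' z R
                    \<le> ennreal ((S0 + e) powr (p - 1) * R powr (- (p * s)))"
                    using S0e by (intro Tail_borel[OF u' ae p R]) auto
                qed
              qed
              show "0 < R / 2" using R by simp
              have "cball x (R / 2) \<subseteq> cball x R" using R by auto
              also have "\<dots> \<subseteq> W" by (rule cbW[OF x])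
              also have "\<dots> \<subseteq> \<Omega>" by (auto simp: W_def)
              finally show "cball x (R / 2) \<subseteq> \<Omega>" .
              show "0 < S" by (rule S)
              show "AE y in lborel. y \<in> ball x (R / 2) \<longrightarrow> \<bar>u' y\<bar> \<le> S"
                using bound by eventually_elim (use S R in auto)
              have "tail_energy ?q p u' x (R / 2)
                \<le> ennreal ((1 + kernel_const TYPE('a) (p * s)) * (S0 + e) powr (p - 1) * (R / 2) powr (- (p * s)))"
                by (rule tail_at_center[OF p s(1) u' R _ bound tails]) (use S0e in simp)
              also have "(1 + kernel_const TYPE('a) (p * s)) * (S0 + e) powr (p - 1) = S powr (p - 1)"
                by (simp only: S_def powr_mult Mp)
              finally show "tail_energy ?q p u' x (R / 2)
                \<le> ennreal (S powr (p - 1) * (R / 2) powr (- (p * s)))" .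
            qed
            then have "\<bar>v x1 - v x2\<bar> \<le> 4 * (C + 1) * S * (dist x1 x2 / (R / 2)) powr \<alpha>"
              unfolding v_def using x1 x2 R S C \<alpha> by (intro ess_limit_holder) auto
            also have "(dist x1 x2 / (R / 2)) powr \<alpha> = 2 powr \<alpha> * (dist x1 x2 / R) powr \<alpha>"
              by (simp add: powr_mult[symmetric] mult.commute)
            also have "4 * (C + 1) * S * (2 powr \<alpha> * (dist x1 x2 / R) powr \<alpha>) \<le> 4 * (C + 1) * S * (2 powr 1 * (dist x1 x2 / R) powr \<alpha>)"
              using C S \<alpha> by (intro mult_left_mono mult_right_mono powr_mono) auto
            also have "\<dots> = C' * (S0 + e) * (dist x1 x2 / R) powr \<alpha>" by (simp add: C'_def S_def)
            finally show ?thesis .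
          qed
          note approx = this
          have "\<bar>v x1 - v x2\<bar> \<le> C' * S0 * (dist x1 x2 / R) powr \<alpha>"
          proof (rule field_le_epsilon)
            fix \<delta> :: real assume \<delta>: "0 < \<delta>"
            define e where "e = \<delta> / (C' * (dist x1 x2 / R) powr \<alpha>)"
            have "0 < e" using \<delta> C' d by (simp add: e_def)
            from approx[OF this] show "\<bar>v x1 - v x2\<bar> \<le> C' * S0 * (dist x1 x2 / R) powr \<alpha> + \<delta>"
              using C' d by (simp add: e_def field_simps)
          qed
          then have "ennreal \<bar>v x1 - v x2\<bar> \<le> ennreal (C' * S0 * (dist x1 x2 / R) powr \<alpha>)" by (rule ennreal_leI)
          also have "\<dots> = ennreal C' * E * ennreal ((dist x1 x2 / R) powr \<alpha>)"
            using real C' by (simp add: ennreal_mult')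
          finally show ?thesis .
        qed
      qed simp
      then show "ennreal \<bar>v x1 - v x2\<bar> \<le> ennreal C' *
                  esssup (lebesgue_on {x\<in>\<Omega>. infdist x \<Omega>' \<le> R}) (\<lambda>x. ennreal \<bar>u x\<bar> + Tail s p u x R) *
                  ennreal ((dist x1 x2 / R) powr \<alpha>)"
        unfolding E_def W_def .
    qed
  qed
qed

end
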